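(* Let $D_1,D_2$ be positive coprime fundamental discriminants, let $n$ be an integer with $|n|<\sqrt{D_1D_2}$ and $n\equiv D_1D_2\pmod 2$, and factorize $$\frac{D_1D_2-n^2}{4}=\prod_{i=1}^{r}p_i^{2e_i+1}\prod_{i=1}^{s}q_i^{2f_i}\prod_{i=1}^{t}w_i^{g_i},$$ where the $p_i$ are the primes with $\epsilon(p_i)=-1$ that appear to an odd power, the $q_i$ are the primes with $\epsilon(q_i)=-1$ that appear to an even (positive) power, and the $w_i$ are the primes with $\epsilon(w_i)=1$ that appear. Then $p(n)=0$ if and only if $r>0$, and when $r=0$, $$p(n)=2\prod_{i=1}^{t}(g_i+1)=2\sum_{d\mid\frac{D_1D_2-n^2}{4}}\epsilon(d)=2\,r_{L/K}\!\left(\left\langle\frac{\sqrt{D_1D_2}-n}{2}\right\rangle\right).$$ Moreover, the equalities $$p(n)=2\sum_{d\mid\frac{D_1D_2-n^2}{4}}\epsilon(d)=2\,r_{L/K}\!\left(\left\langle\frac{\sqrt{D_1D_2}-n}{2}\right\rangle\right)$$ are also valid when $r>0$. (Sums over $d$ run over positive divisors.)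
   Context: A positive fundamental discriminant is the discriminant of a real quadratic field (in particular it is not $1$). Write $[A,B,C]$ for the integral form $Ax^2+Bxy+Cy^2$, with discriminant $\mathrm{disc}=B^2-4AC$. $\mathrm{PSL}(2,\mathbb Z)$ acts on forms by $(\gamma\circ q)(x,y)=q(ax+by,cx+dy)$ for $\gamma=\begin{pmatrix}a&b\\c&d\end{pmatrix}$, and $(q_1,q_2)\sim_2(q_1',q_2')$ means there is a single $\gamma\in\mathrm{PSL}(2,\mathbb Z)$ with $\gamma\circ q_i=q_i'$ for $i=1,2$. Put $$B_\Delta([A_1,B_1,C_1],[A_2,B_2,C_2])=B_1B_2-2A_1C_2-2A_2C_1,$$ $$p(n)=\left|\{(q_1,q_2):\mathrm{disc}(q_1)=D_1,\ \mathrm{disc}(q_2)=D_2,\ B_\Delta(q_1,q_2)=n\}/\sim_2\right| .$$ For a prime $p$ with Kronecker symbol $\left(\frac{D_1D_2}{p}\right)\ne-1$, $\epsilon(p)$ is the nonzero value in the set $\left\{\left(\frac{D_1}{p}\right),\left(\frac{D_2}{p}\right)\right\}$ (if both are nonzero they agree); $\epsilon$ is extended (completely) multiplicatively to positive integers all of whose prime factors satisfy this condition. All prime divisors $p$ of $\frac{D_1D_2-n^2}{4}$ with $n\equiv D_1D_2\pmod 2$ satisfy it. $K=\mathbb Q(\sqrt{D_1D_2})$, $L=\mathbb Q(\sqrt{D_1},\sqrt{D_2})$, and for an integral ideal $\mathfrak a$ of $K$, $r_{L/K}(\mathfrak a)$ is the number of integral ideals $\mathfrak A$ of $L$ with $N_{L/K}(\mathfrak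 A)=\mathfrak a$. $\langle x\rangle$ denotes the principal ideal of the ring of integers of $K$ generated by $x$. *)

theory Defs
  imports
    "HOL-Algebra.Generated_Fields"
    "HOL-Algebra.Ideal"
    "HOL-Analysis.Analysis"
    "HOL-Number_Theory.Number_Theory"
    "HOL-Computational_Algebra.Squarefree"
begin

section \<open>Number fields as subfields of the complex numbers\<close>

definition complex_ring :: "complex ring" where
  "complex_ring = \<lparr>carrier = UNIV, monoid.mult = (*), one = 1, zero = 0, add = (+)\<rparr>"

text \<open>The field \<open>\<rat>(S)\<close>; the prime field is automatically contained in it.\<close>

definition adjoin :: "complex set \<Rightarrow> complex set" where
  "adjoin S = generate_field complex_ring S"

definition integers_ring :: "complex set \<Rightarrow> complex ring" where
  "integers_ring K = complex_ring\<lparr>carrier := {x \<in> K. algebraic_int x}\<rparr>"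

text \<open>Embeddings of \<open>L\<close> into the complex numbers over \<open>K\<close>. Embeddings are taken to be
  extensional on \<open>L\<close>, so that distinct functions are distinct embeddings.\<close>

definition embeddings :: "complex set \<Rightarrow> complex set \<Rightarrow> (complex \<Rightarrow> complex) set" where
  "embeddings K L = {\<sigma> \<in> ring_hom (complex_ring\<lparr>carrier := L\<rparr>) complex_ring.
                       \<sigma> \<in> extensional L \<and> (\<forall>x\<in>K. \<sigma> x = x)}"

definition rel_norm :: "complex set \<Rightarrow> complex set \<Rightarrow> complex \<Rightarrow> complex" where
  "rel_norm K L x = (\<Prod>\<sigma>\<in>embeddings K L. \<sigma> x)"

definition rel_trace :: "complex set \<Rightarrow> complex set \<Rightarrow> complex \<Rightarrow> complex" where
  "rel_trace K L x = (\<Sum>\<sigma>\<in>embeddings K L. \<sigma> x)"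

text \<open>The relative norm of an ideal \<open>A\<close> of the integers of \<open>L\<close> is the ideal of the integers
  of \<open>K\<close> generated by the norms of the elements of \<open>A\<close>.\<close>

definition rel_ideal_norm :: "complex set \<Rightarrow> complex set \<Rightarrow> complex set \<Rightarrow> complex set" where
  "rel_ideal_norm K L A = Idl\<^bsub>integers_ring K\<^esub> (rel_norm K L ` A)"

definition ideals_of_norm :: "complex set \<Rightarrow> complex set \<Rightarrow> complex set \<Rightarrow> complex set set" where
  "ideals_of_norm K L \<aa> = {A. ideal A (integers_ring L) \<and> rel_ideal_norm K L A = \<aa>}"

definition num_ideals_of_norm :: "complex set \<Rightarrow> complex set \<Rightarrow> complex set \<Rightarrow> nat" where
  "num_ideals_of_norm K L \<aa> = card (ideals_of_norm K L \<aa>)"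


section \<open>Fundamental discriminants\<close>

definition real_quadratic_field :: "complex set \<Rightarrow> bool" where
  "real_quadratic_field K \<longleftrightarrow> (\<exists>m::int. m > 1 \<and> squarefree m \<and> K = adjoin {csqrt (of_int m)})"

definition quadratic_integral_basis :: "complex set \<Rightarrow> complex \<Rightarrow> complex \<Rightarrow> bool" where
  "quadratic_integral_basis K v w \<longleftrightarrow>
     v \<in> carrier (integers_ring K) \<and> w \<in> carrier (integers_ring K) \<and>
     (\<forall>x\<in>carrier (integers_ring K). \<exists>!(a, b). x = of_int a * v + of_int b * w)"

text \<open>The discriminant is the determinant of the trace form on an integral basis.\<close>

definition quadratic_field_disc :: "complex set \<Rightarrow> int \<Rightarrow> bool" where
  "quadratic_field_disc K D \<longleftrightarrow>
     (\<exists>v w. quadratic_integral_basis K v w \<and>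
        of_int D = rel_trace \<rat> K (v * v) * rel_trace \<rat> K (w * w)
                   - rel_trace \<rat> K (v * w) * rel_trace \<rat> K (w * v))"

definition pos_fundamental_disc :: "int \<Rightarrow> bool" where
  "pos_fundamental_disc D \<longleftrightarrow> (\<exists>K. real_quadratic_field K \<and> quadratic_field_disc K D)"


section \<open>Pairs of binary quadratic forms\<close>

text \<open>The triple \<open>(A, B, C)\<close> is the form \<open>A x\<^sup>2 + B x y + C y\<^sup>2\<close>.\<close>

type_synonym qform = "int \<times> int \<times> int"

fun form_eval :: "qform \<Rightarrow> int \<Rightarrow> int \<Rightarrow> int" where
  "form_eval (A, B, C) x y = A * x\<^sup>2 + B * x * y + C * y\<^sup>2"

fun form_disc :: "qform \<Rightarrow> int" where
  "form_disc (A, B, C) = B\<^sup>2 - 4 * A * C"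

fun B_Delta :: "qform \<Rightarrow> qform \<Rightarrow> int" where
  "B_Delta (A1, B1, C1) (A2, B2, C2) = B1 * B2 - 2 * A1 * C2 - 2 * A2 * C1"

fun form_act :: "int \<Rightarrow> int \<Rightarrow> int \<Rightarrow> int \<Rightarrow> qform \<Rightarrow> qform" where
  "form_act a b c d (A, B, C) =
     (A * a\<^sup>2 + B * a * c + C * c\<^sup>2,
      2 * A * a * b + B * (a * d + b * c) + 2 * C * c * d,
      A * b\<^sup>2 + B * b * d + C * d\<^sup>2)"

lemma form_eval_act: "form_eval (form_act a b c d q) x y = form_eval q (a * x + b * y) (c * x + d * y)"
  by (cases q) (simp add: power2_eq_square algebra_simps)

text \<open>As \<open>- I\<close> acts trivially, an element of \<open>PSL(2,\<int>)\<close> is given by a matrix in \<open>SL(2,\<int>)\<close>.\<close>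

definition sim2 :: "((qform \<times> qform) \<times> (qform \<times> qform)) set" where
  "sim2 = {((q1, q2), (q1', q2')). \<exists>a b c d. a * d - b * c = 1 \<and>
             form_act a b c d q1 = q1' \<and> form_act a b c d q2 = q2'}"

lemma form_act_minus: "form_act (- a) (- b) (- c) (- d) q = form_act a b c d q"
  by (cases q) (simp add: algebra_simps)

lemma form_act_id: "form_act 1 0 0 1 q = q"
  by (cases q) simp

lemma form_act_act:
  "form_act a' b' c' d' (form_act a b c d q) =
   form_act (a * a' + b * c') (a * b' + b * d') (c * a' + d * c') (c * b' + d * d') q"
  by (cases q) (simp add: power2_eq_square algebra_simps)

lemma equiv_sim2: "equiv UNIV sim2"
proof (rule equivI)
  show "refl sim2"
  proof (rule reflI, clarify)
    fix q1 q2
    have "(1::int) * 1 - 0 * 0 = 1" by simp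
    then show "((q1, q2), (q1, q2)) \<in> sim2"
      unfolding sim2_def using form_act_id by blast
  qed
  show "sym sim2"
  proof (rule symI, clarify)
    fix q1 q2 q1' q2'
    assume "((q1, q2), (q1', q2')) \<in> sim2"
    then obtain a b c d where det: "a * d - b * c = 1"
      and q': "q1' = form_act a b c d q1" "q2' = form_act a b c d q2"
      unfolding sim2_def by auto
    have "form_act d (- b) (- c) a (form_act a b c d q) = q" for q
    proof -
      have "form_act d (- b) (- c) a (form_act a b c d q) = form_act 1 0 0 1 q"
        unfolding form_act_act using det by (simp add: algebra_simps)
      then show ?thesis by (simp add: form_act_id)
    qed
    moreover have "d * a - (- b) * (- c) = 1" using det by (simp add: algebra_simps)
    ultimately show "((q1', q2'), (q1, q2)) \<in> sim2"
      unfolding sim2_def q' by blast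
  qed
  show "trans sim2"
  proof (rule transI, clarify)
    fix q1 q2 q1' q2' q1'' q2''
    assume "((q1, q2), (q1', q2')) \<in> sim2" "((q1', q2'), (q1'', q2'')) \<in> sim2"
    then obtain a b c d a' b' c' d' where det: "a * d - b * c = 1" "a' * d' - b' * c' = 1"
      and q': "q1' = form_act a b c d q1" "q2' = form_act a b c d q2"
      and q'': "q1'' = form_act a' b' c' d' q1'" "q2'' = form_act a' b' c' d' q2'"
      unfolding sim2_def by auto
    have "(a * a' + b * c') * (c * b' + d * d') - (a * b' + b * d') * (c * a' + d * c')
          = (a * d - b * c) * (a' * d' - b' * c')"
      by (simp add: algebra_simps)
    with det have "(a * a' + b * c') * (c * b' + d * d') - (a * b' + b * d') * (c * a' + d * c') = 1"
      by simp
    then show "((q1, q2), (q1'', q2'')) \<in> sim2"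
      unfolding sim2_def q'' q' form_act_act by blast
  qed
qed simp

definition form_pairs :: "int \<Rightarrow> int \<Rightarrow> int \<Rightarrow> (qform \<times> qform) set" where
  "form_pairs D1 D2 n =
     {(q1, q2). form_disc q1 = D1 \<and> form_disc q2 = D2 \<and> B_Delta q1 q2 = n}"

lemma form_pairs_sim2:
  assumes "((q1, q2), (q1', q2')) \<in> sim2" "(q1, q2) \<in> form_pairs D1 D2 n"
  shows "(q1', q2') \<in> form_pairs D1 D2 n"
proof -
  obtain a b c d where det: "a * d - b * c = 1"
    and q': "q1' = form_act a b c d q1" "q2' = form_act a b c d q2"
    using assms(1) unfolding sim2_def by auto
  have B: "B_Delta (form_act a b c d q) (form_act a b c d r) = (a * d - b * c)\<^sup>2 * B_Delta q r"
    for q r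
    by (cases q; cases r) (simp add: power2_eq_square algebra_simps)
  have D: "form_disc q = B_Delta q q" for q
    by (cases q) (simp add: power2_eq_square)
  show ?thesis
    using assms(2) by (simp add: form_pairs_def D q' B det)
qed

definition form_pair_classes :: "int \<Rightarrow> int \<Rightarrow> int \<Rightarrow> (qform \<times> qform) set set" where
  "form_pair_classes D1 D2 n = form_pairs D1 D2 n // sim2"

definition num_classes :: "int \<Rightarrow> int \<Rightarrow> int \<Rightarrow> nat" where
  "num_classes D1 D2 n = card (form_pair_classes D1 D2 n)"


section \<open>The character \<open>\<epsilon>\<close>\<close>

text \<open>The Kronecker symbol with a prime lower argument.\<close>

definition kronecker_prime :: "int \<Rightarrow> nat \<Rightarrow> int" where
  "kronecker_prime D p =
     (if p = 2 then (if even D then 0 else if D mod 8 \<in> {1, 7} then 1 else - 1)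
      else Legendre D (int p))"

text \<open>The description determines a value when \<open>D1\<close>, \<open>D2\<close> are coprime and
  \<open>kronecker_prime (D1 * D2) p \<noteq> - 1\<close>; otherwise the value is arbitrary.\<close>

definition eps_prime :: "int \<Rightarrow> int \<Rightarrow> nat \<Rightarrow> int" where
  "eps_prime D1 D2 p = (THE v. v \<noteq> 0 \<and> v \<in> {kronecker_prime D1 p, kronecker_prime D2 p})"

definition eps :: "int \<Rightarrow> int \<Rightarrow> nat \<Rightarrow> int" where
  "eps D1 D2 m = (\<Prod>p\<in>prime_factors m. eps_prime D1 D2 p ^ multiplicity p m)"

end

theory Submission
  imports Defs "HOL-Computational_Algebra.Nth_Powers" "Jordan_Normal_Form.Char_Poly"
begin

text \<open>Both sides are matched with the same finite set. The forms \<open>q1, q2\<close> span a lattice on which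
  the discriminant is \<open>f(x, y) = D1 x\<^sup>2 + 2 n x y + D2 y\<^sup>2\<close>, and \<open>f\<close> represents primitively some odd
  \<open>D\<close> coprime to \<open>N = (D1 D2 - n\<^sup>2) / 4\<close>, so that \<open>\<epsilon>(p) = (D / p)\<close> for every prime \<open>p\<close> dividing \<open>N\<close>.
  After a change of basis \<open>q1\<close> has discriminant \<open>D\<close>. A pair then amounts to an embedding of \<open>f\<close> into
  the ternary lattice of all binary forms, equipped with the discriminant. This lattice has
  determinant \<open>-4\<close>, it is the only such lattice up to isometry (Hermite reduction), and its proper
  isometries come from \<open>GL(2,\<int>)\<close>. So the pairs with a given sign of the Jacobian \<open>q1 \<times> q2\<close> are
  classified by the index \<open>e\<close> of \<open>\<langle>q1, q2\<rangle>\<close> in its saturation together with a root \<open>k\<close> modulo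
  \<open>M = N / e\<^sup>2\<close> of \<open>(2k + 1)\<^sup>2 \<equiv> D (mod 4M)\<close>; the two signs give the factor 2.

  On the other side put \<open>\<alpha> = (\<surd>(D1 D2) - n) / 2\<close> and \<open>\<theta> = (1 + x \<surd>D1 + y \<surd>D2) / 2\<close> with \<open>f(x, y) = D\<close>.
  The integers of \<open>L\<close> modulo \<open>\<alpha>\<close> form \<open>(\<int>/N)[\<theta>]\<close>, and an ideal of norm \<open>\<langle>\<alpha>\<rangle>\<close> contains \<open>\<alpha>\<close>. Hence it is
  generated by \<open>\<alpha>\<close>, \<open>e M\<close> and \<open>e (k + \<theta>)\<close> for a unique triple \<open>(e, M, k)\<close> as above. The triples are
  counted prime by prime.\<close>

section \<open>Indefinite ternary forms of determinant -4\<close>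

text \<open>Neither D1 nor D2 need be prime to N, so projecting a pair along its first form may fail
  to be invertible, and \<epsilon> switches between two symbols. The value D repairs both: it is
  invertible modulo 4N, the change of basis keeps the determinant 4N of the pair, and x s1 + y s2
  (with s1, s2 the roots of D1, D2) squares to D modulo \<alpha>. Writing roots of D modulo 4M as 2k
  + 1 keeps p = 2 uniform, because 2k + 1 is also the derivative of k^2 + k - (D - 1)/4. A matrix of
  determinant -1 followed by negation of all forms is a proper isometry of the ternary lattice but
  not an element of PSL(2,Z). It reverses the sign of the Jacobian, which is definite because its
  determinant is N > 0; so a triple (e, M, k) accounts for exactly two classes. Beyond residues
  modulo 4, fundamentality enters on the ideal side: for the integers of L, and for showing that the
  norms from an ideal with e^2 M = N generate all of the ideal of \<alpha>. There a prime p dividing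
  e, n and D1 D2 would make D1 D2 / p^2 a discriminant.\<close>

fun qadd :: "qform \<Rightarrow> qform \<Rightarrow> qform" where
  "qadd (A, B, C) (A', B', C') = (A + A', B + B', C + C')"

fun qscale :: "int \<Rightarrow> qform \<Rightarrow> qform" where
  "qscale k (A, B, C) = (k * A, k * B, k * C)"

lemma B_Delta_bilinear:
  "B_Delta (qadd p q) r = B_Delta p r + B_Delta q r"
  "B_Delta r (qadd p q) = B_Delta r p + B_Delta r q"
  "B_Delta (qscale k p) r = k * B_Delta p r"
  "B_Delta r (qscale k p) = k * B_Delta r p"
  by (cases p; cases q; cases r; simp add: algebra_simps)+

lemma B_Delta_commute: "B_Delta p q = B_Delta q p"
  by (cases p; cases q; simp)

lemma form_disc_conv_B_Delta: "form_disc q = B_Delta q q"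
  by (cases q) (simp add: power2_eq_square)

text \<open>A symmetric \<open>3 \<times> 3\<close> matrix is given by its diagonal \<open>a, b, c\<close> and the entries \<open>f, g, h\<close> at
  positions \<open>(2, 3)\<close>, \<open>(1, 3)\<close>, \<open>(1, 2)\<close>. The congruences in \<open>disc_like\<close> hold for every Gram matrix
  of forms, with \<open>l1, l2, l3\<close> the middle coefficients.\<close>

definition realizable :: "int \<Rightarrow> int \<Rightarrow> int \<Rightarrow> int \<Rightarrow> int \<Rightarrow> int \<Rightarrow> bool" where
  "realizable a b c f g h \<longleftrightarrow> (\<exists>q1 q2 q3. B_Delta q1 q1 = a \<and> B_Delta q2 q2 = b \<and> B_Delta q3 q3 = c \<and>
     B_Delta q2 q3 = f \<and> B_Delta q1 q3 = g \<and> B_Delta q1 q2 = h)"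

definition gram_det :: "int \<Rightarrow> int \<Rightarrow> int \<Rightarrow> int \<Rightarrow> int \<Rightarrow> int \<Rightarrow> int" where
  "gram_det a b c f g h = a * b * c + 2 * f * g * h - a * f\<^sup>2 - b * g\<^sup>2 - c * h\<^sup>2"

definition disc_like :: "int \<Rightarrow> int \<Rightarrow> int \<Rightarrow> int \<Rightarrow> int \<Rightarrow> int \<Rightarrow> bool" where
  "disc_like a b c f g h \<longleftrightarrow> gram_det a b c f g h = - 4 \<and>
     (\<exists>l1 l2 l3. 4 dvd a - l1\<^sup>2 \<and> 4 dvd b - l2\<^sup>2 \<and> 4 dvd c - l3\<^sup>2 \<and>
        2 dvd f - l2 * l3 \<and> 2 dvd g - l1 * l3 \<and> 2 dvd h - l1 * l2)"

section \<open>Change of basis for ternary Gram matrices\<close>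

lemma realizable_swap12: "realizable b a c g f h \<Longrightarrow> realizable a b c f g h"
  unfolding realizable_def by (metis B_Delta_commute)

lemma realizable_swap13: "realizable c b a h g f \<Longrightarrow> realizable a b c f g h"
  unfolding realizable_def by (metis B_Delta_commute)

lemma disc_like_swap12: "disc_like a b c f g h \<Longrightarrow> disc_like b a c g f h"
  unfolding disc_like_def gram_det_def
  by (auto simp: algebra_simps)

lemma disc_like_swap13: "disc_like a b c f g h \<Longrightarrow> disc_like c b a h g f"
  unfolding disc_like_def gram_det_def
  by (auto simp: algebra_simps)

text \<open>Realizability is pulled back along a change of basis, whereas \<open>disc_like\<close>
  is pushed forward. The descent needs exactly these two directions: pass to a smaller Gram matrix,
  realize it there, and undo the change on the realizing forms.\<close>

lemma realizable_shear:
  assumes "realizable a (b + 2 * x * h + x\<^sup>2 * a) c (f + x * g) g (h + x * a)"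
  shows "realizable a b c f g h"
proof -
  obtain q1 q2 q3 where q: "B_Delta q1 q1 = a" "B_Delta q2 q2 = b + 2 * x * h + x\<^sup>2 * a" "B_Delta q3 q3 = c"
     "B_Delta q2 q3 = f + x * g" "B_Delta q1 q3 = g" "B_Delta q1 q2 = h + x * a"
    using assms unfolding realizable_def by blast
  show ?thesis
    unfolding realizable_def
    by (rule exI[of _ q1], rule exI[of _ "qadd q2 (qscale (- x) q1)"], rule exI[of _ q3])
       (simp add: B_Delta_bilinear q B_Delta_commute[of q2 q1], simp add: algebra_simps power2_eq_square)
qed

lemma disc_like_shear:
  assumes "disc_like a b c f g h"
  shows "disc_like a (b + 2 * x * h + x\<^sup>2 * a) c (f + x * g) g (h + x * a)"
proof -
  obtain l1 l2 l3 where l: "4 dvd a - l1\<^sup>2" "4 dvd b - l2\<^sup>2" "4 dvd c - l3\<^sup>2"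
        "2 dvd f - l2 * l3" "2 dvd g - l1 * l3" "2 dvd h - l1 * l2"
    and det: "gram_det a b c f g h = - 4"
    using assms unfolding disc_like_def by blast
  from l obtain k1 k2 k3 k4 k5 k6 where k: "a = l1\<^sup>2 + 4 * k1" "b = l2\<^sup>2 + 4 * k2" "c = l3\<^sup>2 + 4 * k3"
     "f = l2 * l3 + 2 * k4" "g = l1 * l3 + 2 * k5" "h = l1 * l2 + 2 * k6"
    unfolding dvd_def by (metis add.commute diff_eq_eq)
  have 1: "gram_det a (b + 2 * x * h + x\<^sup>2 * a) c (f + x * g) g (h + x * a) = - 4"
    using det unfolding gram_det_def by (simp add: algebra_simps power2_eq_square)
  \<comment> \<open>The middle coefficient is a linear functional on forms, so the parity vector
    changes from \<open>l2\<close> to \<open>l2 + x * l1\<close>.\<close>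
  have "b + 2 * x * h + x\<^sup>2 * a - (l2 + x * l1)\<^sup>2 = 4 * (k2 + x * k6 + x\<^sup>2 * k1)"
    "f + x * g - (l2 + x * l1) * l3 = 2 * (k4 + x * k5)"
    "h + x * a - l1 * (l2 + x * l1) = 2 * (k6 + 2 * x * k1)"
    unfolding k by (simp_all add: algebra_simps power2_eq_square)
  then have "4 dvd b + 2 * x * h + x\<^sup>2 * a - (l2 + x * l1)\<^sup>2"
    "2 dvd f + x * g - (l2 + x * l1) * l3" "2 dvd h + x * a - l1 * (l2 + x * l1)" by simp_all
  with 1 l show ?thesis unfolding disc_like_def by blast
qed

lemma realizable_SL2:
  assumes det: "y * w - z * v = 1"
    and "realizable a (b * y\<^sup>2 + 2 * f * y * z + c * z\<^sup>2) (b * v\<^sup>2 + 2 * f * v * w + c * w\<^sup>2)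
           (b * y * v + f * (y * w + z * v) + c * z * w) (v * h + w * g) (y * h + z * g)"
  shows "realizable a b c f g h"
proof -
  obtain q1 q2 q3 where q: "B_Delta q1 q1 = a" "B_Delta q2 q2 = b * y\<^sup>2 + 2 * f * y * z + c * z\<^sup>2"
     "B_Delta q3 q3 = b * v\<^sup>2 + 2 * f * v * w + c * w\<^sup>2"
     "B_Delta q2 q3 = b * y * v + f * (y * w + z * v) + c * z * w" "B_Delta q1 q3 = v * h + w * g" "B_Delta q1 q2 = y * h + z * g"
    using assms unfolding realizable_def by blast
  \<comment> \<open>Keeping the determinant as a symbol and inserting \<open>d\<close> or its square
    into the goals makes them polynomial identities.\<close>
  define d where "d = y * w - z * v"
  have e: "b * d\<^sup>2 = b" "c * d\<^sup>2 = c" "f * d\<^sup>2 = f" "h * d = h" "g * d = g" using det by (simp_all add: d_def)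
  show ?thesis
    unfolding realizable_def
  proof (intro exI conjI)
    show "B_Delta (qadd (qscale w q2) (qscale (- z) q3)) (qadd (qscale w q2) (qscale (- z) q3)) = b"
      by (subst e(1)[symmetric]) (simp add: B_Delta_bilinear q B_Delta_commute[of q3 q2] d_def algebra_simps power2_eq_square)
    show "B_Delta (qadd (qscale (-v) q2) (qscale y q3)) (qadd (qscale (-v) q2) (qscale y q3)) = c"
      by (subst e(2)[symmetric]) (simp add: B_Delta_bilinear q B_Delta_commute[of q3 q2] d_def algebra_simps power2_eq_square)
    show "B_Delta (qadd (qscale w q2) (qscale (- z) q3)) (qadd (qscale (-v) q2) (qscale y q3)) = f"
      by (subst e(3)[symmetric]) (simp add: B_Delta_bilinear q B_Delta_commute[of q3 q2] d_def algebra_simps power2_eq_square)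
    show "B_Delta q1 (qadd (qscale (-v) q2) (qscale y q3)) = g"
      by (subst e(5)[symmetric]) (simp add: B_Delta_bilinear q d_def algebra_simps power2_eq_square)
    show "B_Delta q1 (qadd (qscale w q2) (qscale (- z) q3)) = h"
      by (subst e(4)[symmetric]) (simp add: B_Delta_bilinear q d_def algebra_simps power2_eq_square)
  qed (fact q(1))
qed

lemma disc_like_SL2:
  assumes det: "y * w - z * v = 1" and "disc_like a b c f g h"
  shows "disc_like a (b * y\<^sup>2 + 2 * f * y * z + c * z\<^sup>2) (b * v\<^sup>2 + 2 * f * v * w + c * w\<^sup>2)
           (b * y * v + f * (y * w + z * v) + c * z * w) (v * h + w * g) (y * h + z * g)"
proof -
  obtain l1 l2 l3 where l: "4 dvd a - l1\<^sup>2" "4 dvd b - l2\<^sup>2" "4 dvd c - l3\<^sup>2"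
        "2 dvd f - l2 * l3" "2 dvd g - l1 * l3" "2 dvd h - l1 * l2"
    and det': "gram_det a b c f g h = - 4"
    using assms unfolding disc_like_def by blast
  from l obtain k1 k2 k3 k4 k5 k6 where k: "a = l1\<^sup>2 + 4 * k1" "b = l2\<^sup>2 + 4 * k2" "c = l3\<^sup>2 + 4 * k3"
     "f = l2 * l3 + 2 * k4" "g = l1 * l3 + 2 * k5" "h = l1 * l2 + 2 * k6"
    unfolding dvd_def by (metis add.commute diff_eq_eq)
  have "gram_det a (b * y\<^sup>2 + 2 * f * y * z + c * z\<^sup>2) (b * v\<^sup>2 + 2 * f * v * w + c * w\<^sup>2)
           (b * y * v + f * (y * w + z * v) + c * z * w) (v * h + w * g) (y * h + z * g)
        = (y * w - z * v)\<^sup>2 * gram_det a b c f g h"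
    unfolding gram_det_def by (simp add: algebra_simps power2_eq_square)
  then have 1: "gram_det a (b * y\<^sup>2 + 2 * f * y * z + c * z\<^sup>2) (b * v\<^sup>2 + 2 * f * v * w + c * w\<^sup>2)
           (b * y * v + f * (y * w + z * v) + c * z * w) (v * h + w * g) (y * h + z * g) = - 4"
    using det det' by simp
  have "b * y\<^sup>2 + 2 * f * y * z + c * z\<^sup>2 - (y * l2 + z * l3)\<^sup>2 = 4 * (k2 * y\<^sup>2 + k4 * y * z + k3 * z\<^sup>2)"
    "b * v\<^sup>2 + 2 * f * v * w + c * w\<^sup>2 - (v * l2 + w * l3)\<^sup>2 = 4 * (k2 * v\<^sup>2 + k4 * v * w + k3 * w\<^sup>2)"
    "b * y * v + f * (y * w + z * v) + c * z * w - (y * l2 + z * l3) * (v * l2 + w * l3)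
      = 2 * (2 * k2 * y * v + k4 * (y * w + z * v) + 2 * k3 * z * w)"
    "v * h + w * g - l1 * (v * l2 + w * l3) = 2 * (v * k6 + w * k5)"
    "y * h + z * g - l1 * (y * l2 + z * l3) = 2 * (y * k6 + z * k5)"
    unfolding k by (simp_all add: algebra_simps power2_eq_square)
  then have "4 dvd b * y\<^sup>2 + 2 * f * y * z + c * z\<^sup>2 - (y * l2 + z * l3)\<^sup>2"
    "4 dvd b * v\<^sup>2 + 2 * f * v * w + c * w\<^sup>2 - (v * l2 + w * l3)\<^sup>2"
    "2 dvd b * y * v + f * (y * w + z * v) + c * z * w - (y * l2 + z * l3) * (v * l2 + w * l3)"
    "2 dvd v * h + w * g - l1 * (v * l2 + w * l3)"
    "2 dvd y * h + z * g - l1 * (y * l2 + z * l3)" by simp_all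
  with 1 l(1) show ?thesis unfolding disc_like_def by blast
qed

text \<open>Euler's four-number lemma: \<open>p\<close> and \<open>q\<close> split the divisor
  \<open>a\<close> of \<open>c * d\<close>, and the cofactors are \<open>r\<close> and
  \<open>s\<close>. It will supply the coefficients of two forms from a single product
  equation.\<close>

lemma four_numbers_int:
  fixes a b c d :: int
  assumes "a * b = c * d"
  shows "\<exists>p q r s. a = p * q \<and> b = r * s \<and> c = p * r \<and> d = q * s"
proof (cases "a = 0")
  case True
  then consider "c = 0" | "d = 0" using assms by auto
  then show ?thesis
  proof cases
    case 1
    with True have "a = 0 * d \<and> b = b * 1 \<and> c = 0 * b \<and> d = d * 1" by simp
    then show ?thesis by blast
  next
    case 2
    with True have "a = c * 0 \<and> b = 1 * b \<and> c = c * 1 \<and> d = 0 * b" by simp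
    then show ?thesis by blast
  qed
next
  case False
  have "a dvd c * d" using assms by (metis dvd_triv_left)
  then obtain p q where pq: "a = p * q" "p dvd c" "q dvd d" using division_decomp by blast
  then obtain r s where rs: "c = p * r" "d = q * s" by (auto elim!: dvdE)
  have "(p * q) * b = (p * q) * (r * s)" using assms pq rs by (simp add: algebra_simps)
  with False pq have "b = r * s" by simp
  with pq rs show ?thesis by blast
qed

section \<open>Reduction of binary forms\<close>

lemma balanced_remainder_int:
  fixes b f :: int
  assumes "b \<noteq> 0"
  shows "\<exists>t. 2 * \<bar>f + t * b\<bar> \<le> \<bar>b\<bar>"
proof -
  define r where "r = f mod \<bar>b\<bar>"
  have r: "0 \<le> r" "r < \<bar>b\<bar>" using assms by (simp_all add: r_def)
  have f: "f = r + (f div \<bar>b\<bar>) * \<bar>b\<bar>" by (simp add: r_def)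
  define s where "s = sgn b * (f div \<bar>b\<bar>)"
  have fs: "f = r + s * b" using f by (cases "b > 0") (auto simp: s_def sgn_if abs_if)
  show ?thesis
  proof (cases "2 * r \<le> \<bar>b\<bar>")
    case True
    then show ?thesis using r by (intro exI[of _ "- s"]) (simp add: fs)
  next
    case False
    then show ?thesis using r
      by (intro exI[of _ "- s - sgn b"]) (cases "b > 0"; auto simp: fs sgn_if algebra_simps)
  qed
qed

text \<open>Lagrange reduction, for definite and indefinite forms alike. With a balanced middle
  coefficient, either b already meets the Hermite bound, or the last coefficient is smaller than b
  in absolute value and takes its place after a quarter turn.\<close>

lemma binary_form_small_value:
  fixes b f c :: int
  shows "\<exists>y z v w. y * w - z * v = 1 \<and>
           (let A = b * y\<^sup>2 + 2 * f * y * z + c * z\<^sup>2 in A = 0 \<or> 3 * A\<^sup>2 \<le> 4 * \<bar>b * c - f\<^sup>2\<bar>)"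
proof (induction "nat \<bar>b\<bar>" arbitrary: b f c rule: less_induct)
  case less
  show ?case
  proof (cases "b = 0 \<or> 3 * b\<^sup>2 \<le> 4 * \<bar>b * c - f\<^sup>2\<bar>")
    case True
    then show ?thesis by (intro exI[of _ 1] exI[of _ 0] exI[of _ "0::int"] exI[of _ "1::int"]) simp
  next
    case False
    then have b0: "b \<noteq> 0" by simp
    obtain t where t: "2 * \<bar>f + t * b\<bar> \<le> \<bar>b\<bar>" using balanced_remainder_int[OF b0] by blast
    define f' where "f' = f + t * b"
    define c' where "c' = c + 2 * t * f + t\<^sup>2 * b"
    have disc: "b * c' - f'\<^sup>2 = b * c - f\<^sup>2"
      by (simp add: c'_def f'_def algebra_simps power2_eq_square)
    have "(2 * \<bar>f'\<bar>)\<^sup>2 \<le> \<bar>b\<bar>\<^sup>2" using t unfolding f'_def by (intro power_mono) auto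
    then have f'2: "4 * f'\<^sup>2 \<le> b\<^sup>2" by (simp add: power_mult_distrib)
    \<comment> \<open>4 |b c'| <= 4 |det| + 4 f'^2 < 3 b^2 + b^2: the constant 3 of the bound is
      what the balanced remainder leaves over.\<close>
    have "4 * \<bar>b * c'\<bar> < 4 * b\<^sup>2"
    proof -
      have "\<bar>b * c'\<bar> \<le> \<bar>b * c - f\<^sup>2\<bar> + f'\<^sup>2"
        using disc zero_le_power2[of f'] by linarith
      moreover have "4 * \<bar>b * c - f\<^sup>2\<bar> < 3 * b\<^sup>2" using False by linarith
      moreover have "4 * X < 4 * W" if "X \<le> Y + Z" "4 * Y < 3 * W" "4 * Z \<le> W" for X Y Z W :: int
        using that by linarith
      ultimately show ?thesis using f'2 by blast
    qed
    then have "\<bar>b\<bar> * \<bar>c'\<bar> < \<bar>b\<bar> * \<bar>b\<bar>" by (simp add: abs_mult power2_eq_square)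
    then have "\<bar>c'\<bar> < \<bar>b\<bar>" by (rule mult_left_less_imp_less) simp
    then have "nat \<bar>c'\<bar> < nat \<bar>b\<bar>" by simp
    from less(1)[OF this, of "- f'" b] obtain y z v w where yz: "y * w - z * v = 1"
      and A: "let A = c' * y\<^sup>2 + 2 * (- f') * y * z + b * z\<^sup>2 in A = 0 \<or> 3 * A\<^sup>2 \<le> 4 * \<bar>c' * b - (- f')\<^sup>2\<bar>"
      by blast
    have A': "b * (t * y - z)\<^sup>2 + 2 * f * (t * y - z) * y + c * y\<^sup>2 = c' * y\<^sup>2 + 2 * (- f') * y * z + b * z\<^sup>2"
      by (simp add: c'_def f'_def algebra_simps power2_eq_square)
    have D: "c' * b - (- f')\<^sup>2 = b * c - f\<^sup>2" using disc by (simp add: mult.commute)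
    have det: "(t * y - z) * v - y * (t * v - w) = 1" using yz by (simp add: algebra_simps)
    show ?thesis
      by (rule exI[of _ "t * y - z"], rule exI[of _ y], rule exI[of _ "t * v - w"], rule exI[of _ v])
         (intro conjI det A[unfolded D A'[symmetric]])
  qed
qed

section \<open>Hermite reduction of ternary forms\<close>

lemma square_mod_4: "(l::int)\<^sup>2 mod 4 = (if even l then 0 else 1)"
proof (cases "even l")
  case True then show ?thesis by (auto elim!: evenE simp: power2_eq_square)
next
  case False
  then obtain k where "l = 2 * k + 1" by (elim oddE)
  then have "l\<^sup>2 = 4 * (k\<^sup>2 + k) + 1" by (simp add: power2_eq_square algebra_simps)
  then show ?thesis using False by presburger
qed

text \<open>The form xy has discriminant 1, and the forms p x^2 - q y^2 are orthogonal to it. Parity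
  makes \<open>b\<close> and \<open>c\<close> divisible by 4 and \<open>f\<close> even, and the
  determinant becomes f'^2 = 4 b' c' + 1 with f' = 2k + 1, that is b' c' = k (k + 1). The
  four-number factorization of this equation gives both remaining forms.\<close>

lemma realizable_unit_orthogonal:
  assumes "disc_like 1 b c f 0 0"
  shows "realizable 1 b c f 0 0"
proof -
  obtain l1 l2 l3 where l: "4 dvd 1 - l1\<^sup>2" "4 dvd b - l2\<^sup>2" "4 dvd c - l3\<^sup>2"
        "2 dvd f - l2 * l3" "2 dvd 0 - l1 * l3" "2 dvd 0 - l1 * l2"
    and det: "gram_det 1 b c f 0 0 = - 4"
    using assms unfolding disc_like_def by blast
  have "odd l1" using l(1) square_mod_4[of l1] by presburger
  then have ev: "even l2" "even l3" using l by auto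
  then have "4 dvd b" "4 dvd c" "2 dvd f"
    using l(2,3,4) square_mod_4[of l2] square_mod_4[of l3] by (presburger+, auto)
  then obtain b' c' f' where b': "b = 4 * b'" "c = 4 * c'" "f = 2 * f'" by (auto elim!: dvdE)
  have disc: "f'\<^sup>2 = 4 * (b' * c') + 1"
    using det unfolding gram_det_def b' by (simp add: power2_eq_square)
  then have "odd (f'\<^sup>2)" by simp
  then have "odd f'" by simp
  then obtain k where k: "f' = 2 * k + 1" by (elim oddE)
  have "4 * (k * (k + 1)) = 4 * (b' * c')" using disc unfolding k by (simp add: power2_eq_square algebra_simps)
  then have "b' * c' = k * (k + 1)" by simp
  from four_numbers_int[OF this] obtain p q r s where
    pq: "b' = p * q" "c' = r * s" "k = p * r" "k + 1 = q * s" by blast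
  have f': "f' = p * r + q * s" using pq k by simp
  show ?thesis unfolding realizable_def
    by (rule exI[of _ "(0, 1, 0)"], rule exI[of _ "(p, 0, - q)"], rule exI[of _ "(s, 0, - r)"])
       (simp add: b' pq(1,2) f')
qed

text \<open>A vector of norm 1 splits off orthogonally: shears by \<open>- h\<close> and
  \<open>- g\<close> reach the orthogonal case and are then undone in reverse order.\<close>

lemma realizable_unit:
  assumes "disc_like 1 b c f g h"
  shows "realizable 1 b c f g h"
proof -
  have 1: "disc_like 1 (b - h\<^sup>2) c (f - h * g) g 0" (is "disc_like 1 ?b c ?f g 0")
    using disc_like_shear[OF assms, of "- h"] by (simp add: power2_eq_square)
  \<comment> \<open>\<open>disc_like_shear\<close> changes only the second vector, so a quarter turn
    brings the third one into its place.\<close>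
  have 2: "disc_like 1 c ?b (- ?f) 0 g"
    using disc_like_SL2[OF _ 1, of 0 0 1 "-1"] by simp
  have "disc_like 1 (c - g\<^sup>2) ?b (- ?f) 0 0"
    using disc_like_shear[OF 2, of "- g"] by (simp add: power2_eq_square)
  then have "realizable 1 (c - g\<^sup>2) ?b (- ?f) 0 0" by (rule realizable_unit_orthogonal)
  then have "realizable 1 c ?b (- ?f) 0 g"
    using realizable_shear[of 1 c "-g" g ?b "- ?f" 0] by (simp add: power2_eq_square)
  then have "realizable 1 ?b c ?f g 0"
    using realizable_SL2[of 0 0 1 "-1" 1 ?b ?f c 0 g] by simp
  then show ?thesis
    using realizable_shear[of 1 b "-h" h c f g] by (simp add: power2_eq_square)
qed

text \<open>A unimodular change of the last two vectors makes the third orthogonal to the isotropic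
  first one. The determinant then reads c' d^2 = 4, and the parity conditions force d to be even, so
  c' = 1 and the unit case applies after exchanging the first and third vectors.\<close>

lemma realizable_isotropic:
  assumes "disc_like 0 b c f g h"
  shows "realizable 0 b c f g h"
proof -
  have det: "gram_det 0 b c f g h = - 4" using assms unfolding disc_like_def by blast
  define d where "d = gcd h g"
  have "d \<noteq> 0" using det by (auto simp: d_def gram_det_def)
  obtain h0 g0 where hg: "h = d * h0" "g = d * g0" unfolding d_def by (meson dvdE gcd_dvd1 gcd_dvd2)
  obtain y z where yz: "y * h + z * g = d" unfolding d_def using bezout_int[of h g] by blast
  have yz': "y * h0 - z * (- g0) = 1"
  proof -
    have "d * (y * h0 + z * g0) = d * 1" using yz by (simp add: hg algebra_simps)
    then show ?thesis using \<open>d \<noteq> 0\<close> by simp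
  qed
  have zero: "(- g0) * h + h0 * g = 0" by (simp add: hg)
  note new = disc_like_SL2[OF yz' assms, unfolded zero yz]
  obtain b' c' f' where bcf: "disc_like 0 b' c' f' 0 d"
    "b' = b * y\<^sup>2 + 2 * f * y * z + c * z\<^sup>2" "c' = b * (- g0)\<^sup>2 + 2 * f * (- g0) * h0 + c * h0\<^sup>2"
    "f' = b * y * (- g0) + f * (y * h0 + z * (- g0)) + c * z * h0"
    using new by blast
  obtain l1 l2 l3 where l: "4 dvd 0 - l1\<^sup>2" "2 dvd d - l1 * l2"
    and det': "gram_det 0 b' c' f' 0 d = - 4"
    using bcf(1) unfolding disc_like_def by blast
  have "even l1" using l(1) square_mod_4[of l1] by presburger
  then have "even d" using l(2) by auto
  then obtain d' where d': "d = 2 * d'" by (elim evenE)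
  have "c' * d'\<^sup>2 = 1" using det' unfolding gram_det_def d' by (simp add: power2_eq_square)
  then have "c' = 1"
    using zero_le_power2[of d'] by (auto simp: zmult_eq_1_iff)
  then have "disc_like 1 b' 0 d 0 f'"
    using disc_like_swap13[OF bcf(1)] by simp
  then have "realizable 0 b' c' f' 0 d"
    using realizable_swap13 realizable_unit \<open>c' = 1\<close> by blast
  then show ?thesis
    using realizable_SL2[OF yz', of 0 b f c h g] unfolding zero yz bcf by blast
qed

text \<open>Hermite's descent on |a|. The projections orthogonal to the first vector, scaled by a,
  form a binary lattice of determinant -4a, which takes a small value A; the relation a b = h^2 + A
  then pushes another diagonal entry below |a|. Since a is 0 or 1 modulo 4, the values -2, -1 and 2
  cannot occur: the descent ends at 0 or 1, and for |a| >= 3 the bound is strict.\<close>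

theorem realizable_disc_like:
  assumes "disc_like a b c f g h"
  shows "realizable a b c f g h"
  using assms
proof (induction "nat \<bar>a\<bar>" arbitrary: a b c f g h rule: less_induct)
  case less
  obtain l1 where "4 dvd a - l1\<^sup>2" using less.prems unfolding disc_like_def by blast
  then have "a mod 4 = 0 \<or> a mod 4 = 1" using square_mod_4[of l1] by presburger
  then have "a \<noteq> 2 \<and> a \<noteq> - 1 \<and> a \<noteq> - 2" by auto
  then consider "a = 0" | "a = 1" | "\<bar>a\<bar> \<ge> 3" by linarith
  then show ?case
  proof cases
    case 1
    then show ?thesis using less.prems realizable_isotropic by simp
  next
    case 2
    then show ?thesis using less.prems realizable_unit by simp
  next
    case 3
    \<comment> \<open>The projections of the last two vectors orthogonal to the first have the Gram
      matrix with entries B, F, C divided by \<open>a\<close>.\<close>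
    define B F C where "B = a * b - h\<^sup>2" and "F = a * f - g * h" and "C = a * c - g\<^sup>2"
    have det: "gram_det a b c f g h = - 4" using less.prems unfolding disc_like_def by blast
    have "B * C - F\<^sup>2 = a * gram_det a b c f g h"
      by (simp add: B_def F_def C_def gram_det_def algebra_simps power2_eq_square)
    then have disc: "\<bar>B * C - F\<^sup>2\<bar> = 4 * \<bar>a\<bar>" using det by simp
    obtain y z v w where yz: "y * w - z * v = 1"
      and A: "let A = B * y\<^sup>2 + 2 * F * y * z + C * z\<^sup>2 in A = 0 \<or> 3 * A\<^sup>2 \<le> 4 * \<bar>B * C - F\<^sup>2\<bar>"
      using binary_form_small_value[of B F C] by blast
    define A where "A = B * y\<^sup>2 + 2 * F * y * z + C * z\<^sup>2"
    have A3: "3 * A\<^sup>2 \<le> 16 * \<bar>a\<bar>" using A unfolding disc A_def[symmetric] Let_def by auto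
    define b' c' f' g' h' where defs: "b' = b * y\<^sup>2 + 2 * f * y * z + c * z\<^sup>2"
      "c' = b * v\<^sup>2 + 2 * f * v * w + c * w\<^sup>2" "f' = b * y * v + f * (y * w + z * v) + c * z * w"
      "g' = v * h + w * g" "h' = y * h + z * g"
    have new: "disc_like a b' c' f' g' h'"
      unfolding defs by (rule disc_like_SL2[OF yz less.prems])
    have A': "a * b' = h'\<^sup>2 + A"
      by (simp add: A_def B_def F_def C_def defs algebra_simps power2_eq_square)
    have "a \<noteq> 0" using 3 by auto
    obtain x where x: "2 * \<bar>h' + x * a\<bar> \<le> \<bar>a\<bar>" using balanced_remainder_int[OF \<open>a \<noteq> 0\<close>] by blast
    define b'' where "b'' = b' + 2 * x * h' + x\<^sup>2 * a"
    have new': "disc_like a b'' c' (f' + x * g') g' (h' + x * a)"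
      unfolding b''_def by (rule disc_like_shear[OF new])
    have ab: "a * b'' = (h' + x * a)\<^sup>2 + A"
      using A' by (simp add: b''_def algebra_simps power2_eq_square)
    have "(2 * \<bar>h' + x * a\<bar>)\<^sup>2 \<le> \<bar>a\<bar>\<^sup>2" using x by (intro power_mono) auto
    then have h2: "4 * (h' + x * a)\<^sup>2 \<le> a\<^sup>2" by (simp add: power_mult_distrib)
    \<comment> \<open>Otherwise 3 A^2 <= 16 |a| would give 27 a^4 <= 256 |a|, hence |a|^3 < 10,
      against |a| >= 3.\<close>
    have A4: "4 * \<bar>A\<bar> < 3 * a\<^sup>2"
    proof (rule ccontr)
      assume "\<not> 4 * \<bar>A\<bar> < 3 * a\<^sup>2"
      then have "(3 * a\<^sup>2)\<^sup>2 \<le> (4 * \<bar>A\<bar>)\<^sup>2" by (intro power_mono) auto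
      then have "9 * (a\<^sup>2)\<^sup>2 \<le> 16 * A\<^sup>2" by (simp add: power_mult_distrib)
      then have *: "27 * (a\<^sup>2)\<^sup>2 \<le> 256 * \<bar>a\<bar>" using A3 by linarith
      have "9 \<le> \<bar>a\<bar>\<^sup>2" using power_mono[OF 3, of 2] by simp
      then have "9 * 3 \<le> \<bar>a\<bar>\<^sup>2 * \<bar>a\<bar>" using 3 by (intro mult_mono) auto
      then have "27 * \<bar>a\<bar> \<le> \<bar>a\<bar>\<^sup>2 * \<bar>a\<bar> * \<bar>a\<bar>" by (intro mult_right_mono) auto
      also have "\<dots> = (a\<^sup>2)\<^sup>2" by (simp add: power2_eq_square)
      finally show False using * 3 by linarith
    qed
    have "4 * (\<bar>a\<bar> * \<bar>b''\<bar>) < 4 * (\<bar>a\<bar> * \<bar>a\<bar>)"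
    proof -
      have "4 * \<bar>a * b''\<bar> \<le> 4 * (h' + x * a)\<^sup>2 + 4 * \<bar>A\<bar>"
        unfolding ab using abs_triangle_ineq[of "(h' + x * a)\<^sup>2" A] by simp
      also have "\<dots> < 4 * a\<^sup>2" using h2 A4 by linarith
      finally show ?thesis by (simp add: abs_mult power2_eq_square)
    qed
    then have "\<bar>a\<bar> * \<bar>b''\<bar> < \<bar>a\<bar> * \<bar>a\<bar>" by simp
    then have "\<bar>b''\<bar> < \<bar>a\<bar>" by (rule mult_left_less_imp_less) simp
    then have "nat \<bar>b''\<bar> < nat \<bar>a\<bar>" by simp
    from less(1)[OF this disc_like_swap12[OF new']]
    have "realizable a b'' c' (f' + x * g') g' (h' + x * a)"
      by (rule realizable_swap12)
    then have "realizable a b' c' f' g' h'" unfolding b''_def by (rule realizable_shear)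
    then show ?thesis unfolding defs by (rule realizable_SL2[OF yz])
  qed
qed

section \<open>Triples of binary quadratic forms\<close>

fun det3 :: "qform \<Rightarrow> qform \<Rightarrow> qform \<Rightarrow> int" where
  "det3 (A1, B1, C1) (A2, B2, C2) (A3, B3, C3) =
     C3 * (A1 * B2 - A2 * B1) - B3 * (A1 * C2 - A2 * C1) + A3 * (B1 * C2 - B2 * C1)"

text \<open>The leading coefficient of the Jacobian of the two forms. For pairs with D1 D2 > n^2 the
  Jacobian is definite, so this coefficient carries its sign.\<close>

fun lead_minor :: "qform \<Rightarrow> qform \<Rightarrow> int" where
  "lead_minor (A1, B1, C1) (A2, B2, C2) = A1 * B2 - A2 * B1"

lemma det3_linear:
  "det3 (qadd p q) r s = det3 p r s + det3 q r s"
  "det3 r (qadd p q) s = det3 r p s + det3 r q s"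
  "det3 r s (qadd p q) = det3 r s p + det3 r s q"
  "det3 (qscale k p) r s = k * det3 p r s"
  "det3 r (qscale k p) s = k * det3 r p s"
  "det3 r s (qscale k p) = k * det3 r s p"
  by (cases p; cases q; cases r; cases s; simp add: algebra_simps)+

lemma det3_alternating: "det3 p p q = 0" "det3 p q p = 0" "det3 q p p = 0"
  by (cases p; cases q; simp add: algebra_simps)+

lemma lead_minor_linear:
  "lead_minor (qscale k p) r = k * lead_minor p r"
  "lead_minor r (qscale k p) = k * lead_minor r p"
  "lead_minor r (qadd p q) = lead_minor r p + lead_minor r q"
  "lead_minor r r = 0"
  by (cases p; cases q; cases r; simp add: algebra_simps)+

lemma form_act_linear:
  "form_act a b c d (qadd p q) = qadd (form_act a b c d p) (form_act a b c d q)"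
  "form_act a b c d (qscale k p) = qscale k (form_act a b c d p)"
  by (cases p; cases q; simp add: algebra_simps)+

lemma B_Delta_form_act: "B_Delta (form_act a b c d q) (form_act a b c d r) = (a * d - b * c)\<^sup>2 * B_Delta q r"
  by (cases q; cases r) (simp add: power2_eq_square algebra_simps)

lemma det3_form_act:
  "det3 (form_act a b c d p) (form_act a b c d q) (form_act a b c d r) = (a * d - b * c) ^ 3 * det3 p q r"
  by (cases p; cases q; cases r) (simp add: power2_eq_square power3_eq_cube algebra_simps)

text \<open>The Gram matrix of x^2, xy, y^2 has determinant -4, and a triple of forms multiplies it
  by the square of its coordinate determinant. Hence a Gram determinant of -4 means that the triple
  is a basis.\<close>

lemma gram_det_B_Delta:
  "gram_det (B_Delta p p) (B_Delta q q) (B_Delta r r) (B_Delta q r) (B_Delta p r) (B_Delta p q) = - 4 * (det3 p q r)\<^sup>2"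
  by (cases p; cases q; cases r) (simp add: gram_det_def power2_eq_square algebra_simps)

lemma qscale_simps: "qscale k (qadd p q) = qadd (qscale k p) (qscale k q)" "qscale k (qscale l p) = qscale (k * l) p"
  "qscale 1 p = p"
  by (cases p; cases q; simp add: algebra_simps)+

lemma cramer:
  assumes "det3 q1 q2 q3 = 1"
  shows "v = qadd (qscale (det3 v q2 q3) q1) (qadd (qscale (det3 q1 v q3) q2) (qscale (det3 q1 q2 v) q3))"
proof -
  have "qscale (det3 q1 q2 q3) v =
      qadd (qscale (det3 v q2 q3) q1) (qadd (qscale (det3 q1 v q3) q2) (qscale (det3 q1 q2 v) q3))"
    by (cases q1; cases q2; cases q3; cases v) (simp add: algebra_simps)
  then show ?thesis using assms by (simp add: qscale_simps)
qed

definition qlin :: "int \<Rightarrow> int \<Rightarrow> int \<Rightarrow> qform \<Rightarrow> qform \<Rightarrow> qform \<Rightarrow> qform" where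
  "qlin x y z p q r = qadd (qscale x p) (qadd (qscale y q) (qscale z r))"

lemma det3_qlin:
  "det3 (qlin x1 y1 z1 p q r) (qlin x2 y2 z2 p q r) (qlin x3 y3 z3 p q r) =
     det3 (x1, y1, z1) (x2, y2, z2) (x3, y3, z3) * det3 p q r"
  by (cases p; cases q; cases r) (simp add: qlin_def algebra_simps)

lemma B_Delta_qlin:
  assumes "B_Delta p p = B_Delta p' p'" "B_Delta q q = B_Delta q' q'" "B_Delta r r = B_Delta r' r'"
    "B_Delta q r = B_Delta q' r'" "B_Delta p r = B_Delta p' r'" "B_Delta p q = B_Delta p' q'"
  shows "B_Delta (qlin x y z p q r) (qlin x' y' z' p q r) = B_Delta (qlin x y z p' q' r') (qlin x' y' z' p' q' r')"
  using assms by (simp add: qlin_def B_Delta_bilinear B_Delta_commute[of q p] B_Delta_commute[of r p] B_Delta_commute[of r q]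
   B_Delta_commute[of q' p'] B_Delta_commute[of r' p'] B_Delta_commute[of r' q'])

section \<open>Proper isometries of the lattice of forms\<close>

lemma coprime_intI_prime:
  fixes a b :: int
  assumes "\<And>p. prime p \<Longrightarrow> p dvd a \<Longrightarrow> p dvd b \<Longrightarrow> False"
  shows "coprime a b"
proof (rule ccontr)
  assume "\<not> coprime a b"
  then have "\<not> is_unit (gcd a b)" by (simp add: coprime_iff_gcd_eq_1)
  moreover have "gcd a b \<noteq> 0" using assms[of 2] by auto
  ultimately obtain p where "prime p" "p dvd gcd a b" using prime_divisor_exists by blast
  then show False using assms by auto
qed

lemma coprime_mult_eq_square_int:
  fixes a b c :: int
  assumes "coprime a b" "a * b = c\<^sup>2"
  shows "\<exists>s x y. (s = 1 \<or> s = -1) \<and> a = s * x\<^sup>2 \<and> b = s * y\<^sup>2 \<and> c = x * y"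
proof -
  have "nat \<bar>a\<bar> * nat \<bar>b\<bar> = (nat \<bar>c\<bar>) ^ 2"
  proof -
    have "int (nat \<bar>a\<bar> * nat \<bar>b\<bar>) = int ((nat \<bar>c\<bar>) ^ 2)"
      using arg_cong[OF assms(2), of abs] by (simp add: abs_mult)
    then show ?thesis by (simp only: of_nat_eq_iff)
  qed
  moreover have "coprime (nat \<bar>a\<bar>) (nat \<bar>b\<bar>)" using assms(1)
    by (simp add: coprime_int_iff[symmetric])
  ultimately have "\<exists>x. nat \<bar>a\<bar> = x ^ 2" "\<exists>y. nat \<bar>b\<bar> = y ^ 2"
    using is_nth_power_mult_coprime_nat_iff[of "nat \<bar>a\<bar>" "nat \<bar>b\<bar>" 2] unfolding is_nth_power_def by auto
  then obtain x y where xy: "\<bar>a\<bar> = (int x)\<^sup>2" "\<bar>b\<bar> = (int y)\<^sup>2"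
    by (metis abs_ge_zero nat_0_le of_nat_power)
  have ab: "a * b \<ge> 0" using assms(2) by simp
  obtain s :: int where s: "s = 1 \<or> s = -1" "a = s * (int x)\<^sup>2" "b = s * (int y)\<^sup>2"
  proof -
    consider "a > 0" | "a < 0" | "a = 0" by linarith
    then show ?thesis
    proof cases
      case 1 then show ?thesis using ab xy that[of 1] by (simp add: zero_le_mult_iff)
    next
      case 2 then show ?thesis using ab xy that[of "-1"] by (simp add: zero_le_mult_iff)
    next
      case 3
      then show ?thesis using xy that[of 1] that[of "-1"] by (cases "b \<ge> 0") auto
    qed
  qed
  have "c\<^sup>2 = (int x * int y)\<^sup>2" using assms(2) s by (auto simp: power_mult_distrib)
  then have "c = int x * int y \<or> c = int x * (- int y)" by (simp add: power2_eq_iff)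
  then show ?thesis using s by (metis power2_minus)
qed

text \<open>Discriminant 0 gives A C = b^2 with B = 2b, and the pairing -2 with another isotropic
  form makes A and C coprime. So both are squares up to a common sign, and E is plus or minus the
  square of a linear form.\<close>

lemma isotropic_form:
  assumes "B_Delta E E = 0" "B_Delta E F = - 2" "B_Delta F F = 0"
  shows "\<exists>s x y. (s = 1 \<or> s = -1) \<and> E = (s * x\<^sup>2, s * (2 * x * y), s * y\<^sup>2)"
proof -
  obtain A B C where E: "E = (A, B, C)" by (cases E)
  obtain A' B' C' where F: "F = (A', B', C')" by (cases F)
  have B: "B\<^sup>2 = 4 * (A * C)" "B'\<^sup>2 = 4 * (A' * C')" using assms by (simp_all add: E F power2_eq_square)
  then have "even (B\<^sup>2)" "even (B'\<^sup>2)" by simp_all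
  then obtain b b' where b: "B = 2 * b" "B' = 2 * b'" by (auto elim!: evenE)
  have b2: "A * C = b\<^sup>2" using B b by simp
  have lin: "A * C' + C * A' - 2 * b * b' = 1"
  proof -
    have "2 * (A * C' + C * A' - 2 * b * b') = 2 * 1" using assms(2) by (simp add: E F b algebra_simps)
    then show ?thesis unfolding mult_cancel_left by simp
  qed
  have "coprime A C"
  proof (rule coprime_intI_prime)
    fix p assume p: "prime p" "p dvd A" "p dvd C"
    then have "p dvd b\<^sup>2" unfolding b2[symmetric] by simp
    then have "p dvd b" using p prime_dvd_power by blast
    then have "p dvd A * C' + C * A' - 2 * b * b'" using p by simp
    then show False using lin p(1) by (simp add: not_prime_unit)
  qed
  from coprime_mult_eq_square_int[OF this b2] obtain s x y where
    *: "s = 1 \<or> s = -1" "A = s * x\<^sup>2" "C = s * y\<^sup>2" "b = x * y" by blast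
  then consider "s = 1" | "s = -1" by blast
  then show ?thesis
  proof cases
    case 1
    then show ?thesis using * by (intro exI[of _ 1] exI[of _ x] exI[of _ y]) (simp add: E b)
  next
    case 2
    then show ?thesis using * by (intro exI[of _ "-1"] exI[of _ x] exI[of _ "- y"]) (simp add: E b)
  qed
qed

text \<open>The images of x^2 and y^2 under an isometry are, up to a common sign s, the squares of
  linear forms ax + by and cx + dy; the image of xy is determined by being orthogonal to both and by
  the orientation. A matrix of determinant -1 reverses the orientation of triples, and the factor s
  = ad - bc compensates this.\<close>

lemma standard_triple:
  assumes "B_Delta E E = 0" "B_Delta S S = 1" "B_Delta F F = 0" "B_Delta E S = 0" "B_Delta F S = 0" "B_Delta E F = - 2"
    and "det3 E S F = 1"
  shows "\<exists>a b c d s. (s = 1 \<or> s = -1) \<and> a * d - b * c = s \<and>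
     E = qscale s (form_act a b c d (1, 0, 0)) \<and> S = qscale s (form_act a b c d (0, 1, 0)) \<and>
     F = qscale s (form_act a b c d (0, 0, 1))"
proof -
  obtain s a b where E: "s = 1 \<or> s = -1" "E = (s * a\<^sup>2, s * (2 * a * b), s * b\<^sup>2)"
    using isotropic_form[OF assms(1,6,3)] by blast
  obtain s' c0 d0 where F: "s' = 1 \<or> s' = -1" "F = (s' * c0\<^sup>2, s' * (2 * c0 * d0), s' * d0\<^sup>2)"
    using isotropic_form[OF assms(3) _ assms(1)] assms(6) B_Delta_commute[of E F] by metis
  have "s * s' * (a * d0 - b * c0)\<^sup>2 = 1"
    using assms(6) by (simp add: E F power2_eq_square algebra_simps)
  then have ss: "s' = s" and sq: "(a * d0 - b * c0)\<^sup>2 = 1"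
    using E(1) F(1) zero_le_power2[of "a * d0 - b * c0"] by (auto simp: zmult_eq_1_iff)
  then have "a * d0 - b * c0 = s \<or> a * d0 - b * c0 = - s" using E(1) by (auto simp: power2_eq_1_iff)
  \<comment> \<open>Negating the second linear form leaves its square unchanged and flips the
    determinant, so the determinant can be made equal to s.\<close>
  then obtain c d where F': "F = (s * c\<^sup>2, s * (2 * c * d), s * d\<^sup>2)" and det: "a * d - b * c = s"
  proof
    assume "a * d0 - b * c0 = s" then show ?thesis using that[of c0 d0] F ss by simp
  next
    assume "a * d0 - b * c0 = - s" then show ?thesis using that[of "- c0" "- d0"] F ss by simp
  qed
  define S0 where "S0 = qscale s (form_act a b c d (0, 1, 0))"
  have Ea: "E = qscale s (form_act a b c d (1, 0, 0))" using E by simp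
  have Fa: "F = qscale s (form_act a b c d (0, 0, 1))" using F' by simp
  have s2: "s * s = 1" using E(1) by auto
  have d0: "det3 E S0 F = 1"
  proof -
    have "det3 E S0 F = s ^ 3 * (a * d - b * c) ^ 3"
      unfolding Ea Fa S0_def det3_linear det3_form_act by (simp add: power3_eq_cube)
    also have "\<dots> = (s * s) ^ 3" unfolding det by (simp add: power_mult_distrib)
    finally show ?thesis using s2 by simp
  qed
  define x y z where "x = det3 S S0 F" and "y = det3 E S F" and "z = det3 E S0 S"
  have S: "S = qadd (qscale x E) (qadd (qscale y S0) (qscale z F))"
    unfolding x_def y_def z_def by (rule cramer[OF d0])
  have B0: "B_Delta E S0 = 0" "B_Delta F S0 = 0"
    unfolding Ea Fa S0_def by (simp_all only: B_Delta_bilinear B_Delta_form_act) simp_all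
  \<comment> \<open>Pairing S with E and F isolates the coordinates z and x, as E and F are
    isotropic and orthogonal to \<open>S0\<close>.\<close>
  have "B_Delta E S = - 2 * z" unfolding S by (simp add: B_Delta_bilinear assms B0)
  moreover have "B_Delta F S = - 2 * x"
    unfolding S using B_Delta_commute[of F E] by (simp add: B_Delta_bilinear assms B0)
  ultimately have "x = 0" "z = 0" using assms by simp_all
  moreover have "y = 1" using assms by (simp add: y_def)
  ultimately have "S = S0" using S by (cases E; cases F; cases S0) simp
  then show ?thesis using E(1) det Ea Fa S0_def by blast
qed

text \<open>The linear map \<tau> carrying one basis to the other preserves \<open>B_Delta\<close>
  and the orientation, so \<open>standard_triple\<close> applies to its values on x^2, xy and y^2;
  by linearity the matrix found there describes \<tau> everywhere.\<close>

lemma isometric_triples: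
  assumes "B_Delta p p = B_Delta p' p'" "B_Delta q q = B_Delta q' q'" "B_Delta r r = B_Delta r' r'"
    "B_Delta q r = B_Delta q' r'" "B_Delta p r = B_Delta p' r'" "B_Delta p q = B_Delta p' q'"
    and det: "det3 p q r = 1" "det3 p' q' r' = 1"
  shows "\<exists>a b c d s. (s = 1 \<or> s = -1) \<and> a * d - b * c = s \<and>
     p' = qscale s (form_act a b c d p) \<and> q' = qscale s (form_act a b c d q) \<and> r' = qscale s (form_act a b c d r)"
proof -
  define \<tau> where "\<tau> = (\<lambda>v. qlin (det3 v q r) (det3 p v r) (det3 p q v) p' q' r')"
  define e s t :: qform where est: "e = (1, 0, 0)" "s = (0, 1, 0)" "t = (0, 0, 1)"
  have id: "v = qlin (det3 v q r) (det3 p v r) (det3 p q v) p q r" for v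
    unfolding qlin_def by (rule cramer[OF det(1)])
  have iso: "B_Delta (\<tau> v) (\<tau> w) = B_Delta v w" for v w
    using B_Delta_qlin[OF assms(1-6)] id[of v] id[of w] unfolding \<tau>_def by metis
  have dt: "det3 (\<tau> u) (\<tau> v) (\<tau> w) = det3 u v w" for u v w
    using det3_qlin[of "det3 u q r" "det3 p u r" "det3 p q u" p q r "det3 v q r" "det3 p v r" "det3 p q v" "det3 w q r" "det3 p w r" "det3 p q w"]
      det3_qlin[of "det3 u q r" "det3 p u r" "det3 p q u" p' q' r' "det3 v q r" "det3 p v r" "det3 p q v" "det3 w q r" "det3 p w r" "det3 p q w"]
      id[of u] id[of v] id[of w] det unfolding \<tau>_def by simp
  have "\<exists>a b c d k. (k = 1 \<or> k = -1) \<and> a * d - b * c = k \<and>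
     \<tau> e = qscale k (form_act a b c d (1, 0, 0)) \<and> \<tau> s = qscale k (form_act a b c d (0, 1, 0)) \<and>
     \<tau> t = qscale k (form_act a b c d (0, 0, 1))"
    by (rule standard_triple; unfold iso dt) (simp_all add: est)
  then obtain a b c d k where k: "k = 1 \<or> k = -1" "a * d - b * c = k"
     "\<tau> e = qscale k (form_act a b c d e)" "\<tau> s = qscale k (form_act a b c d s)"
     "\<tau> t = qscale k (form_act a b c d t)" unfolding est by blast
  have "\<tau> v = qscale k (form_act a b c d v)" for v
  proof -
    obtain x y z where v: "v = (x, y, z)" by (cases v)
    have v': "v = qadd (qscale x e) (qadd (qscale y s) (qscale z t))" by (simp add: v est)
    have "\<tau> v = qadd (qscale x (\<tau> e)) (qadd (qscale y (\<tau> s)) (qscale z (\<tau> t)))"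
      unfolding v' \<tau>_def det3_linear by (cases p'; cases q'; cases r') (simp add: qlin_def algebra_simps)
    also have "\<dots> = qscale k (form_act a b c d v)"
      unfolding k v' form_act_linear by (simp add: qscale_simps mult.commute)
    finally show ?thesis .
  qed
  moreover have "\<tau> p = p'" "\<tau> q = q'" "\<tau> r = r'"
    unfolding \<tau>_def using det
    by (cases p'; cases q'; cases r'; simp add: det3_alternating qlin_def)+
  ultimately show ?thesis using k by metis
qed

section \<open>Classes of pairs of forms\<close>

text \<open>The Jacobian P x^2 + 2U xy + V y^2 is covariant up to the determinant: the new leading
  coefficient is s times its value at (a, c). Since PV - U^2 = (D1 D2 - n^2)/4 is positive, this
  value has the sign of P.\<close>

lemma lead_minor_form_act:
  assumes "D1 * D2 - n\<^sup>2 > 0" "(q1, q2) \<in> form_pairs D1 D2 n" "a * d - b * c = s"  "s = 1 \<or> s = - 1"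
  shows "sgn (lead_minor (form_act a b c d q1) (form_act a b c d q2)) = s * sgn (lead_minor q1 q2)"
    and "lead_minor q1 q2 \<noteq> 0"
proof -
  obtain A1 B1 C1 A2 B2 C2 where q: "q1 = (A1, B1, C1)" "q2 = (A2, B2, C2)" by (cases q1; cases q2)
  define P U V where "P = A1 * B2 - A2 * B1" and "U = A1 * C2 - A2 * C1" and "V = B1 * C2 - B2 * C1"
  have qs: "B1\<^sup>2 - 4 * A1 * C1 = D1" "B2\<^sup>2 - 4 * A2 * C2 = D2" "B1 * B2 - 2 * A1 * C2 - 2 * A2 * C1 = n"
    using assms(2) by (auto simp: form_pairs_def q)
  have res: "D1 * D2 - n\<^sup>2 = 4 * (P * V - U\<^sup>2)"
    unfolding qs[symmetric] P_def U_def V_def by (simp add: power2_eq_square algebra_simps)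
  then have pos: "P * V - U\<^sup>2 > 0" using assms(1) by simp
  then have P0: "P \<noteq> 0" by auto
  then show "lead_minor q1 q2 \<noteq> 0" by (simp add: q P_def)
  have eq: "lead_minor (form_act a b c d q1) (form_act a b c d q2) = s * (P * a\<^sup>2 + 2 * U * a * c + V * c\<^sup>2)"
    unfolding assms(3)[symmetric] q P_def U_def V_def by (simp add: power2_eq_square algebra_simps)
  have sq: "P * (P * a\<^sup>2 + 2 * U * a * c + V * c\<^sup>2) = (P * a + U * c)\<^sup>2 + (P * V - U\<^sup>2) * c\<^sup>2"
    by (simp add: power2_eq_square algebra_simps)
  have "a \<noteq> 0 \<or> c \<noteq> 0" using assms(3,4) by auto
  then have "P * (P * a\<^sup>2 + 2 * U * a * c + V * c\<^sup>2) > 0"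
    unfolding sq using pos P0 by (cases "c = 0") (auto intro: add_nonneg_pos)
  then have "sgn (P * a\<^sup>2 + 2 * U * a * c + V * c\<^sup>2) = sgn P"
    by (auto simp: zero_less_mult_iff sgn_if)
  then show "sgn (lead_minor (form_act a b c d q1) (form_act a b c d q2)) = s * sgn (lead_minor q1 q2)"
    unfolding eq using assms(4) by (auto simp: sgn_mult q P_def)
qed

lemma form_pairs_altdef:
  "(q1, q2) \<in> form_pairs D1 D2 n \<longleftrightarrow> B_Delta q1 q1 = D1 \<and> B_Delta q2 q2 = D2 \<and> B_Delta q1 q2 = n"
  by (simp add: form_pairs_def form_disc_conv_B_Delta)

text \<open>The finite set with which both sides are matched. For odd D the square roots modulo 4M
  are odd; written as 2k + 1, they are counted modulo 2M when k runs through the residues modulo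
  M.\<close>

definition square_divisor_roots :: "int \<Rightarrow> int \<Rightarrow> (int \<times> int \<times> int) set" where
  "square_divisor_roots D N = {(e, M, k). e > 0 \<and> M > 0 \<and> e\<^sup>2 * M = N \<and> 0 \<le> k \<and> k < M \<and> 4 * M dvd (2 * k + 1)\<^sup>2 - D}"

section \<open>The complete invariant of a pair of forms\<close>

locale coprime_form_data =
  fixes D D2 n N :: int
  assumes DN: "D * D2 - n\<^sup>2 = 4 * N" and N_pos: "N > 0" and D_mod_4: "D mod 4 = 1" and coprime_DN: "coprime D N"
begin

lemma odd_D: "odd D" using D_mod_4 by presburger

lemma coprime_D4N: "coprime D (4 * N)"
proof -
  have "coprime D (2 ^ 2)" unfolding coprime_power_right_iff using odd_D by simp
  then show ?thesis using coprime_DN by simp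
qed

text \<open>Here \<open>(q1, p)\<close> is a basis of the saturation of \<open>\<langle>q1, q2\<rangle>\<close> and \<open>q3\<close> completes it to a basis of the
  lattice of forms. The integer \<open>D B(p, q3) - B(q1, p) B(q1, q3)\<close> pairs \<open>q3\<close> with a form orthogonal to
  \<open>q1\<close>; modulo \<open>4M\<close> it does not depend on \<open>q3\<close>, and its square is \<open>4D\<close> modulo \<open>16M\<close>.\<close>

definition signature_of :: "qform \<Rightarrow> qform \<Rightarrow> int \<Rightarrow> int \<Rightarrow> int \<Rightarrow> int \<Rightarrow> bool" where
  "signature_of q1 q2 e M k s \<longleftrightarrow> (e, M, k) \<in> square_divisor_roots D N \<and> sgn (lead_minor q1 q2) = s \<and>
     (\<exists>c p q3. q2 = qadd (qscale e p) (qscale c q1) \<and> det3 q1 p q3 = 1 \<and>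
        4 * M dvd D * B_Delta p q3 - B_Delta q1 p * B_Delta q1 q3 - 2 * (2 * k + 1))"

lemma signature_of_form_act:
  assumes "(q1, q2) \<in> form_pairs D D2 n" "signature_of q1 q2 e M k s" "a * d - b * c = 1"
  shows "signature_of (form_act a b c d q1) (form_act a b c d q2) e M k s"
proof -
  obtain c0 p q3 where c0: "q2 = qadd (qscale e p) (qscale c0 q1)" "det3 q1 p q3 = 1"
        "4 * M dvd D * B_Delta p q3 - B_Delta q1 p * B_Delta q1 q3 - 2 * (2 * k + 1)"
    using assms(2) unfolding signature_of_def by blast
  have "form_act a b c d q2 = qadd (qscale e (form_act a b c d p)) (qscale c0 (form_act a b c d q1))"
    by (simp add: c0 form_act_linear)
  moreover have "det3 (form_act a b c d q1) (form_act a b c d p) (form_act a b c d q3) = 1"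
    by (simp add: det3_form_act assms c0)
  moreover have "sgn (lead_minor (form_act a b c d q1) (form_act a b c d q2)) = s"
    using lead_minor_form_act[OF _ assms(1,3)] DN N_pos assms(2) unfolding signature_of_def by simp
  ultimately show ?thesis
    using assms(2) c0(3) unfolding signature_of_def
    by (intro conjI exI[of _ c0] exI[of _ "form_act a b c d p"] exI[of _ "form_act a b c d q3"])
      (auto simp only: B_Delta_form_act assms(3) power_one mult_1)
qed

text \<open>D q2 - n q1 is D times the projection of q2 orthogonal to q1. The part c q1 of q2 does
  not affect it, so it is e times the same expression for p; comparing norms gives the second
  identity.\<close>

lemma projection_identity:
  assumes "(q1, q2) \<in> form_pairs D D2 n" "q2 = qadd (qscale e p) (qscale c q1)"
  shows "D * B_Delta q2 v - n * B_Delta q1 v = e * (D * B_Delta p v - B_Delta q1 p * B_Delta q1 v)"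
    and "e\<^sup>2 * (D * B_Delta p p - (B_Delta q1 p)\<^sup>2) = 4 * N"
proof -
  have q: "B_Delta q1 q1 = D" "B_Delta q2 q2 = D2" "B_Delta q1 q2 = n" using assms(1) by (simp_all add: form_pairs_altdef)
  have n: "n = e * B_Delta q1 p + c * D" using q(3) by (simp add: assms(2) B_Delta_bilinear q(1))
  show "D * B_Delta q2 v - n * B_Delta q1 v = e * (D * B_Delta p v - B_Delta q1 p * B_Delta q1 v)"
    unfolding n by (simp add: assms(2) B_Delta_bilinear algebra_simps)
  have "D2 = e\<^sup>2 * B_Delta p p + 2 * e * c * B_Delta q1 p + c\<^sup>2 * D"
    using q(2) by (simp add: assms(2) B_Delta_bilinear q(1) B_Delta_commute[of p q1] power2_eq_square algebra_simps)
  then show "e\<^sup>2 * (D * B_Delta p p - (B_Delta q1 p)\<^sup>2) = 4 * N"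
    unfolding DN[symmetric] n by (simp add: power2_eq_square algebra_simps)
qed

lemma projection_disc:
  assumes "(q1, q2) \<in> form_pairs D D2 n" "q2 = qadd (qscale e p) (qscale c q1)" "e\<^sup>2 * M = N" "e > 0"
  shows "D * B_Delta p p - (B_Delta q1 p)\<^sup>2 = 4 * M"
proof -
  have "e\<^sup>2 * (D * B_Delta p p - (B_Delta q1 p)\<^sup>2) = e\<^sup>2 * (4 * M)"
    using projection_identity(2)[OF assms(1,2)] assms(3) by simp
  then show ?thesis using assms(4) unfolding mult_cancel_left by simp
qed

text \<open>e is the positive generator of the values of \<open>det3 q1 q2\<close>, hence intrinsic.
  Two completions q3 differ by a multiple of q1, which the defining pairing does not see, and a
  multiple y of p, which adds y times 4M by \<open>projection_disc\<close>; so k is fixed modulo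
  M.\<close>

lemma signature_of_unique:
  assumes "(q1, q2) \<in> form_pairs D D2 n" "signature_of q1 q2 e M k s" "signature_of q1 q2 e' M' k' s'"
  shows "(e, M, k, s) = (e', M', k', s')"
proof -
  obtain c p q3 where 1: "q2 = qadd (qscale e p) (qscale c q1)" "det3 q1 p q3 = 1"
        "4 * M dvd D * B_Delta p q3 - B_Delta q1 p * B_Delta q1 q3 - 2 * (2 * k + 1)"
    using assms(2) unfolding signature_of_def by blast
  obtain c' p' q3' where 2: "q2 = qadd (qscale e' p') (qscale c' q1)" "det3 q1 p' q3' = 1"
        "4 * M' dvd D * B_Delta p' q3' - B_Delta q1 p' * B_Delta q1 q3' - 2 * (2 * k' + 1)"
    using assms(3) unfolding signature_of_def by blast
  have d1: "det3 q1 q2 v = e * det3 q1 p v" for v unfolding 1 by (simp add: det3_linear det3_alternating)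
  have d2: "det3 q1 q2 v = e' * det3 q1 p' v" for v unfolding 2 by (simp add: det3_linear det3_alternating)
  have pos: "e > 0" "e' > 0" using assms(2,3) unfolding signature_of_def square_divisor_roots_def by auto
  have "e dvd e'" "e' dvd e" using d1[of q3'] d2[of q3'] d1[of q3] d2[of q3] 1(2) 2(2) by (metis dvd_triv_left mult.right_neutral)+
  then have e: "e' = e" using pos by (simp add: zdvd_antisym_nonneg)
  have M: "e\<^sup>2 * M = N" "e\<^sup>2 * M' = N" using assms(2,3) e unfolding signature_of_def square_divisor_roots_def by auto
  then have M': "M' = M" using pos by (metis less_irrefl mult_cancel_left power_eq_0_iff)
  have r: "D * B_Delta p v - B_Delta q1 p * B_Delta q1 v = D * B_Delta p' v - B_Delta q1 p' * B_Delta q1 v" for v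
    using projection_identity(1)[OF assms(1) 1(1), of v] projection_identity(1)[OF assms(1) 2(1), of v] pos e by simp
  have dd: "det3 q1 p q3' = 1" using d1[of q3'] d2[of q3'] 2(2) e pos by simp
  have q1: "B_Delta q1 q1 = D" using assms(1) by (simp add: form_pairs_altdef)
  have "4 * M = D * B_Delta p p - (B_Delta q1 p)\<^sup>2"
    using projection_disc[OF assms(1) 1(1) M(1) pos(1)] by simp
  define x y where "x = det3 q3' p q3" and "y = det3 q1 q3' q3"
  have q3': "q3' = qadd (qscale x q1) (qadd (qscale y p) (qscale 1 q3))"
    using cramer[OF 1(2), of q3'] unfolding x_def y_def dd .
  have "D * B_Delta p q3' - B_Delta q1 p * B_Delta q1 q3' = D * B_Delta p q3 - B_Delta q1 p * B_Delta q1 q3 + y * (4 * M)"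
    unfolding q3' \<open>4 * M = _\<close> by (simp add: B_Delta_bilinear q1 B_Delta_commute[of p q1] power2_eq_square algebra_simps)
  then have eq: "D * B_Delta p' q3' - B_Delta q1 p' * B_Delta q1 q3' = D * B_Delta p q3 - B_Delta q1 p * B_Delta q1 q3 + y * (4 * M)"
    by (simp add: r)
  have "4 * M dvd (D * B_Delta p' q3' - B_Delta q1 p' * B_Delta q1 q3' - 2 * (2 * k' + 1)) -
          (D * B_Delta p q3 - B_Delta q1 p * B_Delta q1 q3 - 2 * (2 * k + 1)) - y * (4 * M)"
    by (rule dvd_diff[OF dvd_diff[OF 2(3)[unfolded M'] 1(3)] dvd_triv_right])
  also have "\<dots> = 4 * (k - k')" unfolding eq by simp
  finally have "M dvd k - k'" unfolding dvd_mult_cancel_left by simp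
  moreover have "\<bar>k - k'\<bar> < M" using assms(2,3) M' unfolding signature_of_def square_divisor_roots_def by auto
  ultimately have "k = k'" using dvd_imp_le_int[of "k - k'" M] by (cases "k = k'") auto
  then show ?thesis using e M' assms(2,3) unfolding signature_of_def by auto
qed

text \<open>e is the gcd of the 2 by 2 minors of the pair, and q3 comes from a Bezout relation
  between these minors. The form p exists because D q2 - n q1 is divisible by e while D is
  invertible modulo e. The congruence for k is read off from the Gram determinant of q1, p,
  q3.\<close>

lemma signature_of_exists:
  assumes "(q1, q2) \<in> form_pairs D D2 n"
  shows "\<exists>e M k s. signature_of q1 q2 e M k s"
proof -
  obtain A1 B1 C1 A2 B2 C2 where q: "q1 = (A1, B1, C1)" "q2 = (A2, B2, C2)" by (cases q1; cases q2)
  define P U V where "P = A1 * B2 - A2 * B1" and "U = A1 * C2 - A2 * C1" and "V = B1 * C2 - B2 * C1"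
  have qs: "B1\<^sup>2 - 4 * A1 * C1 = D" "B2\<^sup>2 - 4 * A2 * C2 = D2" "B1 * B2 - 2 * A1 * C2 - 2 * A2 * C1 = n"
    using assms by (auto simp: form_pairs_def q)
  have N: "N = P * V - U\<^sup>2"
  proof -
    have "4 * N = 4 * (P * V - U\<^sup>2)" unfolding DN[symmetric] qs[symmetric] P_def U_def V_def
      by (simp add: power2_eq_square algebra_simps)
    then show ?thesis by simp
  qed
  define e where "e = gcd P (gcd U V)"
  have e0: "e > 0"
  proof -
    have "e \<noteq> 0" using N N_pos by (auto simp: e_def)
    then show ?thesis unfolding e_def using gcd_ge_0_int by (simp add: order.strict_iff_order)
  qed
  obtain P' U' V' where P': "P = e * P'" "U = e * U'" "V = e * V'"
    unfolding e_def by (meson dvdE gcd_dvd1 gcd_dvd2 dvd_trans)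
  obtain x y z where xyz: "P * x + U * y + V * z = e"
  proof -
    obtain y z where yz: "y * U + z * V = gcd U V" using bezout_int by blast
    obtain a b where "a * P + b * gcd U V = e" unfolding e_def using bezout_int by blast
    then show ?thesis using that[of a "b * y" "b * z"] unfolding yz[symmetric] by (simp add: algebra_simps)
  qed
  define M where "M = P' * V' - U'\<^sup>2"
  have NM: "e\<^sup>2 * M = N" unfolding N M_def P' by (simp add: power2_eq_square algebra_simps)
  then have M_pos: "M > 0" using N_pos e0 by (metis zero_less_mult_pos zero_less_power)
  have "coprime D e" using coprime_DN NM by (metis coprime_mult_right_iff dvd_triv_left coprime_divisors dvd_refl power2_eq_square)
  then obtain i j where ij: "i * D + j * e = 1" using bezout_int[of D e] by (auto simp: coprime_iff_gcd_eq_1)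
  \<comment> \<open>Each coefficient of D q2 - n q1 is a linear combination of the minors P, U, V,
    hence divisible by e.\<close>
  have Dq: "D * A2 - n * A1 = e * (- B1 * P' + 2 * A1 * U')" "D * B2 - n * B1 = e * (2 * A1 * V' - 2 * C1 * P')"
      "D * C2 - n * C1 = e * (B1 * V' - 2 * C1 * U')"
  proof -
    have "D * A2 - n * A1 = - B1 * P + 2 * A1 * U" "D * B2 - n * B1 = 2 * A1 * V - 2 * C1 * P"
      "D * C2 - n * C1 = B1 * V - 2 * C1 * U"
      unfolding qs[symmetric] P_def U_def V_def by (simp_all add: power2_eq_square algebra_simps)
    then show "D * A2 - n * A1 = e * (- B1 * P' + 2 * A1 * U')" "D * B2 - n * B1 = e * (2 * A1 * V' - 2 * C1 * P')"
      "D * C2 - n * C1 = e * (B1 * V' - 2 * C1 * U')"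
      unfolding P' by (simp_all add: algebra_simps)
  qed
  \<comment> \<open>i inverts D modulo e, so q2 is congruent to i n q1 modulo e.\<close>
  define c where "c = i * n"
  have split: "\<exists>w. X2 = e * w + c * X1" if "D * X2 - n * X1 = e * t" for X1 X2 t
  proof -
    have "X2 = (i * D + j * e) * X2" using ij by simp
    also have "\<dots> = i * (e * t + n * X1) + j * e * X2" unfolding that[symmetric] by (simp add: algebra_simps)
    also have "\<dots> = e * (i * t + j * X2) + c * X1" by (simp add: c_def algebra_simps)
    finally show ?thesis by blast
  qed
  obtain A B C where ABC: "A2 = e * A + c * A1" "B2 = e * B + c * B1" "C2 = e * C + c * C1"
    using split[OF Dq(1)] split[OF Dq(2)] split[OF Dq(3)] by blast
  define p where "p = (A, B, C)"
  have q2: "q2 = qadd (qscale e p) (qscale c q1)" by (simp add: q p_def ABC)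
  \<comment> \<open>The order and signs make \<open>det3 q1 q2 q3\<close> equal to P x + U y + V z =
    e.\<close>
  define q3 where "q3 = (z, - y, x)"
  have "e * det3 q1 p q3 = e * 1"
  proof -
    have "e * det3 q1 p q3 = det3 q1 q2 q3" unfolding q2 by (simp add: det3_linear det3_alternating)
    also have "\<dots> = P * x + U * y + V * z" by (simp add: q q3_def P_def U_def V_def algebra_simps)
    finally show ?thesis using xyz by simp
  qed
  then have det: "det3 q1 p q3 = 1" using e0 by simp
  define X where "X = D * B_Delta p q3 - B_Delta q1 p * B_Delta q1 q3"
  have DM: "D * B_Delta p p - (B_Delta q1 p)\<^sup>2 = 4 * M"
    by (rule projection_disc[OF assms q2 NM e0])
  have q1: "B_Delta q1 q1 = D" using assms by (simp add: form_pairs_altdef)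
  \<comment> \<open>D times the Gram determinant is the determinant of the two projections
    orthogonal to q1, with X as off-diagonal entry.\<close>
  have X2: "X\<^sup>2 = 4 * D + 4 * M * (D * B_Delta q3 q3 - (B_Delta q1 q3)\<^sup>2)"
  proof -
    have "D * gram_det (B_Delta q1 q1) (B_Delta p p) (B_Delta q3 q3) (B_Delta p q3) (B_Delta q1 q3) (B_Delta q1 p)
       = (D * B_Delta p p - (B_Delta q1 p)\<^sup>2) * (D * B_Delta q3 q3 - (B_Delta q1 q3)\<^sup>2) - X\<^sup>2"
      unfolding q1 X_def gram_det_def by (simp add: power2_eq_square algebra_simps)
    then show ?thesis unfolding gram_det_B_Delta DM det by simp
  qed
  then have "even (X\<^sup>2)" by simp
  then obtain \<beta> where X: "X = 2 * \<beta>" by auto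
  have b2: "\<beta>\<^sup>2 = D + M * (D * B_Delta q3 q3 - (B_Delta q1 q3)\<^sup>2)" using X2 by (simp add: X)
  have "4 dvd D * B_Delta q3 q3 - (B_Delta q1 q3)\<^sup>2"
  proof -
    have "D * B_Delta q3 q3 - (B_Delta q1 q3)\<^sup>2 = 4 * (B1 * B3 * (A1 * C3 + A3 * C1) - A1 * C1 * B3\<^sup>2 - B1\<^sup>2 * A3 * C3 + 4 * A1 * C1 * A3 * C3 - (A1 * C3 + A3 * C1)\<^sup>2)"
      if "q3 = (A3, B3, C3)" for A3 B3 C3
      unfolding q1[symmetric] that q by (simp add: power2_eq_square algebra_simps)
    then show ?thesis by (cases q3) simp
  qed
  then have root: "4 * M dvd \<beta>\<^sup>2 - D" unfolding b2 by (simp add: mult.commute mult_dvd_mono)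
  have "odd (\<beta>\<^sup>2)" using \<open>4 dvd _\<close> odd_D unfolding b2 by (metis dvd_mult even_add dvd_trans even_numeral)
  then have "odd \<beta>" by simp
  then obtain k0 where k0: "\<beta> = 2 * k0 + 1" by (elim oddE)
  define k where "k = k0 mod M"
  obtain m where m: "k0 = k + m * M" unfolding k_def by (metis mod_div_mult_eq)
  have "(2 * k + 1)\<^sup>2 - D = \<beta>\<^sup>2 - D - 4 * M * (m * (2 * k + 1) + m\<^sup>2 * M)"
    unfolding k0 m by (simp add: power2_eq_square algebra_simps)
  then have root': "4 * M dvd (2 * k + 1)\<^sup>2 - D" by (simp only: dvd_diff[OF root dvd_triv_left])
  have mem: "(e, M, k) \<in> square_divisor_roots D N"
    using e0 M_pos NM root' unfolding square_divisor_roots_def by (simp add: k_def)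
  have "X - 2 * (2 * k + 1) = 4 * M * m" unfolding X k0 m by (simp add: algebra_simps)
  then have "4 * M dvd D * B_Delta p q3 - B_Delta q1 p * B_Delta q1 q3 - 2 * (2 * k + 1)"
    unfolding X_def by simp
  then show ?thesis using mem q2 det unfolding signature_of_def by blast
qed

end

context coprime_form_data
begin

text \<open>The second triple is adjusted, within the freedom of choosing p and q3, until its Gram
  matrix agrees with that of the first. All entries but the norm of q3 are matched by hand; that one
  is then forced by the common determinant, and \<open>isometric_triples\<close> supplies the
  matrix.\<close>

lemma signature_of_imp_sim2:
  assumes pair: "(q1, q2) \<in> form_pairs D D2 n" "(q1', q2') \<in> form_pairs D D2 n"
    and sig: "signature_of q1 q2 e M k s" "signature_of q1' q2' e M k s"
  shows "((q1, q2), (q1', q2')) \<in> sim2"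
proof -
  obtain c p q3 where 1: "q2 = qadd (qscale e p) (qscale c q1)" "det3 q1 p q3 = 1"
        "4 * M dvd D * B_Delta p q3 - B_Delta q1 p * B_Delta q1 q3 - 2 * (2 * k + 1)"
    using sig(1) unfolding signature_of_def by blast
  obtain c' p0 q3' where 2: "q2' = qadd (qscale e p0) (qscale c' q1')" "det3 q1' p0 q3' = 1"
        "4 * M dvd D * B_Delta p0 q3' - B_Delta q1' p0 * B_Delta q1' q3' - 2 * (2 * k + 1)"
    using sig(2) unfolding signature_of_def by blast
  have e: "e > 0" "M > 0" "e\<^sup>2 * M = N" using sig(1) unfolding signature_of_def square_divisor_roots_def by auto
  have q: "B_Delta q1 q1 = D" "B_Delta q2 q2 = D2" "B_Delta q1 q2 = n"
       "B_Delta q1' q1' = D" "B_Delta q2' q2' = D2" "B_Delta q1' q2' = n"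
    using pair by (simp_all add: form_pairs_altdef)
  have "coprime D e" using coprime_DN e(3) by (metis coprime_mult_right_iff power2_eq_square)
  have nn: "n = e * B_Delta q1 p + c * D" using q(3) by (simp add: 1(1) B_Delta_bilinear q)
  have nn': "n = e * B_Delta q1' p0 + c' * D" using q(6) by (simp add: 2(1) B_Delta_bilinear q)
  have "e * (B_Delta q1 p - B_Delta q1' p0) = D * (c' - c)"
    using nn nn' by (simp add: algebra_simps)
  then have "e dvd D * (c' - c)" by (metis dvd_triv_left)
  then have "e dvd c' - c" using \<open>coprime D e\<close> by (simp add: coprime_commute coprime_dvd_mult_right_iff)
  then obtain j where j: "c' = c + e * j" by (metis add.commute diff_eq_eq dvdE)
  \<comment> \<open>This shift makes the coefficient c the same for both pairs; e divides c' - c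
    because D is invertible modulo e.\<close>
  define p' where "p' = qadd p0 (qscale j q1')"
  have q2': "q2' = qadd (qscale e p') (qscale c q1')"
    unfolding 2(1) p'_def j by (cases p0; cases q1') (simp add: algebra_simps)
  have det': "det3 q1' p' q3' = 1" by (simp add: p'_def det3_linear det3_alternating 2(2))
  have X': "4 * M dvd D * B_Delta p' q3' - B_Delta q1' p' * B_Delta q1' q3' - 2 * (2 * k + 1)"
  proof -
    have "D * B_Delta p' q3' - B_Delta q1' p' * B_Delta q1' q3' = D * B_Delta p0 q3' - B_Delta q1' p0 * B_Delta q1' q3'"
      by (simp add: p'_def B_Delta_bilinear q algebra_simps)
    then show ?thesis using 2(3) by simp
  qed
  have n': "n = e * B_Delta q1' p' + c * D" using q(6) by (simp add: q2' B_Delta_bilinear q)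
  then have m: "B_Delta q1' p' = B_Delta q1 p" using nn e(1) by simp
  note DM = projection_disc[OF pair(1) 1(1) e(3,1)]
  note DM' = projection_disc[OF pair(2) q2' e(3,1)]
  have D0: "D \<noteq> 0" using odd_D by auto
  have pp: "B_Delta p' p' = B_Delta p p" using DM DM' D0 unfolding m by (metis add_diff_cancel_left' diff_add_cancel mult_cancel_left)
  define X where "X = D * B_Delta p q3 - B_Delta q1 p * B_Delta q1 q3"
  define X1 where "X1 = D * B_Delta p' q3' - B_Delta q1' p' * B_Delta q1' q3'"
  have "4 * M dvd (X1 - 2 * (2 * k + 1)) - (X - 2 * (2 * k + 1))"
    using X' 1(3) unfolding X_def X1_def by (rule dvd_diff)
  then have "4 * M dvd X1 - X" by simp
  then obtain y where y: "X1 = X + y * (4 * M)" by (metis add.commute diff_eq_eq dvdE mult.commute)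
  \<comment> \<open>Subtracting y p' changes the pairing by exactly y times 4M, which turns the
    congruence into an equality.\<close>
  define q4 where "q4 = qadd q3' (qscale (- y) p')"
  have X4: "D * B_Delta p' q4 - B_Delta q1' p' * B_Delta q1' q4 = X"
  proof -
    have "D * B_Delta p' q4 - B_Delta q1' p' * B_Delta q1' q4 = X1 - y * (D * B_Delta p' p' - (B_Delta q1' p')\<^sup>2)"
      by (simp add: q4_def X1_def B_Delta_bilinear power2_eq_square algebra_simps)
    then show ?thesis unfolding DM' y by simp
  qed
  have det4: "det3 q1' p' q4 = 1" by (simp add: q4_def det3_linear det3_alternating det')
  have "coprime D (B_Delta q1 p)"
  proof (rule coprime_intI_prime)
    fix r assume r: "prime r" "r dvd D" "r dvd B_Delta q1 p"
    then have "r dvd D * B_Delta p p - (B_Delta q1 p)\<^sup>2" by (simp add: power2_eq_square)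
    then have "r dvd 4 * M" unfolding DM .
    then have "r dvd 4 * N" using e(3) by (metis dvd_mult mult.left_commute)
    then show False using r coprime_D4N by (meson coprime_common_divisor not_prime_unit)
  qed
  moreover have "D * (B_Delta p' q4 - B_Delta p q3) = B_Delta q1 p * (B_Delta q1' q4 - B_Delta q1 q3)"
    using X4 unfolding X_def m by (simp add: algebra_simps)
  ultimately have "D dvd B_Delta q1' q4 - B_Delta q1 q3"
    by (metis coprime_dvd_mult_right_iff dvd_triv_left)
  then obtain x where x: "B_Delta q1' q4 = B_Delta q1 q3 + D * x" by (metis add.commute diff_eq_eq dvdE)
  then have "D * (B_Delta p' q4 - B_Delta p q3) = D * (B_Delta q1 p * x)"
    using \<open>D * (B_Delta p' q4 - B_Delta p q3) = _\<close> by simp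
  then have x': "B_Delta p' q4 = B_Delta p q3 + B_Delta q1 p * x" using D0 by simp
  \<comment> \<open>The pairings of q4 with q1' and p' are off by x times D and x times B(q1, p), so
    one multiple of q1' corrects both.\<close>
  define q5 where "q5 = qadd q4 (qscale (- x) q1')"
  have det5: "det3 q1' p' q5 = 1" by (simp add: q5_def det3_linear det3_alternating det4)
  have l: "B_Delta q1' q5 = B_Delta q1 q3" by (simp add: q5_def B_Delta_bilinear x q)
  have l': "B_Delta p' q5 = B_Delta p q3" by (simp add: q5_def B_Delta_bilinear x' B_Delta_commute[of p' q1'] m)
  have "gram_det D (B_Delta p p) (B_Delta q5 q5) (B_Delta p q3) (B_Delta q1 q3) (B_Delta q1 p) =
        gram_det D (B_Delta p p) (B_Delta q3 q3) (B_Delta p q3) (B_Delta q1 q3) (B_Delta q1 p)"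
    using gram_det_B_Delta[of q1 p q3] gram_det_B_Delta[of q1' p' q5] unfolding q l l' pp m det5 1(2) by simp
  then have "(D * B_Delta p p - (B_Delta q1 p)\<^sup>2) * (B_Delta q5 q5 - B_Delta q3 q3) = 0"
    unfolding gram_det_def by (simp add: algebra_simps power2_eq_square)
  then have l'': "B_Delta q5 q5 = B_Delta q3 q3" unfolding DM using e by simp
  have "\<exists>a b c d s. (s = 1 \<or> s = -1) \<and> a * d - b * c = s \<and>
     q1' = qscale s (form_act a b c d q1) \<and> p' = qscale s (form_act a b c d p) \<and> q5 = qscale s (form_act a b c d q3)"
    by (rule isometric_triples) (simp_all add: q pp l l' l'' m 1(2) det5)
  then obtain a b c' d t where t: "t = 1 \<or> t = -1" "a * d - b * c' = t"
     "q1' = qscale t (form_act a b c' d q1)" "p' = qscale t (form_act a b c' d p)" by blast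
  have q2'': "q2' = qscale t (form_act a b c' d q2)"
    unfolding q2' t(3,4) 1(1) form_act_linear by (simp add: qscale_simps mult.commute)
  have t2: "t * t = 1" using t(1) by auto
  have "lead_minor q1' q2' = (t * t) * lead_minor (form_act a b c' d q1) (form_act a b c' d q2)"
    unfolding t(3) q2'' lead_minor_linear by simp
  then have "sgn (lead_minor q1' q2') = t * sgn (lead_minor q1 q2)"
    using lead_minor_form_act(1)[OF _ pair(1) t(2,1)] DN N_pos t2 by simp
  moreover have "sgn (lead_minor q1' q2') = sgn (lead_minor q1 q2)"
    using sig unfolding signature_of_def by simp
  moreover have "lead_minor q1 q2 \<noteq> 0"
    using lead_minor_form_act(2)[OF _ pair(1) t(2,1)] DN N_pos by simp
  \<comment> \<open>An isometry with t = -1 would reverse the sign of the Jacobian; equal signs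
    therefore place the matrix in SL(2,Z).\<close>
  ultimately have "t = 1" using t(1) by (auto simp: sgn_if split: if_splits)
  then have "q1' = form_act a b c' d q1" "q2' = form_act a b c' d q2" "a * d - b * c' = 1"
    using t q2'' by (simp_all add: qscale_simps)
  then show ?thesis unfolding sim2_def by blast
qed

text \<open>A Gram matrix for q1, p, q3 is written down from (e, M, k), every division by D being
  legitimate because D is prime to 4N, and \<open>realizable_disc_like\<close> turns it into forms.
  Negating all three forms corrects the orientation, and a reflection corrects the sign of the
  Jacobian.\<close>

lemma signature_of_surj:
  assumes "(e, M, k) \<in> square_divisor_roots D N" "s = 1 \<or> s = - 1"
  shows "\<exists>q1 q2. (q1, q2) \<in> form_pairs D D2 n \<and> signature_of q1 q2 e M k s"
proof -
  have e: "e > 0" "M > 0" "e\<^sup>2 * M = N" "4 * M dvd (2 * k + 1)\<^sup>2 - D"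
    using assms(1) unfolding square_divisor_roots_def by auto
  have "coprime D e" using coprime_DN e(3) by (metis coprime_mult_right_iff power2_eq_square)
  then obtain i j where ij: "i * D + j * e = 1" using bezout_int[of D e] by (auto simp: coprime_iff_gcd_eq_1)
  define c where "c = i * n"
  define m where "m = j * n"
  have n: "n = e * m + c * D"
  proof -
    have "n = (i * D + j * e) * n" using ij by simp
    then show ?thesis by (simp add: c_def m_def algebra_simps)
  qed
  \<comment> \<open>The norm that q2 - c q1 = e p has to have; it must be e^2 times the norm D' of
    p.\<close>
  define Y where "Y = D2 - 2 * n * c + c\<^sup>2 * D"
  have DY: "D * Y = e\<^sup>2 * (4 * M + m\<^sup>2)"
  proof -
    have "D * Y = 4 * N + (n - c * D)\<^sup>2" unfolding DN[symmetric] Y_def by (simp add: power2_eq_square algebra_simps)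
    also have "n - c * D = e * m" using n by simp
    finally show ?thesis unfolding e(3)[symmetric] by (simp add: power2_eq_square algebra_simps)
  qed
  have "coprime (e\<^sup>2) D" using \<open>coprime D e\<close> by (simp add: coprime_commute)
  moreover have "e\<^sup>2 dvd D * Y" unfolding DY by simp
  ultimately have "e\<^sup>2 dvd Y" by (simp add: coprime_dvd_mult_right_iff)
  then obtain D' where D': "Y = e\<^sup>2 * D'" by (elim dvdE)
  have "e\<^sup>2 * (D * D') = e\<^sup>2 * (4 * M + m\<^sup>2)" using DY unfolding D' by (simp add: algebra_simps)
  then have DD': "D * D' = 4 * M + m\<^sup>2" using e(1) unfolding mult_cancel_left by simp
  have "coprime D m"
  proof (rule coprime_intI_prime)
    fix r assume r: "prime r" "r dvd D" "r dvd m"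
    then have "r dvd D * D' - m\<^sup>2" by (simp add: power2_eq_square)
    then have "r dvd 4 * M" unfolding DD' by simp
    then have "r dvd 4 * N" using e(3) by (metis dvd_mult mult.left_commute)
    then show False using r coprime_D4N by (meson coprime_common_divisor not_prime_unit)
  qed
  then obtain u v where uv: "u * D + v * m = 1" using bezout_int[of D m] by (auto simp: coprime_iff_gcd_eq_1)
  define \<beta> where "\<beta> = 2 * k + 1"
  \<comment> \<open>2m' and 2l' are to be the pairings of q3 with p and q1. Bezout solves D m' - m
    l' = 2k + 1, which is the condition on k with equality.\<close>
  define m' l' where "m' = u * \<beta>" and "l' = - v * \<beta>"
  have beta: "D * m' - m * l' = \<beta>"
  proof -
    have "D * m' - m * l' = (u * D + v * m) * \<beta>" by (simp add: m'_def l'_def algebra_simps)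
    then show ?thesis using uv by simp
  qed
  obtain t where t: "\<beta>\<^sup>2 = D + 4 * M * t" using e(4) unfolding \<beta>_def by (metis add.commute diff_eq_eq dvdE)
  \<comment> \<open>If q3 has norm 4d, the determinant is -4 exactly when Z = 4 M d. The congruence
    for k makes D Z divisible by 4M, and D can be cancelled.\<close>
  define Z where "Z = D * m'\<^sup>2 - 2 * m * l' * m' + D' * l'\<^sup>2 - 1"
  have "D * Z = \<beta>\<^sup>2 + (D * D' - m\<^sup>2) * l'\<^sup>2 - D"
    unfolding beta[symmetric] Z_def by (simp add: power2_eq_square algebra_simps)
  also have "\<dots> = 4 * M * (t + l'\<^sup>2)" unfolding DD' t by (simp add: algebra_simps)
  finally have DZ: "D * Z = 4 * M * (t + l'\<^sup>2)" .
  have "coprime (4 * M) D"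
  proof -
    have "4 * M dvd 4 * N" using e(3) by (metis dvd_triv_right mult.left_commute mult_dvd_mono dvd_refl)
    then show ?thesis using coprime_D4N by (meson coprime_commute coprime_divisors dvd_refl)
  qed
  moreover have "4 * M dvd D * Z" unfolding DZ by simp
  ultimately have "4 * M dvd Z" by (simp add: coprime_dvd_mult_right_iff)
  then obtain d where d: "Z = 4 * M * d" by (elim dvdE)
  \<comment> \<open>The parity vector is (1, m, 0).\<close>
  have "disc_like D D' (4 * d) (2 * m') (2 * l') m"
    unfolding disc_like_def
  proof (intro conjI exI)
    have "gram_det D D' (4 * d) (2 * m') (2 * l') m = (D * D' - m\<^sup>2) * 4 * d - 4 * (Z + 1)"
      unfolding gram_det_def Z_def by (simp add: power2_eq_square algebra_simps)
    also have "\<dots> = - 4" unfolding DD' d by (simp add: algebra_simps)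
    finally show "gram_det D D' (4 * d) (2 * m') (2 * l') m = - 4" .
    show "4 dvd D - 1\<^sup>2" unfolding power_one using D_mod_4 by presburger
    have "(4::int) dvd (D - 1) * D'" using \<open>4 dvd D - 1\<^sup>2\<close> by simp
    moreover have "(D - 1) * D' = 4 * M - (D' - m\<^sup>2)" using DD' by (simp add: algebra_simps)
    ultimately show "4 dvd D' - m\<^sup>2" by (metis dvd_diff_right_iff dvd_triv_left)
    show "4 dvd 4 * d - 0\<^sup>2" "2 dvd 2 * m' - m * 0" "2 dvd 2 * l' - 1 * 0" "2 dvd m - 1 * m" by simp_all
  qed
  then obtain q1 p q3 where real: "B_Delta q1 q1 = D" "B_Delta p p = D'" "B_Delta q3 q3 = 4 * d"
     "B_Delta p q3 = 2 * m'" "B_Delta q1 q3 = 2 * l'" "B_Delta q1 p = m"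
    using realizable_disc_like unfolding realizable_def by blast
  have "(det3 q1 p q3)\<^sup>2 = 1"
    using gram_det_B_Delta[of q1 p q3] \<open>disc_like _ _ _ _ _ _\<close> unfolding real disc_like_def by simp
  then consider "det3 q1 p q3 = 1" | "det3 q1 p q3 = - 1" by (auto simp: power2_eq_1_iff)
  then obtain q1 p q3 where real: "B_Delta q1 q1 = D" "B_Delta p p = D'" "B_Delta q3 q3 = 4 * d"
     "B_Delta p q3 = 2 * m'" "B_Delta q1 q3 = 2 * l'" "B_Delta q1 p = m" and det: "det3 q1 p q3 = 1"
  proof cases
    case 1 then show ?thesis using real that by blast
  next
    case 2 then show ?thesis using real that[of "qscale (-1) q1" "qscale (-1) p" "qscale (-1) q3"]
      by (simp add: B_Delta_bilinear det3_linear)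
  qed
  have core: "\<exists>q1 q2. (q1, q2) \<in> form_pairs D D2 n \<and> signature_of q1 q2 e M k s"
    if real: "B_Delta q1 q1 = D" "B_Delta p p = D'"
     "B_Delta p q3 = 2 * m'" "B_Delta q1 q3 = 2 * l'" "B_Delta q1 p = m" and det: "det3 q1 p q3 = 1"
     and s: "sgn (lead_minor q1 p) = s" for q1 p q3
  proof -
    define q2 where "q2 = qadd (qscale e p) (qscale c q1)"
    have "B_Delta q1 q2 = n" by (simp add: q2_def B_Delta_bilinear real n)
    moreover have "B_Delta q2 q2 = D2"
    proof -
      have "B_Delta q2 q2 = e\<^sup>2 * D' + 2 * e * c * m + c\<^sup>2 * D"
        by (simp add: q2_def B_Delta_bilinear real B_Delta_commute[of p q1] power2_eq_square algebra_simps)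
      also have "\<dots> = D2" unfolding D'[symmetric] Y_def n by (simp add: power2_eq_square algebra_simps)
      finally show ?thesis .
    qed
    ultimately have mem: "(q1, q2) \<in> form_pairs D D2 n" by (simp add: form_pairs_altdef real)
    have "sgn (lead_minor q1 q2) = s" using e(1) s by (simp add: q2_def lead_minor_linear sgn_mult)
    moreover have "D * B_Delta p q3 - B_Delta q1 p * B_Delta q1 q3 - 2 * (2 * k + 1) = 0"
      using beta unfolding real \<beta>_def by (simp add: algebra_simps)
    ultimately have "signature_of q1 q2 e M k s"
      unfolding signature_of_def using assms(1) q2_def det by (metis dvd_0_right)
    with mem show ?thesis by blast
  qed
  have lead0: "lead_minor q1 p \<noteq> 0"
    by (rule lead_minor_form_act(2)[of D D' m q1 p 1 1 0 0 1]) (use real DD' e in \<open>simp_all add: form_pairs_altdef\<close>)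
  \<comment> \<open>Minus the action of the diagonal matrix (1, -1): a proper isometry that reverses
    the Jacobian.\<close>
  define flip :: "qform \<Rightarrow> qform" where "flip = (\<lambda>(A, B, C). (- A, B, - C))"
  have flip: "B_Delta (flip q) (flip r) = B_Delta q r" "det3 (flip q) (flip r) (flip t) = det3 q r t"
     "lead_minor (flip q) (flip r) = - lead_minor q r" for q r t
    by (cases q; cases r; cases t; simp add: flip_def algebra_simps)+
  show ?thesis
  proof (cases "sgn (lead_minor q1 p) = s")
    case True
    then show ?thesis using core[OF real(1,2,4,5,6) det] by blast
  next
    case False
    then have "sgn (lead_minor (flip q1) (flip p)) = s" using assms(2) lead0 by (auto simp: flip sgn_if split: if_splits)
    then show ?thesis using core[of "flip q1" "flip p" "flip q3"] by (simp add: flip real det)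
  qed
qed

end

section \<open>Counting roots of a quadratic congruence\<close>

definition residue_roots :: "int \<Rightarrow> int \<Rightarrow> int set" where
  "residue_roots D M = {k. 0 \<le> k \<and> k < M \<and> 4 * M dvd (2 * k + 1)\<^sup>2 - D}"

lemma square_divisor_rootsI:
  "e > 0 \<Longrightarrow> M > 0 \<Longrightarrow> e\<^sup>2 * M = N \<Longrightarrow> 0 \<le> k \<Longrightarrow> k < M \<Longrightarrow> 4 * M dvd (2 * k + 1)\<^sup>2 - D \<Longrightarrow>
     (e, M, k) \<in> square_divisor_roots D N"
  by (simp add: square_divisor_roots_def)

lemma square_divisor_rootsE:
  assumes "x \<in> square_divisor_roots D N"
  obtains e M k where "x = (e, M, k)" "e > 0" "M > 0" "e\<^sup>2 * M = N" "0 \<le> k" "k < M" "4 * M dvd (2 * k + 1)\<^sup>2 - D"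
  using assms by (auto simp: square_divisor_roots_def)

lemma square_divisor_roots_dvd:
  assumes "(e, M, k) \<in> square_divisor_roots D N"
  shows "e dvd N" "M dvd N"
proof -
  have "N = e\<^sup>2 * M" using assms by (simp add: square_divisor_roots_def)
  then show "e dvd N" "M dvd N" by (simp_all add: power2_eq_square)
qed

lemma root_cong:
  fixes k k' M D :: int
  assumes "M dvd k - k'"
  shows "4 * M dvd (2 * k + 1)\<^sup>2 - D \<longleftrightarrow> 4 * M dvd (2 * k' + 1)\<^sup>2 - D"
proof -
  obtain m where m: "k = k' + M * m" using assms by (metis add.commute diff_eq_eq dvdE)
  have "(2 * k + 1)\<^sup>2 - D = ((2 * k' + 1)\<^sup>2 - D) + 4 * M * (m * (2 * k' + 1) + m\<^sup>2 * M)"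
    unfolding m by (simp add: power2_eq_square algebra_simps)
  then show ?thesis by (metis dvd_add_left_iff dvd_triv_left)
qed

lemma finite_square_divisor_roots:
  assumes "N > 0"
  shows "finite (square_divisor_roots D N)"
proof (rule finite_subset)
  show "square_divisor_roots D N \<subseteq> {0..N} \<times> {0..N} \<times> {0..N}"
  proof
    fix x assume "x \<in> square_divisor_roots D N"
    then obtain e M k where x: "x = (e, M, k)" "e > 0" "M > 0" "e\<^sup>2 * M = N" "0 \<le> k" "k < M"
      by (rule square_divisor_rootsE)
    have "e dvd N" "M dvd N" using x(4) by (auto simp: power2_eq_square)
    then have "e \<le> N" "M \<le> N" using assms zdvd_imp_le by blast+
    then show "x \<in> {0..N} \<times> {0..N} \<times> {0..N}" using x by auto
  qed
qed simp

section \<open>Multiplicativity of the count\<close>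

lemma coprime_cofactors_eq:
  fixes a b c d :: int
  assumes "a * b = c * d" "coprime a d" "coprime b c" "a > 0" "c > 0"
  shows "a = c"
proof -
  have "a dvd c" using assms by (metis coprime_dvd_mult_left_iff dvd_triv_left)
  moreover have "c dvd a" using assms by (metis coprime_commute coprime_dvd_mult_left_iff dvd_triv_left)
  ultimately show ?thesis using assms by (simp add: zdvd_antisym_nonneg)
qed

lemma positive_division_decomp:
  fixes a b c :: int
  assumes "a dvd b * c" "a > 0"
  obtains x y where "a = x * y" "x dvd b" "y dvd c" "x > 0" "y > 0"
proof -
  obtain x y where xy: "a = x * y" "x dvd b" "y dvd c" using assms(1) division_decomp by blast
  have "a = \<bar>x\<bar> * \<bar>y\<bar>" using xy(1) assms(2) by (simp add: abs_mult[symmetric])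
  moreover have "x \<noteq> 0" "y \<noteq> 0" using xy(1) assms(2) by auto
  ultimately show ?thesis using that[of "\<bar>x\<bar>" "\<bar>y\<bar>"] xy by simp
qed

text \<open>e and M split uniquely along coprime N1 and N2, and the residues k combine by the
  Chinese remainder theorem.\<close>

lemma card_square_divisor_roots_mult:
  assumes "coprime N1 N2" "N1 > 0" "N2 > 0" "D mod 4 = 1"
  shows "card (square_divisor_roots D (N1 * N2)) = card (square_divisor_roots D N1) * card (square_divisor_roots D N2)"
proof -
  define S where "S = square_divisor_roots D"
  define G where "G = (\<lambda>((e1, M1, k1), (e2, M2, k2)).
      (e1 * e2 :: int, M1 * M2, SOME k. 0 \<le> k \<and> k < M1 * M2 \<and> M1 dvd k - k1 \<and> M2 dvd k - (k2::int)))"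
  have crt: "\<exists>k. 0 \<le> k \<and> k < M1 * M2 \<and> M1 dvd k - k1 \<and> M2 dvd k - (k2::int)"
    if pos: "coprime M1 M2" "M1 > 0" "M2 > 0" for M1 M2 k1 k2
  proof -
    obtain x where x: "[x = k1] (mod M1)" "[x = k2] (mod M2)"
      using binary_chinese_remainder_int[OF pos(1)] by blast
    define k where "k = x mod (M1 * M2)"
    have "0 \<le> k" "k < M1 * M2" using pos by (simp_all add: k_def)
    have "M1 * M2 dvd k - x" by (simp add: k_def mod_eq_dvd_iff[symmetric])
    then have "M1 dvd k - x" "M2 dvd k - x" using dvd_mult_left dvd_mult_right by blast+
    moreover have "M1 dvd x - k1" "M2 dvd x - k2" using x by (simp_all add: cong_iff_dvd_diff)
    ultimately have "M1 dvd (k - x) + (x - k1)" "M2 dvd (k - x) + (x - k2)" by (blast intro: dvd_add)+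
    then show ?thesis using \<open>0 \<le> k\<close> \<open>k < M1 * M2\<close> by auto
  qed
  have small: "k = k'" if "M dvd k - k'" "0 \<le> k" "k < M" "0 \<le> k'" "k' < M" for k k' M :: int
    using that dvd_imp_le_int[of "k - k'" M] by (cases "k = k'") auto
  have cop: "coprime x y" if "x dvd N1" "y dvd N2" for x y using assms(1) that coprime_divisors by blast
  have Gspec: "\<exists>k. G ((e1, M1, k1), (e2, M2, k2)) = (e1 * e2, M1 * M2, k) \<and> 0 \<le> k \<and> k < M1 * M2 \<and> M1 dvd k - k1 \<and> M2 dvd k - k2"
    if "coprime M1 M2" "M1 > 0" "M2 > 0" for e1 M1 k1 e2 M2 k2
    using someI_ex[OF crt[OF that, of k1 k2]] by (simp add: G_def)
  have "bij_betw G (S N1 \<times> S N2) (S (N1 * N2))"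
    unfolding bij_betw_def
  proof (intro conjI)
    show "inj_on G (S N1 \<times> S N2)"
    proof (rule inj_onI, clarsimp)
      fix e1 M1 k1 e2 M2 k2 e1' M1' k1' e2' M2' k2'
      assume mem: "(e1, M1, k1) \<in> S N1" "(e2, M2, k2) \<in> S N2" "(e1', M1', k1') \<in> S N1" "(e2', M2', k2') \<in> S N2"
        and eq: "G ((e1, M1, k1), e2, M2, k2) = G ((e1', M1', k1'), e2', M2', k2')"
      note mem' = mem[unfolded S_def square_divisor_roots_def, simplified]
      have dv: "e1 dvd N1" "e2 dvd N2" "e1' dvd N1" "e2' dvd N2" "M1 dvd N1" "M2 dvd N2" "M1' dvd N1" "M2' dvd N2"
        using mem square_divisor_roots_dvd unfolding S_def by blast+
      obtain k where k: "G ((e1, M1, k1), (e2, M2, k2)) = (e1 * e2, M1 * M2, k)" "M1 dvd k - k1" "M2 dvd k - k2"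
        using Gspec[OF cop[OF dv(5,6)]] mem' by blast
      obtain k' where k': "G ((e1', M1', k1'), (e2', M2', k2')) = (e1' * e2', M1' * M2', k')" "M1' dvd k' - k1'" "M2' dvd k' - k2'"
        using Gspec[OF cop[OF dv(7,8)]] mem' by blast
      have ee: "e1 * e2 = e1' * e2'" "k = k'" using eq k k' by simp_all
      have e1: "e1 = e1'" by (rule coprime_cofactors_eq[OF ee(1)]) (use mem' dv cop coprime_commute in auto)
      then have e2: "e2 = e2'" using ee mem' by simp
      have M: "M1 = M1'" "M2 = M2'" using mem' e1 e2 by (metis less_irrefl mult_cancel_left power_eq_0_iff)+
      have "M1 dvd (k - k1') - (k - k1)" by (rule dvd_diff) (use k k' ee M in auto)
      then have k1: "k1 = k1'" using mem' M by (intro small[of M1]) auto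
      have "M2 dvd (k - k2') - (k - k2)" by (rule dvd_diff) (use k k' ee M in auto)
      then have k2: "k2 = k2'" using mem' M by (intro small[of M2]) auto
      show "e1 = e1' \<and> M1 = M1' \<and> k1 = k1' \<and> e2 = e2' \<and> M2 = M2' \<and> k2 = k2'"
        using e1 e2 M k1 k2 by simp
    qed
    show "G ` (S N1 \<times> S N2) = S (N1 * N2)"
    proof (intro equalityI subsetI)
      fix x assume "x \<in> G ` (S N1 \<times> S N2)"
      then obtain e1 M1 k1 e2 M2 k2 where mem: "(e1, M1, k1) \<in> S N1" "(e2, M2, k2) \<in> S N2"
        and x: "x = G ((e1, M1, k1), (e2, M2, k2))" by auto
      note mem' = mem[unfolded S_def square_divisor_roots_def, simplified]
      have dv: "M1 dvd N1" "M2 dvd N2" using mem square_divisor_roots_dvd unfolding S_def by blast+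
      obtain k where k: "x = (e1 * e2, M1 * M2, k)" "0 \<le> k" "k < M1 * M2" "M1 dvd k - k1" "M2 dvd k - k2"
        using Gspec[OF cop[OF dv]] mem' x by blast
      have "4 * M1 dvd (2 * k + 1)\<^sup>2 - D" "4 * M2 dvd (2 * k + 1)\<^sup>2 - D"
        using root_cong[OF k(4)] root_cong[OF k(5)] mem' by auto
      \<comment> \<open>4 M1 and 4 M2 are not coprime, so the common factor 4 is divided out before
        the two divisibilities are combined.\<close>
      then obtain a where a: "(2 * k + 1)\<^sup>2 - D = 4 * a" "M1 dvd a" "M2 dvd a"
      proof -
        assume 1: "4 * M1 dvd (2 * k + 1)\<^sup>2 - D" "4 * M2 dvd (2 * k + 1)\<^sup>2 - D"
        then obtain a where a: "(2 * k + 1)\<^sup>2 - D = 4 * a" by (metis dvdE dvd_mult_left)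
        show ?thesis using 1 that[OF a] unfolding a dvd_mult_cancel_left by simp
      qed
      have "M1 * M2 dvd a" using a cop[OF dv] by (simp add: divides_mult)
      then have "4 * (M1 * M2) dvd (2 * k + 1)\<^sup>2 - D" unfolding a by simp
      then show "x \<in> S (N1 * N2)" unfolding S_def k
        using mem' k by (intro square_divisor_rootsI) (auto simp: power_mult_distrib)
    next
      fix x assume "x \<in> S (N1 * N2)"
      then obtain e M k where x: "x = (e, M, k)" "e > 0" "M > 0" "e\<^sup>2 * M = N1 * N2" "0 \<le> k" "k < M" "4 * M dvd (2 * k + 1)\<^sup>2 - D"
        unfolding S_def by (rule square_divisor_rootsE)
      have "e dvd N1 * N2" "M dvd N1 * N2" unfolding x(4)[symmetric] by (simp_all add: power2_eq_square)
      then obtain e1 e2 M1 M2 where e: "e = e1 * e2" "e1 dvd N1" "e2 dvd N2" "e1 > 0" "e2 > 0"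
        and M: "M = M1 * M2" "M1 dvd N1" "M2 dvd N2" "M1 > 0" "M2 > 0"
        using x(2,3) by (metis positive_division_decomp)
      have eq: "(e1\<^sup>2 * M1) * (e2\<^sup>2 * M2) = N1 * N2" using x(4) unfolding e M by (simp add: power_mult_distrib algebra_simps)
      have c1: "coprime (e1\<^sup>2 * M1) N2" "coprime (e2\<^sup>2 * M2) N1"
        using cop[OF e(2) dvd_refl] cop[OF M(2) dvd_refl] cop[OF dvd_refl e(3)] cop[OF dvd_refl M(3)] by (simp_all add: coprime_commute)
      have n1: "e1\<^sup>2 * M1 = N1" by (rule coprime_cofactors_eq[OF eq c1]) (use e M assms in auto)
      then have n2: "e2\<^sup>2 * M2 = N2" using eq assms by simp
      have dd: "4 * M1 dvd (2 * k + 1)\<^sup>2 - D" "4 * M2 dvd (2 * k + 1)\<^sup>2 - D"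
        using x(7) unfolding M by (metis dvd_mult_left mult.assoc mult.commute)+
      have r1: "M1 dvd k - k mod M1" "M2 dvd k - k mod M2" by (simp_all add: minus_mod_eq_mult_div)
      have mem: "(e1, M1, k mod M1) \<in> S N1" "(e2, M2, k mod M2) \<in> S N2"
        unfolding S_def using dd root_cong[OF r1(1)] root_cong[OF r1(2)] n1 n2 e M
        by (auto intro!: square_divisor_rootsI)
      obtain k' where k': "G ((e1, M1, k mod M1), (e2, M2, k mod M2)) = (e1 * e2, M1 * M2, k')" "0 \<le> k'" "k' < M1 * M2"
         "M1 dvd k' - k mod M1" "M2 dvd k' - k mod M2"
        using Gspec[OF cop[OF M(2,3)] M(4,5)] by blast
      have "M1 dvd (k' - k mod M1) - (k - k mod M1)" "M2 dvd (k' - k mod M2) - (k - k mod M2)"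
        using k' r1 by (blast intro: dvd_diff)+
      then have "M1 * M2 dvd k' - k" using cop[OF M(2,3)] by (simp add: divides_mult)
      then have "k' = k" using k' x M by (intro small) auto
      then have "x = G ((e1, M1, k mod M1), (e2, M2, k mod M2))" using k'(1) x(1) e(1) M(1) by simp
      moreover have "((e1, M1, k mod M1), (e2, M2, k mod M2)) \<in> S N1 \<times> S N2" using mem by simp
      ultimately show "x \<in> G ` (S N1 \<times> S N2)" by (rule image_eqI)
    qed
  qed
  then show ?thesis by (simp add: bij_betw_same_card[symmetric] S_def[symmetric] card_cartesian_product)
qed

text \<open>At p = 2 the modulus is 8, where every odd square is 1, so solvability means D = 1
  modulo 8; the residue 7 in the Kronecker symbol is excluded by D = 1 modulo 4. For odd p, a square
  root of D modulo p is made odd by adding p if necessary, and then divisibility by 4 is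
  automatic.\<close>

lemma kronecker_prime_root:
  fixes D :: int and p :: nat
  assumes "prime p" "\<not> int p dvd D" "D mod 4 = 1"
  shows "kronecker_prime D p = 1 \<or> kronecker_prime D p = - 1"
    and "kronecker_prime D p = 1 \<longleftrightarrow> (\<exists>k::int. 4 * int p dvd (2 * k + 1)\<^sup>2 - D)"
proof -
  have odd: "odd D" using assms(3) by presburger
  show "kronecker_prime D p = 1 \<or> kronecker_prime D p = - 1"
    using assms(2) odd by (auto simp: kronecker_prime_def Legendre_def cong_0_iff)
  show "kronecker_prime D p = 1 \<longleftrightarrow> (\<exists>k::int. 4 * int p dvd (2 * k + 1)\<^sup>2 - D)"
  proof (cases "p = 2")
    case True
    have sq: "(2 * k + 1)\<^sup>2 mod 8 = 1" for k :: int
    proof -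
      have "even (k * (k + 1))" by simp
      then obtain t where "k * (k + 1) = 2 * t" by (elim evenE)
      then have "(2 * k + 1)\<^sup>2 = 8 * t + 1" by (simp add: power2_eq_square algebra_simps)
      then show ?thesis by presburger
    qed
    have "8 dvd X - D \<longleftrightarrow> D mod 8 = 1" if "X mod 8 = 1" for X using that by presburger
    with sq have root: "8 dvd (2 * k + 1)\<^sup>2 - D \<longleftrightarrow> D mod 8 = 1" for k by blast
    have "D mod 8 \<noteq> 7" using assms(3) by presburger
    then have "kronecker_prime D p = 1 \<longleftrightarrow> D mod 8 = 1" using True odd by (simp add: kronecker_prime_def)
    moreover have "4 * int p = 8" using True by simp
    ultimately show ?thesis by (simp only: root simp_thms)
  next
    case False
    then have op: "odd (int p)" using prime_odd_nat[OF assms(1)] prime_ge_2_nat[OF assms(1)] by simp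
    then have "coprime (int p) (2 ^ 2)" unfolding coprime_power_right_iff by simp
    then have "coprime (int p) 4" by simp
    have "kronecker_prime D p = 1 \<longleftrightarrow> QuadRes (int p) D"
      using False assms(2) by (auto simp: kronecker_prime_def Legendre_def cong_0_iff)
    also have "\<dots> \<longleftrightarrow> (\<exists>k::int. 4 * int p dvd (2 * k + 1)\<^sup>2 - D)"
    proof
      assume "QuadRes (int p) D"
      then obtain y where y: "int p dvd y\<^sup>2 - D" by (auto simp: QuadRes_def cong_iff_dvd_diff)
      define z where "z = (if odd y then y else y + int p)"
      have "odd z" using op by (simp add: z_def)
      have "int p dvd z\<^sup>2 - D"
      proof (cases "odd y")
        case True then show ?thesis using y by (simp add: z_def)
      next
        case False
        then have "z\<^sup>2 - D = (y\<^sup>2 - D) + int p * (2 * y + int p)" by (simp add: z_def power2_eq_square algebra_simps)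
        then show ?thesis by (simp only: dvd_add[OF y dvd_triv_left])
      qed
      moreover have "4 dvd z\<^sup>2 - D"
        using square_mod_4[of z] \<open>odd z\<close> assms(3) by presburger
      ultimately have "4 * int p dvd z\<^sup>2 - D" using \<open>coprime (int p) 4\<close> by (simp add: divides_mult coprime_commute)
      moreover obtain k where "z = 2 * k + 1" using \<open>odd z\<close> by (elim oddE)
      ultimately show "\<exists>k::int. 4 * int p dvd (2 * k + 1)\<^sup>2 - D" by blast
    next
      assume "\<exists>k::int. 4 * int p dvd (2 * k + 1)\<^sup>2 - D"
      then show "QuadRes (int p) D" unfolding QuadRes_def cong_iff_dvd_diff using dvd_mult_right by blast
    qed
    finally show ?thesis .
  qed
qed

section \<open>Local counts at prime powers\<close>

lemma card_square_divisor_roots_1: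
  assumes "D mod 4 = 1"
  shows "card (square_divisor_roots D 1) = 1"
proof -
  have "4 dvd 1 - D" using assms by presburger
  then have "(1, 1, 0) \<in> square_divisor_roots D 1" by (simp add: square_divisor_roots_def)
  moreover have "x = (1, 1, 0)" if mem: "x \<in> square_divisor_roots D 1" for x
  proof -
    obtain e M k where x: "x = (e, M, k)" "e > 0" "M > 0" "e\<^sup>2 * M = 1" "0 \<le> k" "k < M"
      using mem by (rule square_divisor_rootsE)
    have "e dvd 1" "M dvd 1" unfolding x(4)[symmetric] by (simp_all add: power2_eq_square)
    then show ?thesis using x by auto
  qed
  ultimately have "square_divisor_roots D 1 = {(1, 1, 0)}" by blast
  then show ?thesis by simp
qed

text \<open>Hensel lifting for k^2 + k - (D - 1)/4. Its derivative 2k + 1 is prime to p, as its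
  square is D modulo p, so p = 2 is treated like every other prime.\<close>

lemma prime_power_roots_lift:
  fixes p k D :: int
  assumes "prime p" "\<not> p dvd D" "4 * p dvd (2 * k + 1)\<^sup>2 - D"
  shows "\<exists>k'. 4 * p ^ Suc m dvd (2 * k' + 1)\<^sup>2 - D"
proof (induction m)
  case 0
  then show ?case using assms(3) by auto
next
  case (Suc m)
  then obtain k' where k': "4 * p ^ Suc m dvd (2 * k' + 1)\<^sup>2 - D" by blast
  then obtain f where f: "(2 * k' + 1)\<^sup>2 - D = 4 * p ^ Suc m * f" by (elim dvdE)
  have "coprime p (2 * k' + 1)"
  proof (rule prime_imp_coprime[OF assms(1)])
    show "\<not> p dvd 2 * k' + 1"
    proof
      assume "p dvd 2 * k' + 1"
      then have "p dvd (2 * k' + 1)\<^sup>2 - 4 * p ^ Suc m * f" by (simp add: power2_eq_square)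
      then show False using assms(2) unfolding f[symmetric] by simp
    qed
  qed
  then obtain x y where "x * p + y * (2 * k' + 1) = 1"
    using bezout_int[of p "2 * k' + 1"] by (auto simp: coprime_iff_gcd_eq_1)
  then have y: "y * (2 * k' + 1) = 1 - x * p" by simp
  \<comment> \<open>The Newton correction: y is an inverse of the derivative modulo p.\<close>
  define t where "t = - f * y"
  have "(2 * (k' + t * p ^ Suc m) + 1)\<^sup>2 - D = 4 * p ^ Suc m * (f + t * (2 * k' + 1) + t\<^sup>2 * p ^ Suc m)"
  proof -
    have "(2 * (k' + t * p ^ Suc m) + 1)\<^sup>2 - D = ((2 * k' + 1)\<^sup>2 - D) + 4 * p ^ Suc m * (t * (2 * k' + 1) + t\<^sup>2 * p ^ Suc m)"
      by (simp only: power2_eq_square) (simp add: algebra_simps)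
    then show ?thesis unfolding f by (simp add: algebra_simps)
  qed
  also have "t * (2 * k' + 1) = - f * (y * (2 * k' + 1))" by (simp add: t_def)
  also have "f + - f * (y * (2 * k' + 1)) + t\<^sup>2 * p ^ Suc m = p * (f * x + t\<^sup>2 * p ^ m)"
    unfolding y by (simp add: algebra_simps)
  finally have "4 * p ^ Suc (Suc m) dvd (2 * (k' + t * p ^ Suc m) + 1)\<^sup>2 - D"
    by (simp add: algebra_simps)
  then show ?case by blast
qed

text \<open>Negating the root 2k + 1 means replacing k by -1 - k. The two are distinct since p does
  not divide 2k + 1. There are no others: a further root has q dividing (k - k2) (k + k2 + 1), and
  the factors differ by 2 k2 + 1, so p divides at most one of them.\<close>

lemma card_residue_roots_prime_power:
  assumes "prime p" "\<not> int p dvd D" "D mod 4 = 1" "m > 0"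
  shows "card (residue_roots D (int p ^ m)) = (if kronecker_prime D p = 1 then 2 else 0)"
proof (cases "kronecker_prime D p = 1")
  case False
  have "residue_roots D (int p ^ m) = {}"
  proof (rule ccontr)
    assume "residue_roots D (int p ^ m) \<noteq> {}"
    then obtain k where k: "4 * int p ^ m dvd (2 * k + 1)\<^sup>2 - D" by (auto simp: residue_roots_def)
    have "int p dvd int p ^ m" using assms(4) by (simp add: dvd_power)
    then have "4 * int p dvd 4 * int p ^ m" by (simp only: dvd_mult_cancel_left simp_thms)
    then have "4 * int p dvd (2 * k + 1)\<^sup>2 - D" using k by (rule dvd_trans)
    then show False using kronecker_prime_root(2)[OF assms(1-3)] False by blast
  qed
  then show ?thesis using False by simp
next
  case True
  define q where "q = int p ^ m"
  have q0: "q > 0" using assms(1) by (simp add: q_def prime_gt_0_nat)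
  have pq: "int p dvd q" using assms(4) by (simp add: q_def dvd_power)
  have pp: "prime (int p)" using assms(1) by simp
  obtain k1 where "4 * int p dvd (2 * k1 + 1)\<^sup>2 - D" using True kronecker_prime_root(2)[OF assms(1-3)] by blast
  from prime_power_roots_lift[OF pp assms(2) this, of "m - 1"] obtain k2 where k2: "4 * q dvd (2 * k2 + 1)\<^sup>2 - D"
    using assms(4) by (auto simp: q_def)
  define a where "a = k2 mod q"
  define b where "b = (- 1 - k2) mod q"
  have ab: "q dvd a - k2" "q dvd b - (- 1 - k2)" by (simp_all add: a_def b_def mod_eq_dvd_iff[symmetric])
  have "4 * q dvd (2 * (- 1 - k2) + 1)\<^sup>2 - D" using k2 by (simp add: power2_eq_square algebra_simps)
  then have mem: "a \<in> residue_roots D q" "b \<in> residue_roots D q"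
    using root_cong[OF ab(1), of D] root_cong[OF ab(2), of D] k2 q0 by (simp_all add: residue_roots_def a_def b_def)
  have ndvd: "\<not> int p dvd 2 * k2 + 1"
  proof
    assume "int p dvd 2 * k2 + 1"
    then have "int p dvd (2 * k2 + 1)\<^sup>2" by (simp add: power2_eq_square)
    moreover have "int p dvd (2 * k2 + 1)\<^sup>2 - D" using k2 pq by (meson dvd_mult dvd_trans)
    ultimately show False using assms(2) by (metis dvd_diff_right_iff)
  qed
  have "a \<noteq> b"
  proof
    assume "a = b"
    have "q dvd (b - (- 1 - k2)) - (a - k2)" using ab(2,1) by (rule dvd_diff)
    then have "q dvd 2 * k2 + 1" using \<open>a = b\<close> by (simp add: algebra_simps)
    then show False using ndvd pq dvd_trans by blast
  qed
  have small: "x = y" if "q dvd x - y" "0 \<le> x" "x < q" "0 \<le> y" "y < q" for x y :: int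
    using that dvd_imp_le_int[of "x - y" q] by (cases "x = y") auto
  have abr: "0 \<le> a" "a < q" "0 \<le> b" "b < q" using mem by (simp_all add: residue_roots_def)
  have "residue_roots D q = {a, b}"
  proof (intro equalityI subsetI)
    fix k assume k: "k \<in> residue_roots D q"
    then have kr: "0 \<le> k" "k < q" "4 * q dvd (2 * k + 1)\<^sup>2 - D" by (auto simp: residue_roots_def)
    have "4 * q dvd ((2 * k + 1)\<^sup>2 - D) - ((2 * k2 + 1)\<^sup>2 - D)" using kr(3) k2 by (rule dvd_diff)
    also have "\<dots> = 4 * ((k - k2) * (k + k2 + 1))" by (simp add: power2_eq_square algebra_simps)
    finally have dv: "q dvd (k - k2) * (k + k2 + 1)" unfolding dvd_mult_cancel_left by simp
    show "k \<in> {a, b}"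
    proof (cases "int p dvd k - k2")
      case True
      have "\<not> int p dvd k + k2 + 1"
      proof
        assume "int p dvd k + k2 + 1"
        then have "int p dvd (k + k2 + 1) - (k - k2)" using True by (rule dvd_diff)
        then show False using ndvd by (simp add: algebra_simps)
      qed
      then have "coprime q (k + k2 + 1)" using prime_imp_coprime[OF pp] assms(4) by (simp add: q_def)
      then have "q dvd k - k2" using dv by (simp add: coprime_dvd_mult_left_iff)
      then have "q dvd (k - k2) - (a - k2)" using ab(1) by (rule dvd_diff)
      then show ?thesis using small[of k a] kr abr by simp
    next
      case False
      then have "coprime q (k - k2)" using prime_imp_coprime[OF pp] assms(4) by (simp add: q_def)
      then have "q dvd k + k2 + 1" using dv by (simp add: coprime_dvd_mult_right_iff)
      then have "q dvd (k + k2 + 1) - (b - (- 1 - k2))" using ab(2) by (rule dvd_diff)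
      then show ?thesis using small[of k b] kr abr by simp
    qed
  qed (use mem in auto)
  then show ?thesis using True \<open>a \<noteq> b\<close> by (simp add: q_def)
qed

lemma finite_residue_roots [simp]: "finite (residue_roots D M)"
  by (rule finite_subset[of _ "{0..<M}"]) (auto simp: residue_roots_def)

lemma card_square_divisor_roots_prime:
  assumes "prime (p::nat)"
  shows "card (square_divisor_roots D (int p)) = card (residue_roots D (int p))"
proof -
  have "square_divisor_roots D (int p) = (\<lambda>k. (1, int p, k)) ` residue_roots D (int p)"
  proof (intro equalityI subsetI)
    fix x assume "x \<in> square_divisor_roots D (int p)"
    then obtain e M k where x: "x = (e, M, k)" "e > 0" "M > 0" "e\<^sup>2 * M = int p" "0 \<le> k" "k < M" "4 * M dvd (2 * k + 1)\<^sup>2 - D"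
      by (rule square_divisor_rootsE)
    have pp: "prime (int p)" using assms by simp
    have "e dvd int p" unfolding x(4)[symmetric] by (simp add: power2_eq_square)
    then have "e = 1 \<or> e = int p" using pp x(2) unfolding prime_int_iff by auto
    moreover have "e \<noteq> int p"
    proof
      assume "e = int p"
      then have "int p * (int p * M) = int p * 1" using x(4) by (simp add: power2_eq_square)
      then have "int p * M = 1" using pp unfolding mult_cancel_left by auto
      then show False using pp by (metis dvd_triv_left not_prime_unit)
    qed
    ultimately show "x \<in> (\<lambda>k. (1, int p, k)) ` residue_roots D (int p)" using x by (auto simp: residue_roots_def)
  qed (use assms in \<open>auto simp: residue_roots_def square_divisor_roots_def prime_gt_0_nat\<close>)
  then show ?thesis by (simp add: card_image inj_on_def)
qed

text \<open>Triples with p dividing e lose one factor p from e and become triples for the exponent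
  g; in all others e = 1. This recursion in steps of two is the source of the parity condition on
  the exponents.\<close>

lemma card_square_divisor_roots_prime_power_step:
  assumes "prime (p::nat)"
  shows "card (square_divisor_roots D (int p ^ Suc (Suc g))) =
         card (residue_roots D (int p ^ Suc (Suc g))) + card (square_divisor_roots D (int p ^ g))"
proof -
  have pp: "prime (int p)" "int p > 0" using assms by (simp_all add: prime_gt_0_nat)
  define A where "A = (\<lambda>k. (1::int, int p ^ Suc (Suc g), k)) ` residue_roots D (int p ^ Suc (Suc g))"
  define B where "B = (\<lambda>(e, M, k). (int p * e, M, k)) ` square_divisor_roots D (int p ^ g)"
  have "square_divisor_roots D (int p ^ Suc (Suc g)) = A \<union> B"
  proof (intro equalityI subsetI)
    fix x assume "x \<in> square_divisor_roots D (int p ^ Suc (Suc g))"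
    then obtain e M k where x: "x = (e, M, k)" "e > 0" "M > 0" "e\<^sup>2 * M = int p ^ Suc (Suc g)" "0 \<le> k" "k < M" "4 * M dvd (2 * k + 1)\<^sup>2 - D"
      by (rule square_divisor_rootsE)
    show "x \<in> A \<union> B"
    proof (cases "int p dvd e")
      case True
      then obtain e' where e': "e = int p * e'" by (elim dvdE)
      have "(int p)\<^sup>2 * (e'\<^sup>2 * M) = (int p)\<^sup>2 * (int p ^ g)" using x(4) by (simp add: e' power2_eq_square algebra_simps)
      then have "e'\<^sup>2 * M = int p ^ g" using pp unfolding mult_cancel_left by simp
      moreover have "e' > 0" using x(2) pp e' by (simp add: zero_less_mult_iff)
      ultimately have "(e', M, k) \<in> square_divisor_roots D (int p ^ g)" using x by (intro square_divisor_rootsI)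
      then show ?thesis unfolding B_def x e' by force
    next
      case False
      have "e dvd int p ^ Suc (Suc g)" unfolding x(4)[symmetric] by (simp add: power2_eq_square)
      moreover have "coprime e (int p ^ Suc (Suc g))"
        using False prime_imp_coprime[OF pp(1)] by (simp only: coprime_power_right_iff coprime_commute[of e]) simp
      ultimately have "e = 1" using x(2) by (metis coprime_absorb_left zdvd1_eq abs_of_pos)
      then show ?thesis using x by (auto simp: A_def residue_roots_def)
    qed
  next
    fix x assume "x \<in> A \<union> B"
    then show "x \<in> square_divisor_roots D (int p ^ Suc (Suc g))"
    proof
      assume "x \<in> A"
      then show ?thesis using pp unfolding A_def residue_roots_def by (auto intro!: square_divisor_rootsI)
    next
      assume "x \<in> B"
      then obtain e M k where x: "x = (int p * e, M, k)" "(e, M, k) \<in> square_divisor_roots D (int p ^ g)"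
        unfolding B_def by auto
      then show ?thesis using pp unfolding square_divisor_roots_def by (auto simp: power_mult_distrib power2_eq_square)
    qed
  qed
  moreover have "A \<inter> B = {}"
  proof -
    have False if "1 = int p * e" for e using that pp by (metis dvd_triv_left not_prime_unit)
    then show ?thesis unfolding A_def B_def by fastforce
  qed
  moreover have "finite A" "finite B" using pp finite_square_divisor_roots[of "int p ^ g"] by (simp_all add: A_def B_def)
  moreover have "card A = card (residue_roots D (int p ^ Suc (Suc g)))"
    unfolding A_def by (intro card_image) (simp add: inj_on_def)
  moreover have "card B = card (square_divisor_roots D (int p ^ g))"
    unfolding B_def using pp by (intro card_image) (auto simp: inj_on_def)
  ultimately show ?thesis by (simp add: card_Un_disjoint)
qed

text \<open>For v = 1 or v = -1 this is 1 + v + ... + v^g, the local factor of the divisor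
  sum.\<close>

definition local_count :: "int \<Rightarrow> nat \<Rightarrow> nat" where
  "local_count v g = (if v = 1 then g + 1 else if even g then 1 else 0)"

lemma card_square_divisor_roots_prime_power:
  assumes "prime p" "\<not> int p dvd D" "D mod 4 = 1"
  shows "card (square_divisor_roots D (int p ^ g)) = local_count (kronecker_prime D p) g"
proof (induction g rule: less_induct)
  case (less g)
  consider "g = 0" | "g = 1" | h where "g = Suc (Suc h)" by (metis One_nat_def not0_implies_Suc)
  then show ?case
  proof cases
    case 1
    then show ?thesis by (simp add: card_square_divisor_roots_1 assms local_count_def)
  next
    case 2
    then show ?thesis
      using card_square_divisor_roots_prime[OF assms(1)] card_residue_roots_prime_power[OF assms, of 1]
      by (simp add: local_count_def)
  next
    case 3
    then show ?thesis
      using card_square_divisor_roots_prime_power_step[OF assms(1)] card_residue_roots_prime_power[OF assms, of "Suc (Suc h)"] less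
      by (simp add: local_count_def)
  qed
qed

text \<open>Splitting off the full power of one prime at a time suits counts whose multiplicativity
  is available for coprime arguments.\<close>

lemma coprime_prime_power_induct [consumes 1, case_names 1 prime_power_mult]:
  fixes N :: nat
  assumes "N > 0" "P 1"
    and "\<And>p g m. prime p \<Longrightarrow> g > 0 \<Longrightarrow> m > 0 \<Longrightarrow> \<not> p dvd m \<Longrightarrow> P m \<Longrightarrow> P (p ^ g * m)"
  shows "P N"
  using assms(1)
proof (induction N rule: less_induct)
  case (less N)
  show ?case
  proof (cases "N = 1")
    case True then show ?thesis using assms(2) by simp
  next
    case False
    then obtain p where p: "prime p" "p dvd N" using prime_factor_nat by blast
    obtain m where m: "N = p ^ multiplicity p N * m" "\<not> p dvd m"
      using multiplicity_decompose'[of N p] less.prems p(1) by (metis gr_implies_not0 not_prime_unit)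
    have g: "multiplicity p N > 0" using p less.prems by (simp add: prime_multiplicity_gt_zero_iff)
    have m0: "m > 0" using m(2) by (metis dvd_0_right neq0_conv)
    have "1 < p ^ multiplicity p N" using prime_gt_1_nat[OF p(1)] g by (rule one_less_power)
    then have "m < N" using m0 by (subst m(1)) simp
    then show ?thesis using assms(3)[OF p(1) g m0 m(2)] less.IH[OF _ m0] m(1) by metis
  qed
qed

lemma card_square_divisor_roots:
  assumes "N > 0" "coprime D (int N)" "D mod 4 = 1"
  shows "card (square_divisor_roots D (int N)) = (\<Prod>p\<in>prime_factors N. local_count (kronecker_prime D p) (multiplicity p N))"
  using assms(1,2)
proof (induction N rule: coprime_prime_power_induct)
  case 1
  then show ?case using card_square_divisor_roots_1[OF assms(3)] by simp
next
  case (prime_power_mult p g m)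
  have cop: "coprime D (int p)" "coprime D (int m)" using prime_power_mult by simp_all
  have "\<not> int p dvd D" using cop(1) prime_power_mult(1)
    by (metis coprime_common_divisor dvd_refl not_prime_unit prime_nat_int_transfer)
  have "coprime (int p ^ g) (int m)" using prime_power_mult prime_imp_coprime_nat by simp
  then have "card (square_divisor_roots D (int (p ^ g * m))) = local_count (kronecker_prime D p) g *
      (\<Prod>q\<in>prime_factors m. local_count (kronecker_prime D q) (multiplicity q m))"
    using card_square_divisor_roots_mult[of "int p ^ g" "int m" D] prime_power_mult cop assms(3)
      card_square_divisor_roots_prime_power[OF prime_power_mult(1) \<open>\<not> int p dvd D\<close> assms(3)]
    by (simp add: prime_gt_0_nat)
  also have "\<dots> = (\<Prod>q\<in>prime_factors (p ^ g * m). local_count (kronecker_prime D q) (multiplicity q (p ^ g * m)))"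
  proof -
    have pf: "prime_factors (p ^ g * m) = insert p (prime_factors m)"
      using prime_power_mult by (subst prime_factors_product) (auto simp: prime_factors_power prime_prime_factors)
    have np: "p \<notin> prime_factors m" using prime_power_mult by auto
    have mp: "multiplicity p (p ^ g * m) = g"
      using prime_power_mult by (subst prime_elem_multiplicity_mult_distrib) (auto simp: not_dvd_imp_multiplicity_0)
    have mq: "multiplicity q (p ^ g * m) = multiplicity q m" if "q \<in> prime_factors m" for q
    proof -
      have "prime q" "q \<noteq> p" using that np by auto
      then have "\<not> q dvd p ^ g" using prime_power_mult(1) prime_dvd_power primes_dvd_imp_eq by blast
      then have "multiplicity q (p ^ g) = 0" by (rule not_dvd_imp_multiplicity_0)
      then show ?thesis using \<open>prime q\<close> prime_power_mult
        by (subst prime_elem_multiplicity_mult_distrib) auto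
    qed
    show ?thesis unfolding pf using np mp mq by simp
  qed
  finally show ?case .
qed


section \<open>Divisor sums of the character\<close>

lemma sum_divisors_coprime_mult:
  fixes f :: "nat \<Rightarrow> 'a::comm_semiring_1"
  assumes "coprime a b" "a > 0" "b > 0" and f: "\<And>x y. coprime x y \<Longrightarrow> x > 0 \<Longrightarrow> y > 0 \<Longrightarrow> f (x * y) = f x * f y"
  shows "(\<Sum>d | d dvd a * b. f d) = (\<Sum>d | d dvd a. f d) * (\<Sum>d | d dvd b. f d)"
proof -
  have cop: "coprime x y" if "x dvd a" "y dvd b" for x y using assms(1) that coprime_divisors by blast
  have "bij_betw (\<lambda>(x, y). x * y) ({d. d dvd a} \<times> {d. d dvd b}) {d. d dvd a * b}"
    unfolding bij_betw_def
  proof (intro conjI)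
    show "inj_on (\<lambda>(x, y). x * y) ({d. d dvd a} \<times> {d. d dvd b})"
    proof (rule inj_onI, clarsimp)
      fix x y x' y' assume *: "x dvd a" "y dvd b" "x' dvd a" "y' dvd b" "x * y = x' * y'"
      have "x dvd x'" using * cop[of x y'] by (metis coprime_dvd_mult_left_iff dvd_triv_left)
      moreover have "x' dvd x" using * cop[of x' y] by (metis coprime_dvd_mult_left_iff dvd_triv_left)
      ultimately have "x = x'" by (rule dvd_antisym)
      moreover have "x \<noteq> 0" using *(1) assms(2) by auto
      ultimately show "x = x' \<and> y = y'" using *(5) by simp
    qed
    show "(\<lambda>(x, y). x * y) ` ({d. d dvd a} \<times> {d. d dvd b}) = {d. d dvd a * b}"
    proof (intro equalityI subsetI)
      fix d assume "d \<in> {d. d dvd a * b}"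
      then obtain x y where "d = x * y" "x dvd a" "y dvd b" using division_decomp by blast
      then show "d \<in> (\<lambda>(x, y). x * y) ` ({d. d dvd a} \<times> {d. d dvd b})" by force
    qed (auto intro: mult_dvd_mono)
  qed
  then have "(\<Sum>d | d dvd a * b. f d) = (\<Sum>(x, y)\<in>{d. d dvd a} \<times> {d. d dvd b}. f (x * y))"
    by (rule sum.reindex_bij_betw[symmetric, THEN trans]) (simp add: case_prod_unfold)
  also have "\<dots> = (\<Sum>(x, y)\<in>{d. d dvd a} \<times> {d. d dvd b}. f x * f y)"
    using assms(2,3) by (intro sum.cong) (auto intro!: f cop Nat.gr0I)
  also have "\<dots> = (\<Sum>d | d dvd a. f d) * (\<Sum>d | d dvd b. f d)"
    by (simp add: sum_product sum.cartesian_product)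
  finally show ?thesis .
qed

lemma prime_factors_coprime_mult:
  fixes x y :: nat
  assumes "coprime x y" "x > 0" "y > 0"
  shows "prime_factors (x * y) = prime_factors x \<union> prime_factors y" "prime_factors x \<inter> prime_factors y = {}"
    "p \<in> prime_factors x \<Longrightarrow> multiplicity p (x * y) = multiplicity p x"
    "p \<in> prime_factors y \<Longrightarrow> multiplicity p (x * y) = multiplicity p y"
proof -
  have no: False if "prime p" "p dvd x" "p dvd y" for p
    using that assms(1) by (meson coprime_common_divisor not_prime_unit)
  show "prime_factors (x * y) = prime_factors x \<union> prime_factors y"
    using assms by (simp add: prime_factors_product)
  show "prime_factors x \<inter> prime_factors y = {}" using no by auto
  show "multiplicity p (x * y) = multiplicity p x" if "p \<in> prime_factors x"
  proof -
    have "prime p" "\<not> p dvd y" using that no by auto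
    then show ?thesis using assms by (subst prime_elem_multiplicity_mult_distrib) (auto simp: not_dvd_imp_multiplicity_0)
  qed
  show "multiplicity p (x * y) = multiplicity p y" if "p \<in> prime_factors y"
  proof -
    have "prime p" "\<not> p dvd x" using that no by auto
    then show ?thesis using assms by (subst prime_elem_multiplicity_mult_distrib) (auto simp: not_dvd_imp_multiplicity_0)
  qed
qed

lemma eps_coprime_mult:
  assumes "coprime x y" "x > 0" "y > 0"
  shows "eps D1 D2 (x * y) = eps D1 D2 x * eps D1 D2 y"
proof -
  note pf = prime_factors_coprime_mult[OF assms]
  have "eps D1 D2 (x * y) = (\<Prod>p\<in>prime_factors x \<union> prime_factors y. eps_prime D1 D2 p ^ multiplicity p (x * y))"
    unfolding eps_def pf(1) ..
  also have "\<dots> = (\<Prod>p\<in>prime_factors x. eps_prime D1 D2 p ^ multiplicity p (x * y)) *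
      (\<Prod>p\<in>prime_factors y. eps_prime D1 D2 p ^ multiplicity p (x * y))"
    by (rule prod.union_disjoint) (simp_all add: pf(2))
  also have "\<dots> = eps D1 D2 x * eps D1 D2 y"
    unfolding eps_def using pf(3,4) by (intro arg_cong2[of _ _ _ _ "(*)"] prod.cong) auto
  finally show ?thesis .
qed

lemma eps_prime_power:
  assumes "prime p"
  shows "eps D1 D2 (p ^ i) = eps_prime D1 D2 p ^ i"
  using assms by (cases "i = 0") (simp_all add: eps_def prime_factors_power prime_prime_factors)

lemma sum_divisors_eps:
  assumes "N > 0" "\<And>p. p \<in> prime_factors N \<Longrightarrow> eps_prime D1 D2 p = 1 \<or> eps_prime D1 D2 p = - 1"
  shows "(\<Sum>d | d dvd N. eps D1 D2 d) = (\<Prod>p\<in>prime_factors N. int (local_count (eps_prime D1 D2 p) (multiplicity p N)))"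
  using assms
proof (induction N rule: coprime_prime_power_induct)
  case 1
  then show ?case by (simp add: eps_def)
next
  case (prime_power_mult p g m)
  have cop: "coprime (p ^ g) m" "p ^ g > 0" using prime_power_mult prime_imp_coprime_nat by (simp_all add: prime_gt_0_nat)
  note pf = prime_factors_coprime_mult[OF cop prime_power_mult(3)]
  have pfp: "prime_factors (p ^ g) = {p}" using prime_power_mult by (simp add: prime_factors_power prime_prime_factors)
  have ep: "eps_prime D1 D2 p = 1 \<or> eps_prime D1 D2 p = - 1"
    by (rule prime_power_mult.prems) (simp add: pf(1) pfp)
  have em: "\<And>q. q \<in> prime_factors m \<Longrightarrow> eps_prime D1 D2 q = 1 \<or> eps_prime D1 D2 q = - 1"
    by (rule prime_power_mult.prems) (simp add: pf(1))
  have "(\<Sum>d | d dvd p ^ g. eps D1 D2 d) = (\<Sum>i\<le>g. eps_prime D1 D2 p ^ i)"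
  proof -
    have "{d. d dvd p ^ g} = (\<lambda>i. p ^ i) ` {..g}"
      using divides_primepow_nat[OF prime_power_mult(1)] by auto
    moreover have "inj_on (\<lambda>i. p ^ i) {..g}"
      using prime_gt_1_nat[OF prime_power_mult(1)] by (auto simp: inj_on_def)
    ultimately show ?thesis using prime_power_mult(1) by (simp add: sum.reindex eps_prime_power)
  qed
  also have "\<dots> = int (local_count (eps_prime D1 D2 p) g)"
  proof (cases "eps_prime D1 D2 p = 1")
    case True
    then show ?thesis by (simp add: local_count_def)
  next
    case False
    then have "eps_prime D1 D2 p = - 1" using ep by blast
    moreover have "(\<Sum>i\<le>g. (- 1) ^ i) = (if even g then 1 else 0 :: int)" by (induction g) auto
    ultimately show ?thesis by (simp add: local_count_def)
  qed
  finally have 1: "(\<Sum>d | d dvd p ^ g. eps D1 D2 d) = int (local_count (eps_prime D1 D2 p) g)" .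
  have "(\<Sum>d | d dvd p ^ g * m. eps D1 D2 d) = int (local_count (eps_prime D1 D2 p) g) *
     (\<Prod>p\<in>prime_factors m. int (local_count (eps_prime D1 D2 p) (multiplicity p m)))"
    using sum_divisors_coprime_mult[OF cop prime_power_mult(3), of "eps D1 D2"] eps_coprime_mult
      prime_power_mult.IH[OF em] by (simp add: 1)
  also have "\<dots> = (\<Prod>q\<in>prime_factors (p ^ g * m). int (local_count (eps_prime D1 D2 q) (multiplicity q (p ^ g * m))))"
  proof -
    have "multiplicity p (p ^ g * m) = g" using pf(3)[of p] prime_power_mult(1) by (simp add: pfp)
    then show ?thesis unfolding pf(1) pfp using pf(2,4) by (simp add: pfp)
  qed
  finally show ?case .
qed

section \<open>Algebraic integers\<close>

text \<open>z is an eigenvalue of an integer matrix, hence a root of its characteristic polynomial,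
  which is monic with integer coefficients.\<close>

lemma algebraic_int_if_integer_matrix_nat:
  fixes z :: complex and v :: "nat \<Rightarrow> complex" and A :: "nat \<Rightarrow> nat \<Rightarrow> int"
  assumes "i0 < n" "v i0 \<noteq> 0" and eq: "\<And>i. i < n \<Longrightarrow> z * v i = (\<Sum>j<n. of_int (A i j) * v j)"
  shows "algebraic_int z"
proof -
  define M :: "int mat" where "M = mat n n (\<lambda>(i, j). A i j)"
  define w :: "complex vec" where "w = vec n v"
  have M: "M \<in> carrier_mat n n" by (simp add: M_def)
  define C where "C = map_mat complex_of_int M"
  have C: "C \<in> carrier_mat n n" by (simp add: C_def M)
  have "C *\<^sub>v w = z \<cdot>\<^sub>v w"
    by (rule eq_vecI) (auto simp: C_def M_def w_def eq scalar_prod_def lessThan_atLeast0)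
  moreover have "w \<noteq> 0\<^sub>v n"
  proof
    assume "w = 0\<^sub>v n"
    then have "w $ i0 = 0" using assms(1) by simp
    then show False using assms(1,2) by (simp add: w_def)
  qed
  ultimately have "eigenvalue C z"
    using C unfolding eigenvalue_def eigenvector_def by (intro exI[of _ w]) (simp add: w_def)
  then have "poly (char_poly C) z = 0" using eigenvalue_root_char_poly[OF C] by simp
  moreover have "char_poly C = map_poly of_int (char_poly M)"
    unfolding C_def by (rule of_int_hom.char_poly_hom[OF M])
  moreover have "lead_coeff (char_poly M) = 1" using degree_monic_char_poly[OF M] by simp
  ultimately show ?thesis unfolding algebraic_int_altdef_ipoly by metis
qed

lemma algebraic_int_if_integer_matrix:
  fixes z :: complex and v :: "'i \<Rightarrow> complex" and A :: "'i \<Rightarrow> 'i \<Rightarrow> int"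
  assumes "finite I" "i0 \<in> I" "v i0 \<noteq> 0" and eq: "\<And>i. i \<in> I \<Longrightarrow> z * v i = (\<Sum>j\<in>I. of_int (A i j) * v j)"
  shows "algebraic_int z"
proof -
  obtain h where h: "bij_betw h {0..<card I} I" using ex_bij_betw_nat_finite[OF assms(1)] by blast
  obtain k0 where k0: "k0 < card I" "h k0 = i0"
    using h assms(2) unfolding bij_betw_def by (metis atLeastLessThan_iff imageE)
  show ?thesis
  proof (rule algebraic_int_if_integer_matrix_nat[OF k0(1), of "v \<circ> h" z "\<lambda>i j. A (h i) (h j)"])
    show "(v \<circ> h) k0 \<noteq> 0" using k0 assms(3) by simp
    fix i assume i: "i < card I"
    then have "h i \<in> I" using h unfolding bij_betw_def by auto
    then have "z * v (h i) = (\<Sum>j\<in>I. of_int (A (h i) j) * v j)" by (rule eq)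
    also have "\<dots> = (\<Sum>j<card I. of_int (A (h i) (h j)) * v (h j))"
      using sum.reindex_bij_betw[OF h, symmetric] by (simp add: lessThan_atLeast0)
    finally show "z * (v \<circ> h) i = (\<Sum>j<card I. of_int (A (h i) (h j)) * (v \<circ> h) j)" by simp
  qed
qed

text \<open>The matrix of multiplication by x on the powers below the degree is a companion matrix:
  shifts, and a last row given by the monic equation of x.\<close>

lemma algebraic_int_power_reduction:
  fixes x :: complex
  assumes "algebraic_int x"
  obtains m :: nat and X :: "nat \<Rightarrow> nat \<Rightarrow> int"
  where "m > 0" "\<And>i. i < m \<Longrightarrow> x * x ^ i = (\<Sum>j<m. of_int (X i j) * x ^ j)"
proof -
  obtain p :: "int poly" where p: "lead_coeff p = 1" "poly (map_poly of_int p) x = 0"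
    using assms unfolding algebraic_int_altdef_ipoly by auto
  define m where "m = degree p"
  have "m \<noteq> 0"
  proof
    assume "m = 0"
    then obtain a where a: "p = [:a:]" using degree_eq_zeroE[of p] unfolding m_def by blast
    then have "a = 1" using p(1) by simp
    then show False using p(2) a by simp
  qed
  have "(\<Sum>j\<le>m. of_int (coeff p j) * x ^ j) = 0"
    using p(2) unfolding poly_altdef m_def by simp
  then have "(\<Sum>j<Suc m. of_int (coeff p j) * x ^ j) = 0" by (simp only: lessThan_Suc_atMost)
  then have "(\<Sum>j<m. of_int (coeff p j) * x ^ j) + x ^ m = 0" using p(1) by (simp add: m_def)
  then have red: "x ^ m = - (\<Sum>j<m. of_int (coeff p j) * x ^ j)" by (simp only: add_eq_0_iff)
  define X where "X = (\<lambda>i j. if Suc i < m then (if j = Suc i then 1 else 0) else - coeff p j)"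
  have "x * x ^ i = (\<Sum>j<m. of_int (X i j) * x ^ j)" if "i < m" for i
  proof (cases "Suc i < m")
    case True
    have "(\<Sum>j<m. of_int (X i j) * x ^ j) = (\<Sum>j<m. if j = Suc i then x ^ j else 0)"
      using True by (intro sum.cong) (auto simp: X_def)
    then show ?thesis using True by simp
  next
    case False
    then have "Suc i = m" using that by simp
    then have "x * x ^ i = x ^ m" by (metis power_Suc)
    then show ?thesis using False unfolding red by (simp add: X_def sum_negf)
  qed
  then show ?thesis using that \<open>m \<noteq> 0\<close> by blast
qed

text \<open>On the products x^i y^j, multiplication by x y acts through the Kronecker product of the
  matrices of x and y, and multiplication by x + y through the Kronecker sum.\<close>

lemma
  fixes x y :: complex
  assumes "algebraic_int x" "algebraic_int y"
  shows algebraic_int_add: "algebraic_int (x + y)" and algebraic_int_mult: "algebraic_int (x * y)"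
proof -
  obtain m X where m: "m > 0" and X: "\<And>i. i < m \<Longrightarrow> x * x ^ i = (\<Sum>j<m. of_int (X i j) * x ^ j)"
    using algebraic_int_power_reduction[OF assms(1)] by blast
  obtain n Y where n: "n > 0" and Y: "\<And>i. i < n \<Longrightarrow> y * y ^ i = (\<Sum>j<n. of_int (Y i j) * y ^ j)"
    using algebraic_int_power_reduction[OF assms(2)] by blast
  define I where "I = {..<m} \<times> {..<n}"
  define v where "v = (\<lambda>(i, j). x ^ i * y ^ j)"
  have I: "finite I" "(0, 0) \<in> I" "v (0, 0) \<noteq> 0" using m n by (simp_all add: I_def v_def)
  have delta: "(\<Sum>k<m. of_int (if k = i then 1 else 0) * x ^ k) = x ^ i" if "i < m" for i
  proof -
    have "(\<Sum>k<m. of_int (if k = i then 1 else 0) * x ^ k) = (\<Sum>k<m. if k = i then x ^ k else 0)"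
      by (intro sum.cong) auto
    then show ?thesis using that by simp
  qed
  have delta': "(\<Sum>k<n. of_int (if k = i then 1 else 0) * y ^ k) = y ^ i" if "i < n" for i
  proof -
    have "(\<Sum>k<n. of_int (if k = i then 1 else 0) * y ^ k) = (\<Sum>k<n. if k = i then y ^ k else 0)"
      by (intro sum.cong) auto
    then show ?thesis using that by simp
  qed
  have prod: "(\<Sum>k\<in>I. of_int (f (fst k) * g (snd k)) * v k) = (\<Sum>i<m. of_int (f i) * x ^ i) * (\<Sum>j<n. of_int (g j) * y ^ j)"
    for f g :: "nat \<Rightarrow> int"
    unfolding sum_product sum.cartesian_product I_def v_def
    by (intro sum.cong) (auto simp: algebra_simps)
  show "algebraic_int (x * y)"
  proof (rule algebraic_int_if_integer_matrix[of I "(0, 0)" v _ "\<lambda>k l. X (fst k) (fst l) * Y (snd k) (snd l)", OF I])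
    fix k assume "k \<in> I"
    then obtain i j where k: "k = (i, j)" "i < m" "j < n" by (auto simp: I_def)
    have "x * y * v k = (x * x ^ i) * (y * y ^ j)" by (simp add: k v_def)
    then show "x * y * v k = (\<Sum>l\<in>I. of_int (X (fst k) (fst l) * Y (snd k) (snd l)) * v l)"
      unfolding prod k fst_conv snd_conv X[OF k(2)] Y[OF k(3)] .
  qed
  show "algebraic_int (x + y)"
  proof (rule algebraic_int_if_integer_matrix[of I "(0, 0)" v _ "\<lambda>k l. X (fst k) (fst l) * (if snd l = snd k then 1 else 0) +
          (if fst l = fst k then 1 else 0) * Y (snd k) (snd l)", OF I])
    fix k assume "k \<in> I"
    then obtain i j where k: "k = (i, j)" "i < m" "j < n" by (auto simp: I_def)
    have "(x + y) * v k = (x * x ^ i) * y ^ j + x ^ i * (y * y ^ j)" by (simp add: k v_def algebra_simps)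
    also have "\<dots> = (\<Sum>l\<in>I. of_int (X (fst k) (fst l) * (if snd l = snd k then 1 else 0)) * v l)
        + (\<Sum>l\<in>I. of_int ((if fst l = fst k then 1 else 0) * Y (snd k) (snd l)) * v l)"
      using prod[of "X i" "\<lambda>s. if s = j then 1 else 0"] prod[of "\<lambda>s. if s = i then 1 else 0" "Y j"]
      unfolding k fst_conv snd_conv delta[OF k(2)] delta'[OF k(3)] X[OF k(2)] Y[OF k(3)] by (rule arg_cong2[OF sym sym])
    finally show "(x + y) * v k = (\<Sum>l\<in>I. of_int (X (fst k) (fst l) * (if snd l = snd k then 1 else 0) +
          (if fst l = fst k then 1 else 0) * Y (snd k) (snd l)) * v l)"
      by (simp only: of_int_add distrib_right sum.distrib)
  qed
qed

lemma algebraic_int_diff: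
  fixes x y :: complex
  assumes "algebraic_int x" "algebraic_int y"
  shows "algebraic_int (x - y)"
  using algebraic_int_add[OF assms(1) algebraic_int_minus[OF assms(2)]] by simp

lemma algebraic_int_of_int': "algebraic_int (of_int k :: complex)"
  by (rule int_imp_algebraic_int) simp

text \<open>\<sigma> fixes the integers, so it sends a root of an integer polynomial to a root of
  the same polynomial. Additivity and multiplicativity are assumed on F alone, which is why
  membership in F accompanies every step.\<close>

lemma algebraic_int_hom:
  fixes \<sigma> :: "complex \<Rightarrow> complex"
  assumes "algebraic_int x" "x \<in> F" and one: "\<sigma> 1 = 1" "1 \<in> F"
    and add: "\<And>x y. x \<in> F \<Longrightarrow> y \<in> F \<Longrightarrow> x + y \<in> F \<and> \<sigma> (x + y) = \<sigma> x + \<sigma> y"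
    and mult: "\<And>x y. x \<in> F \<Longrightarrow> y \<in> F \<Longrightarrow> x * y \<in> F \<and> \<sigma> (x * y) = \<sigma> x * \<sigma> y"
    and neg: "- 1 \<in> F"
  shows "algebraic_int (\<sigma> x)"
proof -
  have zero: "0 \<in> F" "\<sigma> 0 = 0"
  proof -
    show "0 \<in> F" using conjunct1[OF add[OF neg one(2)]] by simp
    then show "\<sigma> 0 = 0" using add[of 0 0] by simp
  qed
  have nat: "of_nat k \<in> F \<and> \<sigma> (of_nat k) = of_nat k" for k
  proof (induction k)
    case (Suc k)
    then show ?case using add[of 1 "of_nat k"] one by simp
  qed (simp add: zero)
  have m1: "\<sigma> (- 1) = - 1"
  proof -
    have "\<sigma> (- 1 + 1) = \<sigma> (- 1) + \<sigma> 1" using add[OF neg one(2)] by blast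
    then have "\<sigma> (- 1) + 1 = 0" unfolding add.left_inverse zero(2) one(1) by (rule sym)
    then show ?thesis by (simp only: eq_neg_iff_add_eq_0)
  qed
  have int: "of_int k \<in> F \<and> \<sigma> (of_int k) = of_int k" for k :: int
  proof (cases k)
    case (nonneg n) then show ?thesis using nat by simp
  next
    case (neg n)
    then have k: "(of_int k :: complex) = (- 1) * of_nat (Suc n)" by simp
    have n: "(of_nat (Suc n) :: complex) \<in> F" "\<sigma> (of_nat (Suc n)) = of_nat (Suc n)" using nat by blast+
    show ?thesis unfolding k using mult[OF \<open>- 1 \<in> F\<close> n(1)] unfolding n(2) m1 .
  qed
  have pow: "x ^ i \<in> F \<and> \<sigma> (x ^ i) = \<sigma> x ^ i" for i
  proof (induction i)
    case (Suc i)
    then show ?case using mult[of x "x ^ i"] assms(2) by simp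
  qed (simp add: one)
  have hsum: "(\<Sum>i\<in>I. f i) \<in> F \<and> \<sigma> (\<Sum>i\<in>I. f i) = (\<Sum>i\<in>I. \<sigma> (f i))" if "finite I" "\<And>i. i \<in> I \<Longrightarrow> f i \<in> F" for I and f :: "nat \<Rightarrow> complex"
    using that
  proof (induction I rule: finite_induct)
    case (insert i I)
    then show ?case using add[of "f i" "\<Sum>i\<in>I. f i"] by simp
  qed (simp add: zero)
  obtain p :: "int poly" where p: "lead_coeff p = 1" "poly (map_poly of_int p) x = 0"
    using assms unfolding algebraic_int_altdef_ipoly by auto
  have "0 = \<sigma> (\<Sum>i\<le>degree p. of_int (coeff p i) * x ^ i)"
    using p(2) zero(2) unfolding poly_altdef by simp
  also have "\<dots> = (\<Sum>i\<le>degree p. \<sigma> (of_int (coeff p i) * x ^ i))"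
  proof (rule conjunct2[OF hsum])
    fix i show "of_int (coeff p i) * x ^ i \<in> F" using conjunct1[OF mult[OF conjunct1[OF int] conjunct1[OF pow]]] .
  qed simp
  also have "\<dots> = (\<Sum>i\<le>degree p. of_int (coeff p i) * \<sigma> x ^ i)"
  proof (rule sum.cong[OF refl])
    fix i show "\<sigma> (of_int (coeff p i) * x ^ i) = of_int (coeff p i) * \<sigma> x ^ i"
      using conjunct2[OF mult[OF conjunct1[OF int] conjunct1[OF pow]], of "coeff p i" i]
      unfolding conjunct2[OF int] conjunct2[OF pow] .
  qed
  finally have "poly (map_poly of_int p) (\<sigma> x) = 0" unfolding poly_altdef by simp
  then show ?thesis unfolding algebraic_int_altdef_ipoly using p(1) by blast
qed

section \<open>Quadratic extensions and their embeddings\<close>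

text \<open>Because \<open>inverse 0 = 0\<close>, closure under inverses can be demanded for all
  elements.\<close>

definition complex_subfield :: "complex set \<Rightarrow> bool" where
  "complex_subfield F \<longleftrightarrow> 1 \<in> F \<and> (\<forall>x\<in>F. \<forall>y\<in>F. x - y \<in> F \<and> x * y \<in> F) \<and> (\<forall>x\<in>F. inverse x \<in> F)"

lemma complex_subfieldD:
  assumes "complex_subfield F"
  shows "1 \<in> F" "0 \<in> F" "x \<in> F \<Longrightarrow> y \<in> F \<Longrightarrow> x - y \<in> F" "x \<in> F \<Longrightarrow> y \<in> F \<Longrightarrow> x + y \<in> F"
    "x \<in> F \<Longrightarrow> y \<in> F \<Longrightarrow> x * y \<in> F" "x \<in> F \<Longrightarrow> - x \<in> F" "x \<in> F \<Longrightarrow> inverse x \<in> F"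
    "x \<in> F \<Longrightarrow> y \<in> F \<Longrightarrow> x / y \<in> F" "of_int k \<in> F" "of_nat m \<in> F" "numeral w \<in> F"
proof -
  show one: "1 \<in> F" and diff: "x \<in> F \<Longrightarrow> y \<in> F \<Longrightarrow> x - y \<in> F" for x y
    using assms unfolding complex_subfield_def by blast+
  then show zero: "0 \<in> F" using diff[OF one one] by simp
  show neg: "x \<in> F \<Longrightarrow> - x \<in> F" for x using diff[OF zero, of x] by simp
  show add: "x \<in> F \<Longrightarrow> y \<in> F \<Longrightarrow> x + y \<in> F" for x y using diff[OF _ neg, of x y] by simp
  show mult: "x \<in> F \<Longrightarrow> y \<in> F \<Longrightarrow> x * y \<in> F" and inv: "x \<in> F \<Longrightarrow> inverse x \<in> F" for x y
    using assms unfolding complex_subfield_def by blast+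
  show "x \<in> F \<Longrightarrow> y \<in> F \<Longrightarrow> x / y \<in> F" using mult[OF _ inv] by (simp add: divide_inverse)
  have nat: "of_nat m \<in> F" for m by (induction m) (use zero one add in auto)
  then show "of_nat m \<in> F" .
  show "numeral w \<in> F" using nat[of "numeral w"] by simp
  show "of_int k \<in> F" using nat neg by (cases k) (auto simp del: of_nat_Suc)
qed

lemma complex_subfield_Rats: "complex_subfield \<rat>"
  by (simp add: complex_subfield_def)

lemma Rats_subset_complex_subfield:
  assumes "complex_subfield F"
  shows "\<rat> \<subseteq> F"
proof
  fix x :: complex assume "x \<in> \<rat>"
  then obtain a b :: int where "x = of_int a / of_int b" by (elim Rats_cases') 
  then show "x \<in> F" using complex_subfieldD(8,9)[OF assms] by simp
qed

lemma complex_ring_inverses: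
  "a_inv complex_ring x = - x" "x \<noteq> 0 \<Longrightarrow> m_inv complex_ring x = inverse x"
proof -
  show "a_inv complex_ring x = - x"
    unfolding a_inv_def m_inv_def
  proof (rule the_equality)
    fix y assume "y \<in> carrier (add_monoid complex_ring) \<and> x \<otimes>\<^bsub>add_monoid complex_ring\<^esub> y = \<one>\<^bsub>add_monoid complex_ring\<^esub> \<and>
        y \<otimes>\<^bsub>add_monoid complex_ring\<^esub> x = \<one>\<^bsub>add_monoid complex_ring\<^esub>"
    then have "x + y = 0" by (simp add: complex_ring_def)
    then show "y = - x" by (rule minus_unique[symmetric])
  qed (simp add: complex_ring_def)
  assume x: "x \<noteq> 0"
  show "m_inv complex_ring x = inverse x"
    unfolding m_inv_def
  proof (rule the_equality)
    fix y assume "y \<in> carrier complex_ring \<and> x \<otimes>\<^bsub>complex_ring\<^esub> y = \<one>\<^bsub>complex_ring\<^esub> \<and> y \<otimes>\<^bsub>complex_ring\<^esub> x = \<one>\<^bsub>complex_ring\<^esub>"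
    then have "x * y = 1" by (simp add: complex_ring_def)
    then show "y = inverse x" by (rule inverse_unique[symmetric])
  qed (simp add: complex_ring_def x)
qed

lemma complex_ring_simps [simp]:
  "carrier complex_ring = UNIV" "x \<otimes>\<^bsub>complex_ring\<^esub> y = x * y" "x \<oplus>\<^bsub>complex_ring\<^esub> y = x + y"
  "\<one>\<^bsub>complex_ring\<^esub> = 1" "\<zero>\<^bsub>complex_ring\<^esub> = 0"
  by (simp_all add: complex_ring_def)

lemma complex_subfield_adjoin: "complex_subfield (adjoin S)" and subset_adjoin: "S \<subseteq> adjoin S"
proof -
  show "S \<subseteq> adjoin S" unfolding adjoin_def by (auto intro: generate_field.incl)
  have one: "1 \<in> adjoin S" unfolding adjoin_def using generate_field.one[of complex_ring S] by simp
  have add: "x + y \<in> adjoin S" and mult: "x * y \<in> adjoin S" if "x \<in> adjoin S" "y \<in> adjoin S" for x y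
    using that unfolding adjoin_def
    using generate_field.eng_add[of x complex_ring S y] generate_field.eng_mult[of x complex_ring S y] by simp_all
  have neg: "- x \<in> adjoin S" if "x \<in> adjoin S" for x
    using that unfolding adjoin_def using generate_field.a_inv[of x complex_ring S] by (simp add: complex_ring_inverses)
  have zero: "0 \<in> adjoin S" using add[OF one neg[OF one]] by simp
  have inv: "inverse x \<in> adjoin S" if "x \<in> adjoin S" for x
    using that zero unfolding adjoin_def using generate_field.m_inv[of x complex_ring S]
    by (cases "x = 0") (simp_all add: complex_ring_inverses)
  show "complex_subfield (adjoin S)"
    unfolding complex_subfield_def using one add neg mult inv by (metis add_uminus_conv_diff)
qed

lemma adjoin_least:
  assumes "complex_subfield F" "S \<subseteq> F"
  shows "adjoin S \<subseteq> F"
proof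
  fix x assume "x \<in> adjoin S"
  then have "x \<in> generate_field complex_ring S" by (simp add: adjoin_def)
  then show "x \<in> F"
  proof induction
    case (m_inv h)
    then show ?case using complex_subfieldD[OF assms(1)] by (simp add: complex_ring_inverses)
  qed (use assms(2) complex_subfieldD[OF assms(1)] in \<open>auto simp: complex_ring_inverses\<close>)
qed

section \<open>Conjugation in a quadratic extension\<close>

definition quadratic_ext :: "complex set \<Rightarrow> complex \<Rightarrow> complex set" where
  "quadratic_ext F s = {a + b * s | a b. a \<in> F \<and> b \<in> F}"

lemma quadratic_extI: "a \<in> F \<Longrightarrow> b \<in> F \<Longrightarrow> a + b * s \<in> quadratic_ext F s"
  unfolding quadratic_ext_def by blast

lemma quadratic_extI': "x = a + b * s \<Longrightarrow> a \<in> F \<Longrightarrow> b \<in> F \<Longrightarrow> x \<in> quadratic_ext F s"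
  unfolding quadratic_ext_def by blast

lemma quadratic_ext_subset:
  assumes "complex_subfield G" "F \<subseteq> G" "s \<in> G"
  shows "quadratic_ext F s \<subseteq> G"
proof
  fix x assume "x \<in> quadratic_ext F s"
  then obtain a b where x: "x = a + b * s" "a \<in> F" "b \<in> F" unfolding quadratic_ext_def by blast
  have "b * s \<in> G" using x assms by (intro complex_subfieldD(5)[OF assms(1)]) auto
  then show "x \<in> G" using x assms by (auto intro: complex_subfieldD(4)[OF assms(1)])
qed

lemma quadratic_ext_mult: "(a + b * s) * (c + d * s) = (a * c + b * d * (s * s)) + (a * d + b * c) * (s::complex)"
  by (simp add: algebra_simps)

lemma complex_subfield_quadratic_ext:
  assumes "complex_subfield F" "s * s \<in> F"
  shows "complex_subfield (quadratic_ext F s)" "F \<subseteq> quadratic_ext F s" "s \<in> quadratic_ext F s"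
proof -
  note F = complex_subfieldD[OF assms(1)]
  show sub: "F \<subseteq> quadratic_ext F s"
  proof
    fix x assume "x \<in> F" then show "x \<in> quadratic_ext F s" using quadratic_extI[of x F 0 s] F by simp
  qed
  show "s \<in> quadratic_ext F s" using quadratic_extI[of 0 F 1 s] F by simp
  show "complex_subfield (quadratic_ext F s)"
    unfolding complex_subfield_def
  proof (intro conjI ballI)
    show "1 \<in> quadratic_ext F s" using sub F by blast
  next
    fix x y assume "x \<in> quadratic_ext F s" "y \<in> quadratic_ext F s"
    then obtain a b c d where xy: "x = a + b * s" "y = c + d * s" "a \<in> F" "b \<in> F" "c \<in> F" "d \<in> F"
      unfolding quadratic_ext_def by blast
    have "x - y = (a - c) + (b - d) * s" by (simp add: xy algebra_simps)
    then show "x - y \<in> quadratic_ext F s" by (rule quadratic_extI') (use xy F(3) in auto)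
    show "x * y \<in> quadratic_ext F s"
      unfolding xy(1,2) quadratic_ext_mult using xy F assms(2) by (intro quadratic_extI) auto
  next
    fix x assume "x \<in> quadratic_ext F s"
    then obtain a b where x: "x = a + b * s" "a \<in> F" "b \<in> F" unfolding quadratic_ext_def by blast
    show "inverse x \<in> quadratic_ext F s"
    proof (cases "s \<in> F")
      case True
      then show ?thesis using x F sub by auto
    next
      case False
      have nz: "a * a - b * b * (s * s) \<noteq> 0" if "x \<noteq> 0"
      proof
        assume *: "a * a - b * b * (s * s) = 0"
        then have "(a + b * s) * (a - b * s) = 0" by (simp add: algebra_simps)
        then have ab: "a = b * s" using that x by simp
        show False
        proof (cases "b = 0")
          case True then show ?thesis using ab that x by simp
        next
          case b: False
          then have "s = a / b" using ab by simp
          then show ?thesis using False x F by simp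
        qed
      qed
      show ?thesis
      proof (cases "x = 0")
        case True then show ?thesis using sub F by auto
      next
        case x0: False
        have "(a + b * s) * (a - b * s) = a * a - b * b * (s * s)" by (simp add: algebra_simps)
        then have "inverse x = (a - b * s) / (a * a - b * b * (s * s))"
          using nz[OF x0] x0 x(1) by (simp add: field_simps)
        also have "\<dots> = a / (a * a - b * b * (s * s)) + (- b / (a * a - b * b * (s * s))) * s"
          by (simp add: diff_divide_distrib)
        finally show ?thesis by (rule quadratic_extI') (use x F(3,5,6,8) assms(2) in simp_all)
      qed
    qed
  qed
qed

lemma adjoin_single:
  assumes "s * s \<in> \<rat>"
  shows "adjoin {s} = quadratic_ext \<rat> s"
proof
  show "adjoin {s} \<subseteq> quadratic_ext \<rat> s"
    using complex_subfield_quadratic_ext[OF complex_subfield_Rats assms] by (intro adjoin_least) auto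
  show "quadratic_ext \<rat> s \<subseteq> adjoin {s}"
    using subset_adjoin[of "{s}"] by (intro quadratic_ext_subset complex_subfield_adjoin Rats_subset_complex_subfield) auto
qed

lemma adjoin_pair:
  assumes "s * s \<in> \<rat>" "t * t \<in> \<rat>"
  shows "adjoin {s, t} = quadratic_ext (quadratic_ext \<rat> s) t"
proof
  note 1 = complex_subfield_quadratic_ext[OF complex_subfield_Rats assms(1)]
  have tt: "t * t \<in> quadratic_ext \<rat> s" using 1 assms by blast
  note 2 = complex_subfield_quadratic_ext[OF 1(1) tt]
  show "adjoin {s, t} \<subseteq> quadratic_ext (quadratic_ext \<rat> s) t"
    using 1 2 by (intro adjoin_least) auto
  show "quadratic_ext (quadratic_ext \<rat> s) t \<subseteq> adjoin {s, t}"
    using subset_adjoin[of "{s, t}"]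
    by (intro quadratic_ext_subset complex_subfield_adjoin Rats_subset_complex_subfield) auto
qed

definition ext_conj :: "complex set \<Rightarrow> complex \<Rightarrow> complex \<Rightarrow> complex" where
  "ext_conj F s x = (THE y. \<exists>a\<in>F. \<exists>b\<in>F. x = a + b * s \<and> y = a - b * s)"

locale quadratic_extension =
  fixes F :: "complex set" and s :: complex
  assumes subfield: "complex_subfield F" and sqr: "s * s \<in> F" and irrational: "s \<notin> F"
begin

lemmas F = complex_subfieldD[OF subfield]

abbreviation "E \<equiv> quadratic_ext F s"

lemma subfield_E: "complex_subfield E" and F_subset: "F \<subseteq> E" and s_in: "s \<in> E"
  using complex_subfield_quadratic_ext[OF subfield sqr] by blast+

lemma coords_unique:
  assumes "a \<in> F" "b \<in> F" "c \<in> F" "d \<in> F" "a + b * s = c + d * s"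
  shows "a = c" "b = d"
proof -
  show bd: "b = d"
  proof (rule ccontr)
    assume "b \<noteq> d"
    then have "s = (c - a) / (b - d)" using assms(5) by (simp add: field_simps)
    then show False using irrational F(8)[OF F(3)[OF assms(3,1)] F(3)[OF assms(2,4)]] by simp
  qed
  then show "a = c" using assms by simp
qed

lemma ext_conj_eq:
  assumes "a \<in> F" "b \<in> F"
  shows "ext_conj F s (a + b * s) = a - b * s"
  unfolding ext_conj_def
proof (rule the_equality)
  show "\<exists>a'\<in>F. \<exists>b'\<in>F. a + b * s = a' + b' * s \<and> a - b * s = a' - b' * s" using assms by blast
  fix y assume "\<exists>a'\<in>F. \<exists>b'\<in>F. a + b * s = a' + b' * s \<and> y = a' - b' * s"
  then obtain a' b' where "a' \<in> F" "b' \<in> F" "a + b * s = a' + b' * s" "y = a' - b' * s" by blast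
  then show "y = a - b * s" using coords_unique[OF assms, of a' b'] by simp
qed

lemma ext_conj_fixed: "a \<in> F \<Longrightarrow> ext_conj F s a = a"
  using ext_conj_eq[of a 0] F(2) by simp

lemma ext_conj_s: "ext_conj F s s = - s"
  using ext_conj_eq[of 0 1] F(1,2) by simp

lemma E_cases:
  assumes "x \<in> E"
  obtains a b where "a \<in> F" "b \<in> F" "x = a + b * s"
  using assms unfolding quadratic_ext_def by blast

lemma ext_conj_hom:
  assumes "x \<in> E" "y \<in> E"
  shows "ext_conj F s (x + y) = ext_conj F s x + ext_conj F s y"
    and "ext_conj F s (x * y) = ext_conj F s x * ext_conj F s y"
    and "ext_conj F s x \<in> E"
proof -
  obtain a b c d where xy: "a \<in> F" "b \<in> F" "x = a + b * s" "c \<in> F" "d \<in> F" "y = c + d * s"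
    using assms by (elim E_cases)
  have sum: "x + y = (a + c) + (b + d) * s" by (simp add: xy algebra_simps)
  have "ext_conj F s (x + y) = (a + c) - (b + d) * s"
    unfolding sum by (rule ext_conj_eq) (use xy F(4) in simp_all)
  then show "ext_conj F s (x + y) = ext_conj F s x + ext_conj F s y"
    by (simp add: xy(3,6) ext_conj_eq xy(1,2,4,5) algebra_simps)
  show "ext_conj F s (x * y) = ext_conj F s x * ext_conj F s y"
    unfolding xy(3,6) quadratic_ext_mult using xy F(3-6) sqr by (simp add: ext_conj_eq) (simp add: algebra_simps)
  have "a - b * s = a + (- b) * s" by simp
  then show "ext_conj F s x \<in> E" unfolding xy(3) ext_conj_eq[OF xy(1,2)] using xy(1,2) F(6) by (intro quadratic_extI'[of _ a "- b"]) auto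
qed

lemma algebraic_int_ext_conj:
  assumes "algebraic_int x" "x \<in> E"
  shows "algebraic_int (ext_conj F s x)"
  using assms
proof (rule algebraic_int_hom[where F = E])
  note EF = complex_subfieldD[OF subfield_E]
  show "ext_conj F s 1 = 1" using ext_conj_fixed F(1) by simp
  show "1 \<in> E" "- 1 \<in> E" using EF(1) EF(6)[OF EF(1)] by blast+
  show "x + y \<in> E \<and> ext_conj F s (x + y) = ext_conj F s x + ext_conj F s y" if "x \<in> E" "y \<in> E" for x y
    using that EF(4) ext_conj_hom(1) by blast
  show "x * y \<in> E \<and> ext_conj F s (x * y) = ext_conj F s x * ext_conj F s y" if "x \<in> E" "y \<in> E" for x y
    using that EF(5) ext_conj_hom(2) by blast
qed

text \<open>The square of s is fixed, so s can only go to s or - s, and its image determines the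
  embedding. \<open>restrict\<close> matches the convention that embeddings are extensional.\<close>

lemma embeddings_eq: "embeddings F E = {restrict (\<lambda>x. x) E, restrict (ext_conj F s) E}"
proof (intro equalityI subsetI)
  note EF = complex_subfieldD[OF subfield_E]
  fix \<sigma> assume "\<sigma> \<in> embeddings F E"
  then have \<sigma>: "\<sigma> \<in> extensional E" "\<And>x. x \<in> F \<Longrightarrow> \<sigma> x = x"
    "\<And>x y. x \<in> E \<Longrightarrow> y \<in> E \<Longrightarrow> \<sigma> (x * y) = \<sigma> x * \<sigma> y" "\<And>x y. x \<in> E \<Longrightarrow> y \<in> E \<Longrightarrow> \<sigma> (x + y) = \<sigma> x + \<sigma> y"
    unfolding embeddings_def Ring.ring_hom_def by (auto simp: complex_ring_def)
  have "\<sigma> s * \<sigma> s = s * s" using \<sigma>(3)[OF s_in s_in] \<sigma>(2)[OF sqr] by simp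
  then have "\<sigma> s = s \<or> \<sigma> s = - s" by (metis square_eq_iff)
  moreover have val: "\<sigma> (a + b * s) = a + b * \<sigma> s" if "a \<in> F" "b \<in> F" for a b
  proof -
    have *: "a \<in> E" "b \<in> E" "b * s \<in> E" using that F_subset s_in EF(5)[of b s] by auto
    then show ?thesis using that \<sigma>(2,3,4) s_in by simp
  qed
  moreover have "\<sigma> = restrict (\<lambda>x. x) E" if "\<sigma> s = s"
    using \<sigma>(1) val that by (intro extensionalityI[of _ E]) (auto elim!: E_cases)
  moreover have "\<sigma> = restrict (ext_conj F s) E" if "\<sigma> s = - s"
    using \<sigma>(1) val that by (intro extensionalityI[of _ E]) (auto elim!: E_cases simp: ext_conj_eq)
  ultimately show "\<sigma> \<in> {restrict (\<lambda>x. x) E, restrict (ext_conj F s) E}" by blast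
next
  note EF = complex_subfieldD[OF subfield_E]
  fix \<sigma> assume "\<sigma> \<in> {restrict (\<lambda>x. x) E, restrict (ext_conj F s) E}"
  then show "\<sigma> \<in> embeddings F E"
    using EF(1,4,5) ext_conj_hom(1,2) F_subset ext_conj_fixed F(1)
    by (auto simp: embeddings_def Ring.ring_hom_def complex_ring_def)
qed

lemma rel_norm_eq: "x \<in> E \<Longrightarrow> rel_norm F E x = x * ext_conj F s x"
  and rel_trace_eq: "x \<in> E \<Longrightarrow> rel_trace F E x = x + ext_conj F s x"
proof -
  have "s \<noteq> 0" using irrational F(2) by auto
  have ne: "restrict (\<lambda>x. x) E \<noteq> restrict (ext_conj F s) E"
  proof
    assume "restrict (\<lambda>x. x) E = restrict (ext_conj F s) E"
    then have "restrict (\<lambda>x. x) E s = restrict (ext_conj F s) E s" by (rule fun_cong)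
    then show False using s_in ext_conj_s \<open>s \<noteq> 0\<close> by simp
  qed
  show "rel_norm F E x = x * ext_conj F s x" if "x \<in> E"
    unfolding rel_norm_def embeddings_eq using ne that by simp
  show "rel_trace F E x = x + ext_conj F s x" if "x \<in> E"
    unfolding rel_trace_def embeddings_eq using ne that by simp
qed

end

section \<open>Fundamental discriminants\<close>

text \<open>The order of discriminant D is maximal: D is a discriminant, but no quotient of D by a
  square exceeding 1 is. This arithmetic form, which admits D = 1, is the one that passes to coprime
  products.\<close>

definition fundamental :: "int \<Rightarrow> bool" where
  "fundamental D \<longleftrightarrow> D mod 4 \<in> {0, 1} \<and> (\<forall>m q. m > 1 \<longrightarrow> D = m\<^sup>2 * q \<longrightarrow> q mod 4 \<notin> {0, 1})"

lemma fundamentalD: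
  assumes "fundamental D"
  shows "D mod 4 = 0 \<or> D mod 4 = 1" "m > 1 \<Longrightarrow> D = m\<^sup>2 * q \<Longrightarrow> q mod 4 \<noteq> 0 \<and> q mod 4 \<noteq> 1"
  using assms unfolding fundamental_def by simp_all

lemma odd_square_mult_mod_4:
  fixes m q :: int
  assumes "odd m"
  shows "m\<^sup>2 * q mod 4 = q mod 4"
proof -
  have "m\<^sup>2 mod 4 = 1" using square_mod_4[of m] assms by simp
  then have "m\<^sup>2 * q mod 4 = 1 * q mod 4" by (metis mod_mult_left_eq)
  then show ?thesis by simp
qed

lemma fundamental_not_square:
  assumes "fundamental D" "D > 1"
  shows "D \<noteq> k\<^sup>2"
proof
  assume D: "D = k\<^sup>2"
  have "\<bar>k\<bar> > 1"
  proof (rule ccontr)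
    assume "\<not> \<bar>k\<bar> > 1"
    then have "k = 0 \<or> k = 1 \<or> k = -1" by auto
    then show False using assms(2) D by auto
  qed
  moreover have "D = \<bar>k\<bar>\<^sup>2 * 1" using D by simp
  ultimately show False using fundamentalD(2)[OF assms(1), of "\<bar>k\<bar>" 1] by simp
qed

text \<open>A square m^2 dividing D1 D2 splits as X^2 Y^2 with D1 = X^2 a and D2 = Y^2 b. If |X| >
  1, then a is not 0 or 1 modulo 4, which forces X to be even; hence D2 and Y are odd, b = 1 modulo
  4, and q = a b is congruent to a.\<close>

lemma fundamental_mult:
  assumes "fundamental D1" "fundamental D2" "coprime D1 D2"
  shows "fundamental (D1 * D2)"
proof -
  have aux: "q mod 4 \<notin> {0, 1}" if fund: "fundamental D1" "fundamental D2" "coprime D1 D2"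
    and eq: "D1 = X\<^sup>2 * a" "D2 = Y\<^sup>2 * b" "q = a * b" and X: "\<bar>X\<bar> > 1" for D1 D2 X Y a b q :: int
  proof -
    have a: "a mod 4 \<noteq> 0 \<and> a mod 4 \<noteq> 1" using fundamentalD(2)[OF fund(1) X, of a] eq(1) by simp
    have "even X"
    proof (rule ccontr)
      assume "odd X"
      then show False using odd_square_mult_mod_4[of X a] a fundamentalD(1)[OF fund(1)] eq(1) by simp
    qed
    then have "even D1" using eq by simp
    then have "odd D2" using fund(3) by (meson coprime_common_divisor odd_one)
    then have D2: "D2 mod 4 = 1" using fundamentalD(1)[OF fund(2)] by auto
    have "odd Y" using \<open>odd D2\<close> eq by auto
    then have "b mod 4 = 1" using odd_square_mult_mod_4[of Y b] D2 eq by simp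
    then have "q mod 4 = a mod 4" unfolding eq by (metis mod_mult_right_eq mult.right_neutral)
    then show ?thesis using a by simp
  qed
  show ?thesis
    unfolding fundamental_def
  proof (intro conjI allI impI)
    have "D1 * D2 mod 4 = (D1 mod 4) * (D2 mod 4) mod 4" by (simp add: mod_mult_eq)
    then show "D1 * D2 mod 4 \<in> {0, 1}" using assms(1,2) unfolding fundamental_def by auto
    fix m q :: int assume m: "m > 1" "D1 * D2 = m\<^sup>2 * q"
    have "m\<^sup>2 dvd D1 * D2" using m by simp
    then obtain x y where xy: "m\<^sup>2 = x * y" "x dvd D1" "y dvd D2" "x > 0" "y > 0"
      using m(1) by (elim positive_division_decomp) auto
    have "coprime x y" using xy assms(3) coprime_divisors by blast
    then obtain s X Y where s: "s = 1 \<or> s = -1" "x = s * X\<^sup>2" "y = s * Y\<^sup>2" "m = X * Y"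
      using coprime_mult_eq_square_int xy(1) by metis
    have "s = 1" using s xy(4) by (auto simp: zero_less_mult_iff)
    then have XY: "x = X\<^sup>2" "y = Y\<^sup>2" using s by simp_all
    obtain a b where ab: "D1 = X\<^sup>2 * a" "D2 = Y\<^sup>2 * b" using xy XY by (auto elim!: dvdE)
    have "D1 * D2 = m\<^sup>2 * (a * b)" unfolding ab s(4) by (simp add: power_mult_distrib algebra_simps)
    then have "m\<^sup>2 * q = m\<^sup>2 * (a * b)" using m(2) by simp
    then have q: "q = a * b" using m(1) by simp
    have "\<bar>X\<bar> > 1 \<or> \<bar>Y\<bar> > 1"
    proof (rule ccontr)
      assume "\<not> ?thesis"
      then have "\<bar>X\<bar> * \<bar>Y\<bar> \<le> 1 * 1" by (intro mult_mono) auto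
      then show False using m(1) s(4) by (simp add: abs_mult[symmetric])
    qed
    then show "q mod 4 \<notin> {0, 1}"
      using aux[OF assms ab q] aux[OF assms(2,1) _ ab(2,1), of q] assms(3) q by (auto simp: coprime_commute mult.commute)
  qed
qed

lemma algebraic_int_sqrt_int:
  fixes s :: complex
  assumes "s * s = of_int D"
  shows "algebraic_int s"
proof -
  have "poly (map_poly of_int [:- D, 0, 1:]) s = 0" using assms by (simp add: map_poly_pCons)
  then show ?thesis unfolding algebraic_int_altdef_ipoly by (intro exI[of _ "[:- D, 0, 1:]"]) simp
qed

lemma sqrt_int_irrational:
  fixes s :: complex
  assumes "s * s = of_int D" "\<And>k. D \<noteq> k\<^sup>2"
  shows "s \<notin> \<rat>"
proof
  assume "s \<in> \<rat>"
  then have "s \<in> \<int>" using rational_algebraic_int_is_int[OF algebraic_int_sqrt_int[OF assms(1)]] by blast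
  then obtain k where "s = of_int k" by (elim Ints_cases)
  then have "(of_int (k\<^sup>2) :: complex) = of_int D" using assms(1) by (simp add: power2_eq_square)
  then have "D = k\<^sup>2" by (simp only: of_int_eq_iff)
  then show False using assms(2) by blast
qed

text \<open>Trace t and norm w are integers. With 2x = t + (i/j) s in lowest terms, j^2 divides D,
  say D = j^2 q, and t^2 - i^2 q = 4w. If j > 1, then q would be 0 or 1 modulo 4: for odd i by this
  equation, for even i because j is then odd and q is congruent to D. Fundamentality excludes
  this.\<close>

lemma quadratic_integer_coords:
  fixes s x :: complex
  assumes "fundamental D" "s * s = of_int D" "s \<notin> \<rat>" "x \<in> quadratic_ext \<rat> s" "algebraic_int x"
  shows "\<exists>a b :: int. x = of_int a + of_int b * ((of_int D + s) / 2)"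
proof -
  interpret quadratic_extension \<rat> s
    by standard (use assms complex_subfield_Rats in auto)
  obtain u v where uv: "u \<in> \<rat>" "v \<in> \<rat>" "x = u + v * s" using E_cases[OF assms(4)] .
  have conj: "algebraic_int (u - v * s)"
    using algebraic_int_ext_conj[OF assms(5,4)] unfolding uv(3) ext_conj_eq[OF uv(1,2)] .
  have "algebraic_int (2 * u)" using algebraic_int_add[OF assms(5) conj] by (simp add: uv(3))
  moreover have "2 * u \<in> \<rat>" using uv by simp
  ultimately have "2 * u \<in> \<int>" by (rule rational_algebraic_int_is_int)
  then obtain t where t: "2 * u = of_int t" by (elim Ints_cases)
  have norm: "(u + v * s) * (u - v * s) = u * u - v * v * of_int D"
    unfolding assms(2)[symmetric] by (simp add: algebra_simps)
  have "algebraic_int (u * u - v * v * of_int D)" using algebraic_int_mult[OF assms(5) conj] unfolding uv(3) norm .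
  moreover have "u * u - v * v * of_int D \<in> \<rat>" using uv by simp
  ultimately have "u * u - v * v * of_int D \<in> \<int>" by (rule rational_algebraic_int_is_int)
  then obtain w where w: "u * u - v * v * of_int D = of_int w" by (elim Ints_cases)
  have "2 * v \<in> \<rat>" using uv by simp
  then obtain i j where ij: "j > 0" "coprime i j" "2 * v = of_int i / of_int j" by (elim Rats_cases')
  have vj: "2 * v * of_int j = of_int i" using ij by simp
  have "(of_int (t\<^sup>2 * j\<^sup>2 - i\<^sup>2 * D) :: complex) = (2 * u) * (2 * u) * of_int j * of_int j - (2 * v * of_int j) * (2 * v * of_int j) * of_int D"
    unfolding t vj by (simp add: power2_eq_square)
  also have "\<dots> = 4 * (u * u - v * v * of_int D) * of_int j * of_int j" by (simp add: algebra_simps)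
  also have "\<dots> = of_int (4 * w * j\<^sup>2)" unfolding w by (simp add: power2_eq_square)
  finally have eq: "t\<^sup>2 * j\<^sup>2 - i\<^sup>2 * D = 4 * w * j\<^sup>2" by (simp only: of_int_eq_iff)
  have "i\<^sup>2 * D = j\<^sup>2 * (t\<^sup>2 - 4 * w)" using eq by (simp add: algebra_simps)
  then have "j\<^sup>2 dvd i\<^sup>2 * D" by simp
  moreover have "coprime (j\<^sup>2) (i\<^sup>2)" using ij(2) by (simp add: coprime_commute)
  ultimately have "j\<^sup>2 dvd D" by (simp add: coprime_dvd_mult_right_iff)
  then obtain q where q: "D = j\<^sup>2 * q" by (elim dvdE)
  have "j\<^sup>2 * (t\<^sup>2 - i\<^sup>2 * q) = j\<^sup>2 * (4 * w)" using eq unfolding q by (simp add: algebra_simps)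
  then have tq: "t\<^sup>2 - i\<^sup>2 * q = 4 * w" using ij(1) by simp
  have j1: "j = 1"
  proof (rule ccontr)
    assume "j \<noteq> 1"
    then have "j > 1" using ij(1) by simp
    from fundamentalD(2)[OF assms(1) this q] have q4: "q mod 4 \<noteq> 0 \<and> q mod 4 \<noteq> 1" .
    show False
    proof (cases "odd i")
      case True
      then have "q mod 4 = i\<^sup>2 * q mod 4" using odd_square_mult_mod_4 by simp
      also have "i\<^sup>2 * q = t\<^sup>2 - 4 * w" using tq by simp
      also have "(t\<^sup>2 - 4 * w) mod 4 = t\<^sup>2 mod 4" by presburger
      finally show False using q4 square_mod_4[of t] by (auto split: if_splits)
    next
      case False
      then have "odd j" using ij(2) by (meson coprime_common_divisor odd_one)
      then show False using odd_square_mult_mod_4[of j q] q4 q fundamentalD(1)[OF assms(1)] by simp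
    qed
  qed
  then have qD: "q = D" and v: "2 * v = of_int i" using q ij(3) by simp_all
  have "even (t - i * D)"
  proof -
    have "even (t\<^sup>2 - i\<^sup>2 * D)" using tq unfolding qD by simp
    then show ?thesis by simp
  qed
  then obtain a where a: "t - i * D = 2 * a" by (elim evenE)
  have "2 * x = of_int t + of_int i * s" unfolding uv(3) t[symmetric] v[symmetric] by (simp add: algebra_simps)
  also have "of_int t = (of_int (2 * a + i * D) :: complex)" using a by (simp add: algebra_simps)
  finally have "x = of_int a + of_int i * ((of_int D + s) / 2)" by (simp add: field_simps)
  then show ?thesis by blast
qed

text \<open>The number is a root of z^2 - D z + (D^2 - D)/4.\<close>

lemma algebraic_int_half_int_plus_sqrt:
  fixes s :: complex
  assumes "D mod 4 \<in> {0, 1}" "s * s = of_int D"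
  shows "algebraic_int ((of_int D + s) / 2)"
proof -
  have "4 dvd D * D - D"
  proof -
    have "D mod 4 = 0 \<or> D mod 4 = 1" using assms(1) by simp
    then obtain k where "D = 4 * k \<or> D = 4 * k + 1" by (metis mod_mult_div_eq mult.commute add.commute add_0)
    then show ?thesis
    proof
      assume "D = 4 * k" then show ?thesis by simp
    next
      assume "D = 4 * k + 1" then show ?thesis by (simp add: algebra_simps)
    qed
  qed
  then obtain c where c: "D * D - D = 4 * c" by (elim dvdE)
  define z where "z = (of_int D + s) / 2"
  have "2 * z = of_int D + s" unfolding z_def by simp
  then have "of_int D - 2 * z = - s" by simp
  then have "(of_int D - 2 * z) * (of_int D - 2 * z) = of_int D" using assms(2) by simp
  moreover have "(of_int (D * D - D) :: complex) = of_int (4 * c)" unfolding c ..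
  ultimately have "4 * (of_int c - of_int D * z + z * z) = 0" by (simp add: algebra_simps)
  then have "of_int c - of_int D * z + z * z = 0" by (simp only: mult_eq_0_iff) simp
  then have "poly (map_poly of_int [:c, - D, 1:]) z = 0" by (simp add: map_poly_pCons algebra_simps)
  then show ?thesis unfolding z_def[symmetric] algebraic_int_altdef_ipoly by (intro exI[of _ "[:c, - D, 1:]"]) simp
qed

lemma integers_ring_carrier [simp]: "carrier (integers_ring K) = {x \<in> K. algebraic_int x}"
  by (simp add: integers_ring_def)

lemma complex_csqrt_square: "csqrt z * csqrt z = z"
  by (metis power2_csqrt power2_eq_square)

text \<open>The discriminant does not depend on the integral basis: v, w and 1, \<omega> express
  each other over the integers, so the transition determinant is 1 or -1, and D is its square times
  the standard value \<open>D0\<close>.\<close>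

lemma pos_fundamental_disc_imp_fundamental:
  assumes "pos_fundamental_disc D"
  shows "fundamental D" "D > 1"
proof -
  obtain K where K: "real_quadratic_field K" "quadratic_field_disc K D"
    using assms unfolding pos_fundamental_disc_def by blast
  obtain m :: int where m: "m > 1" "squarefree m" "K = adjoin {csqrt (of_int m)}"
    using K(1) unfolding real_quadratic_field_def by blast
  define s where "s = csqrt (of_int m)"
  have ss: "s * s = of_int m" by (simp add: s_def complex_csqrt_square)
  have unit: "k\<^sup>2 dvd m \<Longrightarrow> k dvd 1" for k using m(2) unfolding squarefree_def by blast
  have "\<not> 4 dvd m" using unit[of 2] by auto
  define D0 where "D0 = (if m mod 4 = 1 then m else 4 * m)"
  define s0 where "s0 = (if m mod 4 = 1 then s else 2 * s)"
  have s0: "s0 * s0 = of_int D0" using ss by (simp add: s0_def D0_def)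
  have D01: "D0 > 1" using m(1) by (simp add: D0_def)
  have fund: "fundamental D0"
  proof (cases "m mod 4 = 1")
    case True
    then have "D0 = m" by (simp add: D0_def)
    moreover have False if "k > 1" "m = k\<^sup>2 * q" for k q using unit[of k] that by auto
    ultimately show ?thesis unfolding fundamental_def using True by auto
  next
    case False
    then have D0: "D0 = 4 * m" by (simp add: D0_def)
    have m23: "m mod 4 \<notin> {0, 1}" using False \<open>\<not> 4 dvd m\<close> by auto
    have "q mod 4 \<notin> {0, 1}" if k: "k > 1" "4 * m = k\<^sup>2 * q" for k q :: int
    proof (cases "even k")
      case True
      then obtain l where l: "k = 2 * l" by (elim evenE)
      then have ml: "m = l\<^sup>2 * q" using k(2) by (simp add: power_mult_distrib)
      then have "l dvd 1" using unit by simp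
      then have "l = 1" using k(1) l by auto
      then show ?thesis using ml m23 by simp
    next
      case False
      then have "coprime (k\<^sup>2) 4"
      proof -
        have "coprime (k\<^sup>2) (2 ^ 2)" using False unfolding coprime_power_right_iff by simp
        then show ?thesis by simp
      qed
      moreover have "k\<^sup>2 dvd 4 * m" using k(2) by simp
      ultimately have "k\<^sup>2 dvd m" by (simp add: coprime_dvd_mult_right_iff)
      then have "k dvd 1" by (rule unit)
      then show ?thesis using k(1) by auto
    qed
    then show ?thesis unfolding fundamental_def D0 by auto
  qed
  have irr: "s0 \<notin> \<rat>" by (rule sqrt_int_irrational[OF s0]) (rule fundamental_not_square[OF fund D01])
  interpret quadratic_extension \<rat> s0
    by standard (use s0 irr complex_subfield_Rats in auto)
  have KE: "K = E"
  proof -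
    have ssQ: "s * s \<in> \<rat>" unfolding ss by simp
    have K': "K = quadratic_ext \<rat> s" unfolding m(3) s_def[symmetric] by (rule adjoin_single[OF ssQ])
    note S = complex_subfield_quadratic_ext[OF complex_subfield_Rats ssQ]
    show ?thesis
    proof
      have "s \<in> E"
      proof (cases "m mod 4 = 1")
        case True then show ?thesis using s_in by (simp add: s0_def)
      next
        case False
        then have "s = 0 + (1 / 2) * s0" by (simp add: s0_def)
        then show ?thesis by (rule quadratic_extI') simp_all
      qed
      then show "K \<subseteq> E" unfolding K' using subfield_E F_subset by (intro quadratic_ext_subset)
      have "s0 \<in> quadratic_ext \<rat> s"
      proof (cases "m mod 4 = 1")
        case True then show ?thesis using S by (simp add: s0_def)
      next
        case False
        then have "s0 = 0 + 2 * s" by (simp add: s0_def)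
        then show ?thesis by (rule quadratic_extI') simp_all
      qed
      then show "E \<subseteq> K" unfolding K' using S by (intro quadratic_ext_subset)
    qed
  qed
  obtain v w where vw: "quadratic_integral_basis K v w" and
    disc: "of_int D = rel_trace \<rat> K (v * v) * rel_trace \<rat> K (w * w) - rel_trace \<rat> K (v * w) * rel_trace \<rat> K (w * v)"
    using K(2) unfolding quadratic_field_disc_def by blast
  have vwE: "v \<in> E" "w \<in> E" "algebraic_int v" "algebraic_int w"
    using vw unfolding quadratic_integral_basis_def KE by auto
  note EF = complex_subfieldD(5)[OF subfield_E]
  define \<omega> where "\<omega> = (of_int D0 + s0) / 2"
  have \<omega>E: "\<omega> \<in> E"
  proof -
    have "\<omega> = of_int D0 / 2 + (1 / 2) * s0" by (simp add: \<omega>_def field_simps)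
    then show ?thesis by (rule quadratic_extI') simp_all
  qed
  have \<omega>i: "algebraic_int \<omega>" unfolding \<omega>_def
    by (rule algebraic_int_half_int_plus_sqrt[OF _ s0]) (use fund in \<open>simp add: fundamental_def\<close>)
  obtain a b where v: "v = of_int a + of_int b * \<omega>"
    using quadratic_integer_coords[OF fund s0 irr vwE(1,3)] unfolding \<omega>_def by blast
  obtain c d where w: "w = of_int c + of_int d * \<omega>"
    using quadratic_integer_coords[OF fund s0 irr vwE(2,4)] unfolding \<omega>_def by blast
  have "\<exists>x y. z = of_int x * v + of_int y * w" if "z \<in> E" "algebraic_int z" for z
  proof -
    have "\<exists>!(a, b). z = complex_of_int a * v + complex_of_int b * w"
      using vw that unfolding quadratic_integral_basis_def KE by simp
    then have "\<exists>p. case p of (a, b) \<Rightarrow> z = complex_of_int a * v + complex_of_int b * w" by (rule ex1_implies_ex)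
    then show ?thesis by auto
  qed
  then obtain x1 y1 x2 y2 :: int where xy: "1 = of_int x1 * v + of_int y1 * w" "\<omega> = of_int x2 * v + of_int y2 * w"
    using \<omega>E \<omega>i complex_subfieldD(1)[OF subfield_E] algebraic_int_of_int'[of 1] by (metis of_int_1)
  have coords: "x = x' \<and> y = y'" if "of_int x + of_int y * \<omega> = of_int x' + of_int y' * \<omega>" for x y x' y' :: int
  proof -
    have *: "of_int k + of_int l * \<omega> = (of_int k + of_int l * of_int D0 / 2) + (of_int l / 2) * s0" for k l
      by (simp add: \<omega>_def field_simps)
    have "(of_int x + of_int y * of_int D0 / 2 :: complex) = of_int x' + of_int y' * of_int D0 / 2" "(of_int y / 2 :: complex) = of_int y' / 2"
      using coords_unique[OF _ _ _ _ that[unfolded *]] by simp_all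
    then show ?thesis by simp
  qed
  have "of_int 1 + of_int 0 * \<omega> = of_int (x1 * a + y1 * c) + of_int (x1 * b + y1 * d) * \<omega>"
    using xy(1) unfolding v w by (simp add: algebra_simps)
  from coords[OF this] have 1: "1 = x1 * a + y1 * c" "0 = x1 * b + y1 * d" by auto
  have "of_int 0 + of_int 1 * \<omega> = of_int (x2 * a + y2 * c) + of_int (x2 * b + y2 * d) * \<omega>"
    using xy(2) unfolding v w by (simp add: algebra_simps)
  from coords[OF this] have 2: "0 = x2 * a + y2 * c" "1 = x2 * b + y2 * d" by auto
  have "(x1 * y2 - x2 * y1) * (a * d - b * c) = (x1 * a + y1 * c) * (x2 * b + y2 * d) - (x1 * b + y1 * d) * (x2 * a + y2 * c)"
    by (simp add: algebra_simps)
  also have "\<dots> = 1" unfolding 1[symmetric] 2[symmetric] by simp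
  finally have "(a * d - b * c) dvd 1" by (metis dvd_triv_right)
  then have det: "(a * d - b * c)\<^sup>2 = 1" by (auto simp: power2_eq_1_iff zdvd1_eq abs_eq_iff')
  have c\<omega>: "ext_conj \<rat> s0 \<omega> = \<omega> - s0"
  proof -
    have "\<omega> = of_int D0 / 2 + (1 / 2) * s0" by (simp add: \<omega>_def field_simps)
    then have "ext_conj \<rat> s0 \<omega> = of_int D0 / 2 - (1 / 2) * s0" using ext_conj_eq[of "of_int D0 / 2" "1 / 2"] by simp
    then show ?thesis by (simp add: \<omega>_def field_simps)
  qed
  have IE: "of_int k \<in> E" for k using complex_subfieldD(9)[OF subfield_E] .
  have conj: "ext_conj \<rat> s0 (of_int k + of_int l * \<omega>) = of_int k + of_int l * (\<omega> - s0)" for k l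
    using ext_conj_hom(1)[OF IE EF[OF IE \<omega>E], of k l] ext_conj_hom(2)[OF IE \<omega>E, of l]
    by (simp add: c\<omega> ext_conj_fixed)
  define v' where "v' = ext_conj \<rat> s0 v"
  define w' where "w' = ext_conj \<rat> s0 w"
  have "of_int D = (v * v + v' * v') * (w * w + w' * w') - (v * w + v' * w') * (w * v + w' * v')"
    unfolding disc KE v'_def w'_def using vwE(1,2) EF by (simp add: rel_trace_eq ext_conj_hom(2))
  \<comment> \<open>The determinant of the trace form is the square of the determinant of the
    conjugates.\<close>
  also have "\<dots> = (v * w' - v' * w) * (v * w' - v' * w)" by (simp add: algebra_simps)
  also have "v * w' - v' * w = - of_int (a * d - b * c) * s0"
    unfolding v'_def w'_def v w conj by (simp add: algebra_simps)
  also have "(- of_int (a * d - b * c) * s0) * (- of_int (a * d - b * c) * s0) = of_int ((a * d - b * c)\<^sup>2) * (s0 * s0)"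
    by (simp add: power2_eq_square algebra_simps)
  also have "\<dots> = of_int D0" unfolding det s0 by simp
  finally have "D = D0" by (simp only: of_int_eq_iff)
  then show "fundamental D" "D > 1" using fund D01 by simp_all
qed

section \<open>The biquadratic field\<close>

text \<open>If t = a + b s, rationality of t^2 forces a b = 0, and then s t or t itself is
  rational.\<close>

lemma sqrt_not_in_quadratic_ext:
  fixes s t :: complex
  assumes "s * s \<in> \<rat>" "t * t \<in> \<rat>" "s \<notin> \<rat>" "t \<notin> \<rat>" "s * t \<notin> \<rat>"
  shows "t \<notin> quadratic_ext \<rat> s"
proof
  interpret quadratic_extension \<rat> s
    by standard (use assms complex_subfield_Rats in auto)
  assume "t \<in> quadratic_ext \<rat> s"
  then obtain a b where ab: "a \<in> \<rat>" "b \<in> \<rat>" "t = a + b * s" by (rule E_cases)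
  have "(a * a + b * b * (s * s)) + (2 * a * b) * s = t * t + 0 * s" unfolding ab by (simp add: algebra_simps)
  then have "2 * a * b = 0" using coords_unique(2)[of "a * a + b * b * (s * s)" "2 * a * b" "t * t" 0] ab assms by simp
  then consider "a = 0" | "b = 0" by auto
  then show False
  proof cases
    case 1
    then have "s * t = b * (s * s)" using ab(3) by simp
    then have "s * t \<in> \<rat>" using Rats_mult[OF ab(2) assms(1)] by (simp only:)
    then show False using assms(5) by blast
  next
    case 2
    then have "t = a" using ab(3) by simp
    then show False using assms(4) ab(1) by blast
  qed
qed

section \<open>Rings of integers and their ideals\<close>

definition complex_integers :: "complex set \<Rightarrow> complex set" where
  "complex_integers F = {x \<in> F. algebraic_int x}"

lemma complex_integers_closed:
  assumes "complex_subfield F"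
  shows "x \<in> complex_integers F \<Longrightarrow> y \<in> complex_integers F \<Longrightarrow> x + y \<in> complex_integers F"
    "x \<in> complex_integers F \<Longrightarrow> y \<in> complex_integers F \<Longrightarrow> x * y \<in> complex_integers F"
    "x \<in> complex_integers F \<Longrightarrow> y \<in> complex_integers F \<Longrightarrow> x - y \<in> complex_integers F"
    "x \<in> complex_integers F \<Longrightarrow> - x \<in> complex_integers F"
    "of_int m \<in> complex_integers F" "1 \<in> complex_integers F" "0 \<in> complex_integers F"
proof -
  note F = complex_subfieldD[OF assms]
  show "x \<in> complex_integers F \<Longrightarrow> y \<in> complex_integers F \<Longrightarrow> x + y \<in> complex_integers F"
    unfolding complex_integers_def by (simp add: F(4) algebraic_int_add)
  show "x \<in> complex_integers F \<Longrightarrow> y \<in> complex_integers F \<Longrightarrow> x * y \<in> complex_integers F"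
    unfolding complex_integers_def by (simp add: F(5) algebraic_int_mult)
  show "x \<in> complex_integers F \<Longrightarrow> y \<in> complex_integers F \<Longrightarrow> x - y \<in> complex_integers F"
    unfolding complex_integers_def by (simp add: F(3) algebraic_int_diff)
  show "x \<in> complex_integers F \<Longrightarrow> - x \<in> complex_integers F"
    unfolding complex_integers_def by (simp add: F(6))
  have int: "of_int m \<in> complex_integers F" for m
    unfolding complex_integers_def by (simp add: F(9) algebraic_int_of_int')
  then show "of_int m \<in> complex_integers F" .
  show "1 \<in> complex_integers F" "0 \<in> complex_integers F" using int[of 1] int[of 0] by simp_all
qed

lemma ring_integers_ring:
  assumes "complex_subfield F"
  shows "cring (integers_ring F)"
proof -
  note R = complex_integers_closed[OF assms, unfolded complex_integers_def]
  show ?thesis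
  proof (rule cringI)
    show "abelian_group (integers_ring F)"
    proof (rule abelian_groupI)
      fix x assume "x \<in> carrier (integers_ring F)"
      then show "\<exists>y\<in>carrier (integers_ring F). y \<oplus>\<^bsub>integers_ring F\<^esub> x = \<zero>\<^bsub>integers_ring F\<^esub>"
        using R(4)[of x] by (intro bexI[of _ "- x"]) (simp_all add: integers_ring_def complex_ring_def)
    qed (use R in \<open>auto simp: integers_ring_def complex_ring_def\<close>)
    show "Group.comm_monoid (integers_ring F)"
      by (rule comm_monoidI) (use R in \<open>auto simp: integers_ring_def complex_ring_def\<close>)
    show "(x \<oplus>\<^bsub>integers_ring F\<^esub> y) \<otimes>\<^bsub>integers_ring F\<^esub> z = x \<otimes>\<^bsub>integers_ring F\<^esub> z \<oplus>\<^bsub>integers_ring F\<^esub> y \<otimes>\<^bsub>integers_ring F\<^esub> z" for x y z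
      by (simp add: integers_ring_def complex_ring_def algebra_simps)
  qed
qed

text \<open>Closure under negation, needed for the additive subgroup, comes from multiplication by
  the integer -1.\<close>

lemma ideal_integers_ring_iff:
  assumes "complex_subfield F"
  shows "ideal A (integers_ring F) \<longleftrightarrow> A \<subseteq> complex_integers F \<and> 0 \<in> A \<and> (\<forall>x\<in>A. \<forall>y\<in>A. x + y \<in> A) \<and>
           (\<forall>x\<in>A. \<forall>r\<in>complex_integers F. r * x \<in> A)"
proof
  interpret R: cring "integers_ring F" by (rule ring_integers_ring[OF assms])
  have ops: "x \<oplus>\<^bsub>integers_ring F\<^esub> y = x + y" "x \<otimes>\<^bsub>integers_ring F\<^esub> y = x * y" "\<zero>\<^bsub>integers_ring F\<^esub> = 0"
    "carrier (integers_ring F) = complex_integers F" for x y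
    by (simp_all add: integers_ring_def complex_ring_def complex_integers_def)
  assume "ideal A (integers_ring F)"
  then interpret ideal A "integers_ring F" .
  show "A \<subseteq> complex_integers F \<and> 0 \<in> A \<and> (\<forall>x\<in>A. \<forall>y\<in>A. x + y \<in> A) \<and> (\<forall>x\<in>A. \<forall>r\<in>complex_integers F. r * x \<in> A)"
    using a_subset a_closed zero_closed I_l_closed unfolding ops by blast
next
  interpret R: cring "integers_ring F" by (rule ring_integers_ring[OF assms])
  have ops: "x \<oplus>\<^bsub>integers_ring F\<^esub> y = x + y" "x \<otimes>\<^bsub>integers_ring F\<^esub> y = x * y" "\<zero>\<^bsub>integers_ring F\<^esub> = 0"
    "carrier (integers_ring F) = complex_integers F" for x y
    by (simp_all add: integers_ring_def complex_ring_def complex_integers_def)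
  assume A: "A \<subseteq> complex_integers F \<and> 0 \<in> A \<and> (\<forall>x\<in>A. \<forall>y\<in>A. x + y \<in> A) \<and> (\<forall>x\<in>A. \<forall>r\<in>complex_integers F. r * x \<in> A)"
  have neg: "- x \<in> A" if "x \<in> A" for x
  proof -
    have "of_int (- 1) * x \<in> A" using A that complex_integers_closed(5)[OF assms] by blast
    then show ?thesis by simp
  qed
  show "ideal A (integers_ring F)"
  proof (rule idealI)
    show "ring (integers_ring F)" by (rule R.ring_axioms)
    show "subgroup A (add_monoid (integers_ring F))"
    proof (rule R.add.subgroupI)
      show "A \<subseteq> carrier (integers_ring F)" "A \<noteq> {}" using A unfolding ops by blast+
      fix x y assume xy: "x \<in> A" "y \<in> A"
      show "x \<oplus>\<^bsub>integers_ring F\<^esub> y \<in> A" using A xy unfolding ops by blast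
      have "\<ominus>\<^bsub>integers_ring F\<^esub> x = - x"
      proof (rule R.minus_equality)
        show "- x \<oplus>\<^bsub>integers_ring F\<^esub> x = \<zero>\<^bsub>integers_ring F\<^esub>" by (simp add: ops)
        show "x \<in> carrier (integers_ring F)" "- x \<in> carrier (integers_ring F)" using xy A neg unfolding ops by blast+
      qed
      then show "\<ominus>\<^bsub>integers_ring F\<^esub> x \<in> A" using neg xy by simp
    qed
    fix a x assume "a \<in> A" "x \<in> carrier (integers_ring F)"
    then show "x \<otimes>\<^bsub>integers_ring F\<^esub> a \<in> A" "a \<otimes>\<^bsub>integers_ring F\<^esub> x \<in> A"
      using A unfolding ops by (simp_all add: mult.commute)
  qed
qed

lemma cgenideal_integers_ring: "PIdl\<^bsub>integers_ring F\<^esub> a = {x * a | x. x \<in> complex_integers F}"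
  unfolding cgenideal_def by (simp add: integers_ring_def complex_ring_def complex_integers_def)

section \<open>Integral basis of the biquadratic field\<close>

locale biquadratic =
  fixes D1 D2 :: int and s1 s2 :: complex
  assumes sq1: "s1 * s1 = of_int D1" and sq2: "s2 * s2 = of_int D2"
    and fund1: "fundamental D1" and fund2: "fundamental D2" and D1_gt: "D1 > 1" and D2_gt: "D2 > 1"
    and coprime_D: "coprime D1 D2"
begin

lemma fund12: "fundamental (D1 * D2)" by (rule fundamental_mult[OF fund1 fund2 coprime_D])

lemma D12_gt: "D1 * D2 > 1" using less_1_mult[OF D1_gt D2_gt] .

lemma sq12: "(s1 * s2) * (s1 * s2) = of_int (D1 * D2)"
  unfolding of_int_mult sq1[symmetric] sq2[symmetric] by (simp add: algebra_simps)

lemma irr: "s1 \<notin> \<rat>" "s2 \<notin> \<rat>" "s1 * s2 \<notin> \<rat>"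
  using sqrt_int_irrational[OF sq1 fundamental_not_square[OF fund1 D1_gt]]
    sqrt_int_irrational[OF sq2 fundamental_not_square[OF fund2 D2_gt]]
    sqrt_int_irrational[OF sq12 fundamental_not_square[OF fund12 D12_gt]] by blast+

definition "K = quadratic_ext \<rat> (s1 * s2)"
definition "L = quadratic_ext K s1"

sublocale Kx: quadratic_extension \<rat> "s1 * s2"
  by standard (use irr sq12 complex_subfield_Rats in \<open>auto simp del: of_int_mult\<close>)

sublocale Q1: quadratic_extension \<rat> s1
  by standard (use irr sq1 complex_subfield_Rats in auto)

lemma subfield_K: "complex_subfield K" unfolding K_def by (rule Kx.subfield_E)

lemma s12_in_K: "s1 * s2 \<in> K" unfolding K_def by (rule Kx.s_in)

sublocale Lx: quadratic_extension K s1
proof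
  show "complex_subfield K" by (rule subfield_K)
  show "s1 * s1 \<in> K" unfolding sq1 by (rule complex_subfieldD(9)[OF subfield_K])
  show "s1 \<notin> K" unfolding K_def
  proof (rule sqrt_not_in_quadratic_ext)
    show "s1 * s2 * (s1 * s2) \<in> \<rat>" unfolding sq12 by simp
    show "s1 * s1 \<in> \<rat>" unfolding sq1 by simp
    have eq: "s1 * s2 * s1 = of_int D1 * s2" unfolding sq1[symmetric] by (simp add: algebra_simps)
    show "s1 * s2 * s1 \<notin> \<rat>"
    proof
      assume "s1 * s2 * s1 \<in> \<rat>"
      then have "of_int D1 * s2 / of_int D1 \<in> \<rat>" unfolding eq by (intro Rats_divide) simp_all
      then show False using irr D1_gt by simp
    qed
  qed (use irr in auto)
qed

sublocale L2: quadratic_extension "quadratic_ext \<rat> s1" s2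
proof
  show "complex_subfield (quadratic_ext \<rat> s1)" by (rule Q1.subfield_E)
  show "s2 * s2 \<in> quadratic_ext \<rat> s1" unfolding sq2 by (rule complex_subfieldD(9)[OF Q1.subfield_E])
  show "s2 \<notin> quadratic_ext \<rat> s1"
    by (rule sqrt_not_in_quadratic_ext) (use irr sq1 sq2 in auto)
qed

lemma subfield_L: "complex_subfield L" unfolding L_def by (rule Lx.subfield_E)

lemma s_in_L: "s1 \<in> L" "s2 \<in> L"
proof -
  show 1: "s1 \<in> L" unfolding L_def by (rule Lx.s_in)
  have s2: "s2 = 0 + (s1 * s2 / of_int D1) * s1"
    using D1_gt sq1 by (simp add: field_simps)
  have "s1 * s2 / of_int D1 \<in> K"
    using complex_subfieldD(8)[OF subfield_K s12_in_K complex_subfieldD(9)[OF subfield_K]] .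
  then show "s2 \<in> L" unfolding L_def
    by (rule quadratic_extI'[OF s2 complex_subfieldD(2)[OF subfield_K]])
qed

text \<open>L is needed as a tower in two ways: over K for the relative norm, and over the field of
  s1, whose integers are already known, for the integral basis.\<close>

lemma L_eq: "L = quadratic_ext (quadratic_ext \<rat> s1) s2"
proof
  show "L \<subseteq> quadratic_ext (quadratic_ext \<rat> s1) s2"
    unfolding L_def K_def
    using L2.subfield_E L2.s_in L2.F_subset Q1.s_in complex_subfieldD(5)[OF L2.subfield_E]
    by (intro quadratic_ext_subset Rats_subset_complex_subfield) auto
  show "quadratic_ext (quadratic_ext \<rat> s1) s2 \<subseteq> L"
    using subfield_L s_in_L by (intro quadratic_ext_subset Rats_subset_complex_subfield) auto
qed

lemma L_eq_adjoin: "L = adjoin {s1, s2}"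
  unfolding L_eq by (rule adjoin_pair[symmetric]) (simp_all add: sq1 sq2)

definition "\<omega>1 = (of_int D1 + s1) / 2"
definition "\<omega>2 = (of_int D2 + s2) / 2"

definition basis_span :: "complex set" where
  "basis_span = {of_int a + of_int b * \<omega>1 + of_int c * \<omega>2 + of_int d * (\<omega>1 * \<omega>2) | a b c d. True}"

lemma basis_span_lincomb:
  assumes "x \<in> basis_span" "y \<in> basis_span"
  shows "of_int p * x + of_int q * y \<in> basis_span"
proof -
  obtain a b c d a' b' c' d' where
    x: "x = of_int a + of_int b * \<omega>1 + of_int c * \<omega>2 + of_int d * (\<omega>1 * \<omega>2)" and
    y: "y = of_int a' + of_int b' * \<omega>1 + of_int c' * \<omega>2 + of_int d' * (\<omega>1 * \<omega>2)"
    using assms unfolding basis_span_def by blast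
  have "of_int p * x + of_int q * y = of_int (p * a + q * a') + of_int (p * b + q * b') * \<omega>1 +
      of_int (p * c + q * c') * \<omega>2 + of_int (p * d + q * d') * (\<omega>1 * \<omega>2)"
    unfolding x y by (simp add: algebra_simps)
  then show ?thesis unfolding basis_span_def by blast
qed

lemma algebraic_int_omega: "algebraic_int \<omega>1" "algebraic_int \<omega>2"
  unfolding \<omega>1_def \<omega>2_def
  using algebraic_int_half_int_plus_sqrt[OF _ sq1] algebraic_int_half_int_plus_sqrt[OF _ sq2] fund1 fund2
  by (simp_all add: fundamental_def)

text \<open>The traces of x and of x times the conjugate of \<omega>2 down to the field of s1 are
  integers there, hence combinations of 1 and \<omega>1. Solving for the coordinates of x with
  respect to 1 and \<omega>2 is a linear system of determinant - D2, so D2 is the only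
  denominator.\<close>

lemma D2_mult_in_basis_span:
  assumes "x \<in> L" "algebraic_int x"
  shows "of_int D2 * x \<in> basis_span"
proof -
  obtain a b where ab: "a \<in> quadratic_ext \<rat> s1" "b \<in> quadratic_ext \<rat> s1" "x = a + b * s2"
    using L2.E_cases assms(1) unfolding L_eq by blast
  have conj: "algebraic_int (a - b * s2)"
    using L2.algebraic_int_ext_conj[OF assms(2)] assms(1) unfolding L_eq ab(3) L2.ext_conj_eq[OF ab(1,2)] by blast
  have nat4: "D2 mod 4 = 0 \<or> D2 mod 4 = 1" using fundamentalD(1)[OF fund2] .
  define \<omega>2' where "\<omega>2' = of_int D2 - \<omega>2"
  have \<omega>2': "algebraic_int \<omega>2'" unfolding \<omega>2'_def by (intro algebraic_int_diff algebraic_int_of_int' algebraic_int_omega)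
  define t where "t = x + (a - b * s2)"
  define u where "u = x * \<omega>2' + (a - b * s2) * \<omega>2"
  have int: "algebraic_int t" "algebraic_int u"
    unfolding t_def u_def using assms(2) conj \<omega>2' algebraic_int_omega
    by (simp_all add: algebraic_int_add algebraic_int_mult)
  have t: "t = 2 * a" by (simp add: t_def ab(3))
  have u: "u = of_int D2 * a - of_int D2 * b"
  proof -
    have "u = of_int D2 * a - b * (s2 * s2)"
      unfolding u_def \<omega>2'_def \<omega>2_def ab(3) by (simp add: field_simps)
    then show ?thesis unfolding sq2 by simp
  qed
  note QF = complex_subfieldD[OF Q1.subfield_E]
  have in_Q1: "t \<in> quadratic_ext \<rat> s1" "u \<in> quadratic_ext \<rat> s1"
    unfolding t u using QF(3)[OF QF(5)[OF QF(9) ab(1)] QF(5)[OF QF(9) ab(2)]] QF(5)[OF QF(11) ab(1)] by auto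
  obtain t0 t1 where t': "t = of_int t0 + of_int t1 * \<omega>1"
    using quadratic_integer_coords[OF fund1 sq1 irr(1) in_Q1(1) int(1)] unfolding \<omega>1_def by blast
  obtain u0 u1 where u': "u = of_int u0 + of_int u1 * \<omega>1"
    using quadratic_integer_coords[OF fund1 sq1 irr(1) in_Q1(2) int(2)] unfolding \<omega>1_def by blast
  have "even (D2 * D2 - D2)" by simp
  then obtain \<nu> where \<nu>: "D2 * D2 - D2 = 2 * \<nu>" by (elim evenE)
  have \<nu>': "(of_int D2 * of_int D2 - of_int D2 :: complex) = 2 * of_int \<nu>"
    using arg_cong[OF \<nu>, of complex_of_int] by simp
  have "of_int D2 * x = (of_int D2 * u - of_int \<nu> * t) + (of_int D2 * t - 2 * u) * \<omega>2"
  proof -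
    have "2 * (of_int D2 * x) = 2 * of_int D2 * u - (2 * of_int \<nu>) * t + (of_int D2 * t - 2 * u) * (2 * \<omega>2)"
      unfolding \<nu>'[symmetric] t u ab(3) \<omega>2_def by (simp add: algebra_simps)
    also have "\<dots> = 2 * ((of_int D2 * u - of_int \<nu> * t) + (of_int D2 * t - 2 * u) * \<omega>2)"
      by (simp add: algebra_simps)
    finally show ?thesis unfolding mult_cancel_left by simp
  qed
  also have "\<dots> = of_int (D2 * u0 - \<nu> * t0) + of_int (D2 * u1 - \<nu> * t1) * \<omega>1 + of_int (D2 * t0 - 2 * u0) * \<omega>2 +
      of_int (D2 * t1 - 2 * u1) * (\<omega>1 * \<omega>2)"
    unfolding t' u' by (simp add: algebra_simps)
  finally show ?thesis unfolding basis_span_def by blast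
qed

end

text \<open>Integral bases multiply when the discriminants are coprime: exchanging the two fields
  shows that D1 x lies in the span as well as D2 x, and a Bezout relation recovers x.\<close>

lemma (in biquadratic) integers_L_eq: "complex_integers L = basis_span"
proof (intro equalityI subsetI)
  interpret sym: biquadratic D2 D1 s2 s1
    by standard (use sq1 sq2 fund1 fund2 D1_gt D2_gt coprime_D in \<open>auto simp: coprime_commute\<close>)
  have om: "sym.\<omega>1 = \<omega>2" "sym.\<omega>2 = \<omega>1"
    by (simp_all add: sym.\<omega>1_def sym.\<omega>2_def \<omega>1_def \<omega>2_def)
  have span: "sym.basis_span \<subseteq> basis_span"
  proof
    fix x assume "x \<in> sym.basis_span"
    then obtain a b c d where "x = of_int a + of_int b * \<omega>2 + of_int c * \<omega>1 + of_int d * (\<omega>2 * \<omega>1)"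
      unfolding sym.basis_span_def om by blast
    then have "x = of_int a + of_int c * \<omega>1 + of_int b * \<omega>2 + of_int d * (\<omega>1 * \<omega>2)" by (simp add: algebra_simps)
    then show "x \<in> basis_span" unfolding basis_span_def by blast
  qed
  have L': "sym.L = L" unfolding L_eq_adjoin sym.L_eq_adjoin by (simp add: insert_commute)
  fix x assume "x \<in> complex_integers L"
  then have x: "x \<in> L" "algebraic_int x" by (simp_all add: complex_integers_def)
  have "of_int D2 * x \<in> basis_span" by (rule D2_mult_in_basis_span[OF x])
  moreover have "of_int D1 * x \<in> basis_span" using sym.D2_mult_in_basis_span[of x] x L' span by auto
  moreover obtain p q where pq: "p * D1 + q * D2 = 1"
    using bezout_int[of D1 D2] coprime_D by (auto simp: coprime_iff_gcd_eq_1)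
  ultimately have "of_int p * (of_int D1 * x) + of_int q * (of_int D2 * x) \<in> basis_span"
    by (intro basis_span_lincomb)
  also have "of_int p * (of_int D1 * x) + of_int q * (of_int D2 * x) = of_int (p * D1 + q * D2) * x"
    by (simp add: algebra_simps)
  finally show "x \<in> basis_span" unfolding pq by simp
next
  fix x assume "x \<in> basis_span"
  then obtain a b c d where x: "x = of_int a + of_int b * \<omega>1 + of_int c * \<omega>2 + of_int d * (\<omega>1 * \<omega>2)"
    unfolding basis_span_def by blast
  note L = complex_subfieldD[OF subfield_L]
  have "\<omega>1 \<in> L" "\<omega>2 \<in> L" unfolding \<omega>1_def \<omega>2_def
    by (rule L(8)[OF L(4)[OF L(9) s_in_L(1)] L(11)], rule L(8)[OF L(4)[OF L(9) s_in_L(2)] L(11)])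
  then have "\<omega>1 \<in> complex_integers L" "\<omega>2 \<in> complex_integers L"
    using algebraic_int_omega by (simp_all add: complex_integers_def)
  then show "x \<in> complex_integers L" unfolding x
    by (intro complex_integers_closed[OF subfield_L])
qed

context biquadratic
begin

abbreviation "OK \<equiv> complex_integers K"
abbreviation "OL \<equiv> complex_integers L"

definition "\<omega> = (of_int (D1 * D2) + s1 * s2) / 2"

lemma integers_K_coords:
  assumes "x \<in> OK"
  shows "\<exists>a b :: int. x = of_int a + of_int b * \<omega>"
  using quadratic_integer_coords[OF fund12 sq12 irr(3), of x] assms unfolding \<omega>_def complex_integers_def K_def by blast

lemma omega_in_OK: "\<omega> \<in> OK"
proof -
  note F = complex_subfieldD[OF subfield_K]
  have "\<omega> \<in> K" unfolding \<omega>_def by (rule F(8)[OF F(4)[OF F(9) s12_in_K] F(11)])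
  moreover have "algebraic_int \<omega>" unfolding \<omega>_def
    by (rule algebraic_int_half_int_plus_sqrt[OF _ sq12]) (use fund12 in \<open>simp add: fundamental_def\<close>)
  ultimately show ?thesis by (simp add: complex_integers_def)
qed

lemma K_coords_unique:
  fixes a b a' b' :: int
  assumes "of_int a + of_int b * \<omega> = of_int a' + of_int b' * \<omega>"
  shows "a = a'" "b = b'"
proof -
  have *: "of_int k + of_int l * \<omega> = (of_int k + of_int l * of_int (D1 * D2) / 2) + (of_int l / 2) * (s1 * s2)" for k l
    by (simp add: \<omega>_def field_simps)
  have "(of_int b / 2 :: complex) = of_int b' / 2" "(of_int a + of_int b * of_int (D1 * D2) / 2 :: complex) = of_int a' + of_int b' * of_int (D1 * D2) / 2"
    using Kx.coords_unique[OF _ _ _ _ assms[unfolded *]] by simp_all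
  then show "a = a'" "b = b'" by simp_all
qed

lemma OK_subset_OL: "OK \<subseteq> OL"
  using Lx.F_subset unfolding complex_integers_def L_def by blast

definition "\<sigma> = ext_conj K s1"

lemma sigma_OL: "x \<in> OL \<Longrightarrow> \<sigma> x \<in> OL"
  unfolding complex_integers_def \<sigma>_def L_def using Lx.ext_conj_hom(3) Lx.algebraic_int_ext_conj by blast

lemma sigma_hom:
  "x \<in> OL \<Longrightarrow> y \<in> OL \<Longrightarrow> \<sigma> (x + y) = \<sigma> x + \<sigma> y" "x \<in> OL \<Longrightarrow> y \<in> OL \<Longrightarrow> \<sigma> (x * y) = \<sigma> x * \<sigma> y"
  unfolding complex_integers_def \<sigma>_def L_def using Lx.ext_conj_hom(1,2) by blast+

lemma sigma_OK: "x \<in> OK \<Longrightarrow> \<sigma> x = x"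
  unfolding complex_integers_def \<sigma>_def using Lx.ext_conj_fixed by blast

lemma sigma_s: "\<sigma> s1 = - s1" "\<sigma> s2 = - s2"
proof -
  show "\<sigma> s1 = - s1" unfolding \<sigma>_def by (rule Lx.ext_conj_s)
  have b: "s1 * s2 / of_int D1 \<in> K"
    using complex_subfieldD(8)[OF subfield_K s12_in_K complex_subfieldD(9)[OF subfield_K]] .
  have s2: "s2 = 0 + (s1 * s2 / of_int D1) * s1" using D1_gt sq1 by (simp add: field_simps)
  have "\<sigma> (0 + (s1 * s2 / of_int D1) * s1) = 0 - (s1 * s2 / of_int D1) * s1"
    unfolding \<sigma>_def by (rule Lx.ext_conj_eq[OF complex_subfieldD(2)[OF subfield_K] b])
  then show "\<sigma> s2 = - s2" unfolding s2[symmetric] using s2 by simp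
qed

lemma trace_norm_OK:
  assumes "x \<in> OL"
  shows "x + \<sigma> x \<in> OK" "x * \<sigma> x \<in> OK"
proof -
  obtain a b where ab: "a \<in> K" "b \<in> K" "x = a + b * s1"
    using assms Lx.E_cases unfolding complex_integers_def L_def by blast
  have \<sigma>: "\<sigma> x = a - b * s1" unfolding ab(3) \<sigma>_def by (rule Lx.ext_conj_eq[OF ab(1,2)])
  note F = complex_subfieldD[OF subfield_K]
  have "x + \<sigma> x = 2 * a" unfolding \<sigma> by (simp add: ab(3))
  then have 1: "x + \<sigma> x \<in> K" using F(5)[OF F(11) ab(1)] by simp
  have "x * \<sigma> x = a * a - b * b * of_int D1" unfolding \<sigma> sq1[symmetric] by (simp add: ab(3) algebra_simps)
  then have 2: "x * \<sigma> x \<in> K" using F(3)[OF F(5)[OF ab(1) ab(1)] F(5)[OF F(5)[OF ab(2) ab(2)] F(9)]] by simp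
  have "algebraic_int x" "algebraic_int (\<sigma> x)" using assms sigma_OL[OF assms] by (simp_all add: complex_integers_def)
  then show "x + \<sigma> x \<in> OK" "x * \<sigma> x \<in> OK" using 1 2 algebraic_int_add algebraic_int_mult by (simp_all add: complex_integers_def)
qed

lemma rel_norm_KL: "x \<in> OL \<Longrightarrow> rel_norm K L x = x * \<sigma> x"
  unfolding complex_integers_def \<sigma>_def L_def using Lx.rel_norm_eq by blast

end

section \<open>Ideals of given relative norm\<close>

lemma int_subgroup_generator:
  fixes S :: "int set"
  assumes diff: "\<And>x y. x \<in> S \<Longrightarrow> y \<in> S \<Longrightarrow> x - y \<in> S" and m: "m \<in> S" "m > 0"
  shows "\<exists>d>0. \<forall>x. x \<in> S \<longleftrightarrow> d dvd x"
proof -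
  have zero: "0 \<in> S" using diff[OF m(1) m(1)] by simp
  have neg: "- x \<in> S" if "x \<in> S" for x using diff[OF zero that] by simp
  have add: "x + y \<in> S" if "x \<in> S" "y \<in> S" for x y using diff[OF that(1) neg[OF that(2)]] by simp
  have nat: "int i * x \<in> S" if "x \<in> S" for i x
  proof (induction i)
    case (Suc i)
    then show ?case using add[OF that Suc] by (simp add: algebra_simps)
  qed (simp add: zero)
  have mult: "k * x \<in> S" if "x \<in> S" for k x
  proof (cases "k \<ge> 0")
    case True
    then show ?thesis using nat[OF that, of "nat k"] by simp
  next
    case False
    then show ?thesis using neg[OF nat[OF that, of "nat (- k)"]] by simp
  qed
  define d where "d = (LEAST i. i > 0 \<and> int i \<in> S)"
  have ex: "nat m > 0 \<and> int (nat m) \<in> S" using m by simp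
  have d: "d > 0" "int d \<in> S" using LeastI[where P = "\<lambda>i. i > 0 \<and> int i \<in> S", OF ex] unfolding d_def by blast+
  have "int d dvd x" if "x \<in> S" for x
  proof (rule ccontr)
    assume "\<not> int d dvd x"
    then have r: "x mod int d > 0" using d(1)
      by (metis dvd_eq_mod_eq_0 of_nat_0_less_iff order_le_less pos_mod_sign)
    have "x mod int d = x - (x div int d) * int d" by (simp add: minus_div_mult_eq_mod)
    then have "x mod int d \<in> S" using diff[OF that mult[OF d(2)]] by simp
    then have "nat (x mod int d) > 0 \<and> int (nat (x mod int d)) \<in> S" using r by simp
    then have "d \<le> nat (x mod int d)" unfolding d_def by (rule Least_le)
    moreover have "x mod int d < int d" using d(1) by simp
    ultimately show False using r by linarith
  qed
  moreover have "x \<in> S" if "int d dvd x" for x using that mult[OF d(2)] by (auto simp: mult.commute elim!: dvdE)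
  ultimately show ?thesis using d(1) by (intro exI[of _ "int d"]) auto
qed

section \<open>The residue ring of the integers of L modulo \<alpha>\<close>

locale biquadratic_value = biquadratic +
  fixes n N x0 y0 D :: int
  assumes DN: "D1 * D2 - n\<^sup>2 = 4 * N" and N_pos: "N > 0"
    and D_eq: "D = D1 * x0\<^sup>2 + 2 * n * x0 * y0 + D2 * y0\<^sup>2" and D_mod: "D mod 4 = 1" and coprime_DN: "coprime D N"
begin

lemmas OL_closed = complex_integers_closed[OF subfield_L]
lemmas OK_closed = complex_integers_closed[OF subfield_K]

definition "\<alpha> = (s1 * s2 - of_int n) / 2"
definition "\<alpha>' = (- (s1 * s2) - of_int n) / 2"
definition "s = of_int x0 * s1 + of_int y0 * s2"
text \<open>The square of s is D + 4 x0 y0 \<alpha>, so modulo \<alpha> the element \<theta> plays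
  the part of (1 + sqrt D)/2, a root of T^2 - T - c.\<close>

definition "\<theta> = (1 + s) / 2"
definition "c = (D - 1) div 4"

lemma doubles:
  "2 * \<alpha> = s1 * s2 - of_int n" "2 * \<alpha>' = - (s1 * s2) - of_int n" "2 * \<theta> = 1 + s"
  "2 * \<omega> = of_int (D1 * D2) + s1 * s2" "2 * \<omega>1 = of_int D1 + s1" "2 * \<omega>2 = of_int D2 + s2"
  by (simp_all only: \<alpha>_def \<alpha>'_def \<theta>_def \<omega>_def \<omega>1_def \<omega>2_def) simp_all

lemma D_decomp: "D = 4 * c + 1" unfolding c_def using D_mod by presburger

lemma nD_even: "even (D1 * D2 + n)"
proof -
  have "D1 * D2 = n\<^sup>2 + 4 * N" using DN by simp
  then show ?thesis by simp
qed

lemma nD: "D1 * D2 + n = 2 * ((D1 * D2 + n) div 2)" using nD_even by simp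

lemma omega_alpha: "\<omega> = of_int ((D1 * D2 + n) div 2) + \<alpha>"
proof -
  have "2 * \<omega> = of_int (D1 * D2 + n) + 2 * \<alpha>" unfolding doubles by simp
  also have "\<dots> = 2 * (of_int ((D1 * D2 + n) div 2) + \<alpha>)" by (subst nD) simp
  finally show ?thesis unfolding mult_cancel_left by simp
qed

lemma alpha_OK: "\<alpha> \<in> OK"
proof -
  have "\<alpha> = \<omega> - of_int ((D1 * D2 + n) div 2)" using omega_alpha by simp
  then show ?thesis using OK_closed(3)[OF omega_in_OK OK_closed(5)] by simp
qed

lemma alpha'_eq: "\<alpha>' = - \<alpha> - of_int n" by (simp add: \<alpha>_def \<alpha>'_def field_simps)

lemma alpha'_OK: "\<alpha>' \<in> OK"
  unfolding alpha'_eq by (intro OK_closed alpha_OK)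

lemma s12: "s1 * s2 = 2 * \<alpha> + of_int n" unfolding doubles by simp

lemma s12_OK: "s1 * s2 \<in> OK"
proof -
  have "s1 * s2 = \<alpha> + \<alpha> + of_int n" unfolding s12 by simp
  then show ?thesis using OK_closed(1)[OF OK_closed(1)[OF alpha_OK alpha_OK] OK_closed(5)] by simp
qed

lemma alpha_norm: "\<alpha> * \<alpha>' = - of_int N"
proof -
  have "4 * (\<alpha> * \<alpha>') = (2 * \<alpha>) * (2 * \<alpha>')" by simp
  also have "\<dots> = of_int n * of_int n - (s1 * s2) * (s1 * s2)"
    unfolding doubles by (simp add: algebra_simps)
  also have "\<dots> = of_int (n\<^sup>2 - D1 * D2)" unfolding sq12 by (simp add: power2_eq_square)
  also have "n\<^sup>2 - D1 * D2 = - (4 * N)" using DN by simp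
  finally have "4 * (\<alpha> * \<alpha>') = 4 * (- of_int N)" by simp
  then show ?thesis unfolding mult_cancel_left by simp
qed

lemma alpha_nonzero: "\<alpha> \<noteq> 0" using alpha_norm N_pos by auto

text \<open>\<alpha> is primitive: after multiplication by its conjugate \<alpha>', whose coordinate
  at \<omega> is -1, comparing coordinates at \<omega> shows that m is N times an integer.\<close>

lemma alpha_dvd_int:
  assumes "\<kappa> \<in> OK" "\<alpha> * \<kappa> = of_int m"
  shows "N dvd m"
proof -
  obtain u v where uv: "\<kappa> = of_int u + of_int v * \<omega>" using integers_K_coords[OF assms(1)] by blast
  define h where "h = (D1 * D2 + n) div 2"
  have "- of_int N * \<kappa> = \<alpha>' * (\<alpha> * \<kappa>)" unfolding alpha_norm[symmetric] by (simp add: algebra_simps)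
  also have "\<dots> = of_int m * (of_int (h - n) - \<omega>)"
    unfolding assms(2) alpha'_eq omega_alpha h_def by (simp add: algebra_simps)
  finally have "of_int (- N * u) + of_int (- N * v) * \<omega> = of_int (m * (h - n)) + of_int (- m) * \<omega>"
    unfolding uv by (simp add: algebra_simps)
  then have "- N * v = - m" by (rule K_coords_unique(2))
  then have "m = N * v" by simp
  then show ?thesis by simp
qed

lemma OL_of_OK: "x \<in> OK \<Longrightarrow> x \<in> OL" using OK_subset_OL by blast

lemma OK_of_OL: "x \<in> OL \<Longrightarrow> x \<in> K \<Longrightarrow> x \<in> OK" by (simp add: complex_integers_def)

lemma s1_OL: "s1 \<in> OL" and s2_OL: "s2 \<in> OL"
  using s_in_L algebraic_int_sqrt_int[OF sq1] algebraic_int_sqrt_int[OF sq2] by (simp_all add: complex_integers_def)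

lemma s_OL: "s \<in> OL" unfolding s_def by (intro OL_closed s1_OL s2_OL)

lemma s_square: "s * s = of_int D + 4 * of_int (x0 * y0) * \<alpha>"
proof -
  have "s * s = of_int x0 * of_int x0 * (s1 * s1) + of_int y0 * of_int y0 * (s2 * s2) + 2 * of_int (x0 * y0) * (s1 * s2)"
    by (simp add: s_def algebra_simps)
  also have "\<dots> = of_int D + 4 * of_int (x0 * y0) * \<alpha>"
    unfolding sq1 sq2 s12 D_eq by (simp add: power2_eq_square algebra_simps)
  finally show ?thesis .
qed

lemma parity: "even (1 - x0 * D1 - y0 * D2)"
proof -
  have "odd D" using D_mod by presburger
  then show ?thesis unfolding D_eq by auto
qed

lemma omegas_OL: "\<omega>1 \<in> OL" "\<omega>2 \<in> OL"
proof -
  have "\<omega>1 = of_int 0 + of_int 1 * \<omega>1 + of_int 0 * \<omega>2 + of_int 0 * (\<omega>1 * \<omega>2)"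
    "\<omega>2 = of_int 0 + of_int 0 * \<omega>1 + of_int 1 * \<omega>2 + of_int 0 * (\<omega>1 * \<omega>2)" by simp_all
  then show "\<omega>1 \<in> OL" "\<omega>2 \<in> OL" unfolding integers_L_eq basis_span_def by blast+
qed

lemma theta_OL: "\<theta> \<in> OL"
proof -
  obtain h where h: "1 - x0 * D1 - y0 * D2 = 2 * h" using parity by (elim evenE)
  have "2 * \<theta> = of_int (1 - x0 * D1 - y0 * D2) + of_int x0 * (2 * \<omega>1) + of_int y0 * (2 * \<omega>2)"
    unfolding doubles s_def by (simp add: algebra_simps)
  also have "\<dots> = 2 * (of_int h + of_int x0 * \<omega>1 + of_int y0 * \<omega>2)" unfolding h by (simp add: algebra_simps)
  finally have "\<theta> = of_int h + of_int x0 * \<omega>1 + of_int y0 * \<omega>2" unfolding mult_cancel_left by simp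
  then show ?thesis using OL_closed(1)[OF OL_closed(1)[OF OL_closed(5) OL_closed(2)[OF OL_closed(5) omegas_OL(1)]]
        OL_closed(2)[OF OL_closed(5) omegas_OL(2)]] by simp
qed

lemma theta_square: "\<theta> * \<theta> = \<theta> + of_int c + of_int (x0 * y0) * \<alpha>"
proof -
  have "4 * (\<theta> * \<theta>) = (2 * \<theta>) * (2 * \<theta>)" by simp
  also have "\<dots> = 1 + 2 * s + s * s" unfolding doubles by (simp add: algebra_simps)
  also have "\<dots> = 2 * (2 * \<theta>) + 4 * of_int c + 4 * (of_int (x0 * y0) * \<alpha>)"
    unfolding s_square doubles by (subst D_decomp) (simp add: algebra_simps)
  also have "\<dots> = 4 * (\<theta> + of_int c + of_int (x0 * y0) * \<alpha>)" by (simp add: algebra_simps)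
  finally show ?thesis unfolding mult_cancel_left by simp
qed

lemma sigma_int: "\<sigma> (of_int m) = of_int m" by (rule sigma_OK[OF OK_closed(5)])

lemma sigma_alpha: "\<sigma> \<alpha> = \<alpha>" by (rule sigma_OK[OF alpha_OK])

lemma sigma_scale: "x \<in> OK \<Longrightarrow> y \<in> OL \<Longrightarrow> \<sigma> (x * y) = x * \<sigma> y"
  using sigma_hom(2)[OF OL_of_OK] sigma_OK by simp

lemma sigma_theta: "\<sigma> \<theta> = 1 - \<theta>"
proof -
  have "\<sigma> s = - s" unfolding s_def
    using sigma_hom(1)[OF OL_closed(2)[OF OL_closed(5) s1_OL] OL_closed(2)[OF OL_closed(5) s2_OL]]
      sigma_scale[OF OK_closed(5) s1_OL] sigma_scale[OF OK_closed(5) s2_OL] sigma_s by simp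
  moreover have "s = - 1 + (\<theta> + \<theta>)" by (simp add: \<theta>_def)
  moreover have "\<sigma> (- 1 + (\<theta> + \<theta>)) = - 1 + (\<sigma> \<theta> + \<sigma> \<theta>)"
    using sigma_hom(1)[OF OL_closed(5) OL_closed(1)[OF theta_OL theta_OL], of "-1"] sigma_hom(1)[OF theta_OL theta_OL] sigma_int[of "-1"]
    by simp
  ultimately have "- 1 + (\<sigma> \<theta> + \<sigma> \<theta>) = - (- 1 + (\<theta> + \<theta>))" by metis
  then have "2 * \<sigma> \<theta> = 2 * (1 - \<theta>)" by (simp add: algebra_simps)
  then show ?thesis unfolding mult_cancel_left by simp
qed

definition "residue_form r \<longleftrightarrow> (\<exists>x y z. z \<in> OL \<and> r = of_int x + of_int y * \<theta> + \<alpha> * z)"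

lemma residue_formI: "z \<in> OL \<Longrightarrow> r = of_int x + of_int y * \<theta> + \<alpha> * z \<Longrightarrow> residue_form r"
  unfolding residue_form_def by blast

lemma residue_form_add:
  assumes "residue_form r" "residue_form r'"
  shows "residue_form (r + r')"
proof -
  obtain x y z x' y' z' where "z \<in> OL" "r = of_int x + of_int y * \<theta> + \<alpha> * z" "z' \<in> OL" "r' = of_int x' + of_int y' * \<theta> + \<alpha> * z'"
    using assms unfolding residue_form_def by blast
  then show ?thesis by (intro residue_formI[of "z + z'" _ "x + x'" "y + y'"] OL_closed) (simp_all add: algebra_simps)
qed

lemma residue_form_mult:
  assumes "residue_form r" "residue_form r'"
  shows "residue_form (r * r')"
proof -
  obtain x y z x' y' z' where *: "z \<in> OL" "r = of_int x + of_int y * \<theta> + \<alpha> * z" "z' \<in> OL" "r' = of_int x' + of_int y' * \<theta> + \<alpha> * z'"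
    using assms unfolding residue_form_def by blast
  define w where "w = of_int (y * y' * (x0 * y0)) + z * (of_int x' + of_int y' * \<theta>) + z' * (of_int x + of_int y * \<theta>) + \<alpha> * (z * z')"
  have "w \<in> OL" unfolding w_def by (intro OL_closed * theta_OL OL_of_OK alpha_OK)
  moreover have "r * r' = of_int (x * x') + of_int (x * y' + y * x') * \<theta> + of_int (y * y') * (\<theta> * \<theta>) +
      \<alpha> * (z * (of_int x' + of_int y' * \<theta>) + z' * (of_int x + of_int y * \<theta>) + \<alpha> * (z * z'))"
    unfolding * by (simp add: algebra_simps)
  then have "r * r' = of_int (x * x' + y * y' * c) + of_int (x * y' + y * x' + y * y') * \<theta> + \<alpha> * w"
    unfolding theta_square w_def by (simp add: algebra_simps)
  ultimately show ?thesis by (rule residue_formI)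
qed

lemma residue_form_int: "residue_form (of_int m)"
  by (rule residue_formI[of 0 _ m 0]) (simp_all add: OL_closed(7))

lemma residue_form_alpha: "z \<in> OL \<Longrightarrow> residue_form (\<alpha> * z)"
  by (rule residue_formI[of z _ 0 0]) simp_all

text \<open>A Bezout relation between D and N recovers \<eta> from two multiples. D \<eta> has the
  required form since D t is an integer multiple of s modulo 2 \<alpha>, and N \<eta> is a multiple
  of \<alpha> because N = - \<alpha> \<alpha>'. The equation for k serves to make D E - k
  even.\<close>

lemma residue_form_omega_aux:
  assumes k: "k\<^sup>2 + 4 * N * y\<^sup>2 = D * E" and t: "t \<in> OL" "of_int D * t = of_int k * s + 2 * (\<alpha> * z)" "z \<in> OL"
    and \<eta>: "\<eta> = (of_int E + t) / 2" "\<eta> \<in> OL"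
  shows "residue_form \<eta>"
proof -
  obtain p q where pq: "p * D + q * N = 1"
    using bezout_int[of D N] coprime_DN by (auto simp: coprime_iff_gcd_eq_1)
  have "even (D * E - k)"
  proof -
    have "D * E - k = k * (k - 1) + 4 * (N * y\<^sup>2)" using k by (simp add: power2_eq_square algebra_simps)
    then show ?thesis by simp
  qed
  then obtain h where h: "D * E - k = 2 * h" by (elim evenE)
  have "2 * (of_int D * \<eta>) = of_int (D * E) + of_int D * t" by (simp add: \<eta>(1) algebra_simps)
  also have "\<dots> = of_int (D * E - k) + of_int k * (1 + s) + 2 * (\<alpha> * z)" unfolding t(2) by (simp add: algebra_simps)
  also have "\<dots> = 2 * (of_int h + of_int k * \<theta> + \<alpha> * z)" unfolding h doubles(3)[symmetric] by (simp add: algebra_simps)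
  finally have "of_int D * \<eta> = of_int h + of_int k * \<theta> + \<alpha> * z" unfolding mult_cancel_left by simp
  then have 1: "residue_form (of_int D * \<eta>)" using t(3) by (intro residue_formI)
  have "of_int N * \<eta> = \<alpha> * (- \<alpha>' * \<eta>)" using alpha_norm by (simp add: algebra_simps)
  moreover have "- \<alpha>' * \<eta> \<in> OL" by (intro OL_closed OL_of_OK alpha'_OK \<eta>)
  ultimately have 2: "residue_form (of_int N * \<eta>)" by (simp only: residue_form_alpha)
  have "of_int p * (of_int D * \<eta>) + of_int q * (of_int N * \<eta>) = of_int (p * D + q * N) * \<eta>"
    by (simp add: algebra_simps)
  also have "\<dots> = \<eta>" unfolding pq by simp
  finally show ?thesis
    using residue_form_add[OF residue_form_mult[OF residue_form_int[of p] 1] residue_form_mult[OF residue_form_int[of q] 2]]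
    by (simp only:)
qed

lemma residue_form_omega: "residue_form \<omega>1" "residue_form \<omega>2"
proof -
  have DD: "D1 * D2 = n\<^sup>2 + 4 * N" using DN by simp
  show "residue_form \<omega>1"
  proof (rule residue_form_omega_aux)
    show "(x0 * D1 + y0 * n)\<^sup>2 + 4 * N * y0\<^sup>2 = D * D1"
    proof -
      have "(x0 * D1 + y0 * n)\<^sup>2 + 4 * N * y0\<^sup>2 = x0\<^sup>2 * D1\<^sup>2 + 2 * x0 * y0 * n * D1 + y0\<^sup>2 * (n\<^sup>2 + 4 * N)"
        by (simp add: power2_eq_square algebra_simps)
      then show ?thesis unfolding DD[symmetric] D_eq by (simp add: power2_eq_square algebra_simps)
    qed
    have "s1 * s = of_int x0 * (s1 * s1) + of_int y0 * (s1 * s2)" by (simp add: s_def algebra_simps)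
    also have "\<dots> = of_int (x0 * D1 + y0 * n) + 2 * of_int y0 * \<alpha>" unfolding sq1 s12 by (simp add: algebra_simps)
    finally have s1s: "s1 * s = of_int (x0 * D1 + y0 * n) + 2 * of_int y0 * \<alpha>" .
    have "s1 * (s * s) = (s1 * s) * s" by (simp add: algebra_simps)
    then have "s1 * (of_int D + 4 * of_int (x0 * y0) * \<alpha>) = (of_int (x0 * D1 + y0 * n) + 2 * of_int y0 * \<alpha>) * s"
      unfolding s_square s1s .
    then show "of_int D * s1 = of_int (x0 * D1 + y0 * n) * s + 2 * (\<alpha> * (of_int y0 * s - of_int (2 * x0 * y0) * s1))"
      by (simp add: algebra_simps)
    show "of_int y0 * s - of_int (2 * x0 * y0) * s1 \<in> OL" by (intro OL_closed s_OL s1_OL)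
  qed (rule s1_OL \<omega>1_def omegas_OL)+
  show "residue_form \<omega>2"
  proof (rule residue_form_omega_aux)
    show "(y0 * D2 + x0 * n)\<^sup>2 + 4 * N * x0\<^sup>2 = D * D2"
    proof -
      have "(y0 * D2 + x0 * n)\<^sup>2 + 4 * N * x0\<^sup>2 = y0\<^sup>2 * D2\<^sup>2 + 2 * x0 * y0 * n * D2 + x0\<^sup>2 * (n\<^sup>2 + 4 * N)"
        by (simp add: power2_eq_square algebra_simps)
      then show ?thesis unfolding DD[symmetric] D_eq by (simp add: power2_eq_square algebra_simps)
    qed
    have "s2 * s = of_int y0 * (s2 * s2) + of_int x0 * (s1 * s2)" by (simp add: s_def algebra_simps)
    also have "\<dots> = of_int (y0 * D2 + x0 * n) + 2 * of_int x0 * \<alpha>" unfolding sq2 s12 by (simp add: algebra_simps)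
    finally have s2s: "s2 * s = of_int (y0 * D2 + x0 * n) + 2 * of_int x0 * \<alpha>" .
    have "s2 * (s * s) = (s2 * s) * s" by (simp add: algebra_simps)
    then have "s2 * (of_int D + 4 * of_int (x0 * y0) * \<alpha>) = (of_int (y0 * D2 + x0 * n) + 2 * of_int x0 * \<alpha>) * s"
      unfolding s_square s2s .
    then show "of_int D * s2 = of_int (y0 * D2 + x0 * n) * s + 2 * (\<alpha> * (of_int x0 * s - of_int (2 * x0 * y0) * s2))"
      by (simp add: algebra_simps)
    show "of_int x0 * s - of_int (2 * x0 * y0) * s2 \<in> OL" by (intro OL_closed s_OL s2_OL)
  qed (rule s2_OL \<omega>2_def omegas_OL)+
qed

lemma OL_residue_form:
  assumes "r \<in> OL"
  obtains x y z where "z \<in> OL" "r = of_int x + of_int y * \<theta> + \<alpha> * z"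
proof -
  obtain a b c d where r: "r = of_int a + of_int b * \<omega>1 + of_int c * \<omega>2 + of_int d * (\<omega>1 * \<omega>2)"
    using assms unfolding integers_L_eq basis_span_def by blast
  have "residue_form r" unfolding r
    by (intro residue_form_add residue_form_mult residue_form_int residue_form_omega)
  then show ?thesis using that unfolding residue_form_def by blast
qed

text \<open>Subtracting the conjugate equation leaves y s as a multiple of \<alpha>. Multiplying by
  s replaces s^2 by D modulo \<alpha>, so y D is a multiple of \<alpha>, and N divides y because D
  is prime to N. Then y \<theta> is itself a multiple of \<alpha>, and x remains.\<close>

lemma residue_form_unique:
  assumes "of_int x + of_int y * \<theta> = \<alpha> * z" "z \<in> OL"
  shows "N dvd x" "N dvd y"
proof -
  have sz: "\<sigma> z \<in> OL" by (rule sigma_OL[OF assms(2)])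
  have "\<sigma> (of_int x + of_int y * \<theta>) = of_int x + of_int y * (1 - \<theta>)"
    using sigma_hom(1)[OF OL_closed(5) OL_closed(2)[OF OL_closed(5) theta_OL]] sigma_scale[OF OK_closed(5) theta_OL]
    by (simp add: sigma_int sigma_theta)
  then have conj: "of_int x + of_int y * (1 - \<theta>) = \<alpha> * \<sigma> z"
    unfolding assms(1) using sigma_scale[OF alpha_OK assms(2)] by simp
  have "of_int y * s = (of_int x + of_int y * \<theta>) - (of_int x + of_int y * (1 - \<theta>))"
    by (simp add: \<theta>_def field_simps)
  also have "\<dots> = \<alpha> * (z - \<sigma> z)" unfolding assms(1) conj by (simp add: algebra_simps)
  finally have ys: "of_int y * s = \<alpha> * (z - \<sigma> z)" .
  have "of_int y * (s * s) = \<alpha> * (z - \<sigma> z) * s" unfolding ys[symmetric] by (simp add: algebra_simps)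
  then have yD: "\<alpha> * (s * (z - \<sigma> z) - of_int (4 * x0 * y0 * y)) = of_int (y * D)"
    unfolding s_square by (simp add: algebra_simps)
  have "s * (z - \<sigma> z) - of_int (4 * x0 * y0 * y) \<in> OL" by (intro OL_closed s_OL assms sz)
  \<comment> \<open>A quotient of an integer by \<alpha> lies in K; this carries divisibility in the
    integers of L down to those of K, where \<open>alpha_dvd_int\<close> applies.\<close>
  moreover have K_quot: "\<kappa> \<in> K" if "\<alpha> * \<kappa> = of_int m" for \<kappa> m
  proof -
    have "\<kappa> = of_int m / \<alpha>" using that alpha_nonzero by (simp add: field_simps)
    moreover have "\<alpha> \<in> K" using alpha_OK by (simp add: complex_integers_def)
    ultimately show ?thesis using complex_subfieldD(8)[OF subfield_K complex_subfieldD(9)[OF subfield_K]] by simp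
  qed
  ultimately have "s * (z - \<sigma> z) - of_int (4 * x0 * y0 * y) \<in> OK" using yD OK_of_OL by blast
  then have "N dvd y * D" using yD by (rule alpha_dvd_int)
  then show y: "N dvd y" using coprime_DN by (simp add: coprime_commute coprime_dvd_mult_left_iff)
  then obtain y' where y': "y = N * y'" by (elim dvdE)
  have "of_int x = \<alpha> * z - of_int y' * (of_int N) * \<theta>" using assms(1) unfolding y' by (simp add: algebra_simps)
  also have "(of_int N :: complex) = - (\<alpha> * \<alpha>')" unfolding alpha_norm by simp
  finally have x: "\<alpha> * (z + of_int y' * \<alpha>' * \<theta>) = of_int x" by (simp add: algebra_simps)
  have "z + of_int y' * \<alpha>' * \<theta> \<in> OL" by (intro OL_closed assms theta_OL OL_of_OK alpha'_OK)
  then have "z + of_int y' * \<alpha>' * \<theta> \<in> OK" using K_quot[OF x] OK_of_OL by blast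
  then show "N dvd x" using x by (rule alpha_dvd_int)
qed

end

context biquadratic_value
begin

section \<open>Hermite normal form of the ideals containing \<alpha>\<close>

definition hnf_ideal :: "int \<Rightarrow> int \<Rightarrow> int \<Rightarrow> complex set" where
  "hnf_ideal e M k = {of_int (i * (e * M)) + of_int (j * e) * (of_int k + \<theta>) + \<alpha> * z | i j z. z \<in> OL}"

lemma hnf_idealI:
  "z \<in> OL \<Longrightarrow> a = of_int (i * (e * M)) + of_int (j * e) * (of_int k + \<theta>) + \<alpha> * z \<Longrightarrow> a \<in> hnf_ideal e M k"
  unfolding hnf_ideal_def by blast

lemma hnf_idealE:
  assumes "a \<in> hnf_ideal e M k"
  obtains i j z where "z \<in> OL" "a = of_int (i * (e * M)) + of_int (j * e) * (of_int k + \<theta>) + \<alpha> * z"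
  using assms unfolding hnf_ideal_def by blast

lemma hnf_ideal_generators:
  "of_int (e * M) \<in> hnf_ideal e M k" "of_int e * (of_int k + \<theta>) \<in> hnf_ideal e M k" "z \<in> OL \<Longrightarrow> \<alpha> * z \<in> hnf_ideal e M k"
  by (rule hnf_idealI[of 0 _ 1 _ _ 0] hnf_idealI[of 0 _ 0 _ _ 1] hnf_idealI[of z _ 0 _ _ 0]; simp add: OL_closed(7))+

lemma hnf_ideal_add:
  assumes "a \<in> hnf_ideal e M k" "b \<in> hnf_ideal e M k"
  shows "a + b \<in> hnf_ideal e M k"
proof -
  obtain i j z i' j' z' where "z \<in> OL" "a = of_int (i * (e * M)) + of_int (j * e) * (of_int k + \<theta>) + \<alpha> * z"
    "z' \<in> OL" "b = of_int (i' * (e * M)) + of_int (j' * e) * (of_int k + \<theta>) + \<alpha> * z'"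
    using assms by (elim hnf_idealE)
  then show ?thesis by (intro hnf_idealI[of "z + z'" _ "i + i'" _ _ "j + j'"] OL_closed) (simp_all add: algebra_simps)
qed

lemma hnf_ideal_mult_int:
  assumes "a \<in> hnf_ideal e M k"
  shows "of_int m * a \<in> hnf_ideal e M k"
proof -
  obtain i j z where "z \<in> OL" "a = of_int (i * (e * M)) + of_int (j * e) * (of_int k + \<theta>) + \<alpha> * z"
    using assms by (elim hnf_idealE)
  then show ?thesis by (intro hnf_idealI[of "of_int m * z" _ "m * i" _ _ "m * j"] OL_closed) (simp_all add: algebra_simps)
qed

text \<open>Modulo \<alpha>, \<theta> (k + \<theta>) = (k + 1) (k + \<theta>) - (k^2 + k - c); so
  stability under \<theta> is governed by the divisibility assumption.\<close>

lemma hnf_ideal_mult_theta: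
  assumes "a \<in> hnf_ideal e M k" "M dvd k\<^sup>2 + k - c"
  shows "\<theta> * a \<in> hnf_ideal e M k"
proof -
  obtain i j z where a: "z \<in> OL" "a = of_int (i * (e * M)) + of_int (j * e) * (of_int k + \<theta>) + \<alpha> * z"
    using assms(1) by (elim hnf_idealE)
  obtain t where t: "k\<^sup>2 + k - c = M * t" using assms(2) by (elim dvdE)
  have ct: "c = k * k + k - M * t" using t by (simp add: power2_eq_square algebra_simps)
  have "\<theta> * a = of_int (i * (e * M)) * \<theta> + of_int (j * e) * (of_int k * \<theta> + \<theta> * \<theta>) + \<alpha> * (\<theta> * z)"
    unfolding a(2) by (simp add: algebra_simps)
  also have "\<dots> = of_int ((- i * k - j * t) * (e * M)) + of_int ((i * M + j * (k + 1)) * e) * (of_int k + \<theta>) +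
      \<alpha> * (of_int (j * e * (x0 * y0)) + \<theta> * z)"
    unfolding theta_square ct by (simp add: algebra_simps)
  finally show ?thesis
    by (rule hnf_idealI[rotated]) (intro OL_closed theta_OL a(1))
qed

lemma hnf_ideal_ideal:
  assumes "M dvd k\<^sup>2 + k - c"
  shows "ideal (hnf_ideal e M k) (integers_ring L)"
  unfolding ideal_integers_ring_iff[OF subfield_L]
proof (intro conjI ballI)
  show sub: "hnf_ideal e M k \<subseteq> OL"
  proof
    fix a assume "a \<in> hnf_ideal e M k"
    then obtain i j z where a: "z \<in> OL" "a = of_int (i * (e * M)) + of_int (j * e) * (of_int k + \<theta>) + \<alpha> * z"
      by (elim hnf_idealE)
    show "a \<in> OL" unfolding a(2) by (intro OL_closed theta_OL OL_of_OK alpha_OK a(1))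
  qed
  show "0 \<in> hnf_ideal e M k" using hnf_ideal_mult_int[OF hnf_ideal_generators(1), of 0] by simp
  show "a + b \<in> hnf_ideal e M k" if "a \<in> hnf_ideal e M k" "b \<in> hnf_ideal e M k" for a b
    by (rule hnf_ideal_add[OF that])
  fix a r assume a: "a \<in> hnf_ideal e M k" and r: "r \<in> OL"
  obtain x y z where z: "z \<in> OL" "r = of_int x + of_int y * \<theta> + \<alpha> * z" using OL_residue_form[OF r] .
  have "r * a = (of_int x * a + of_int y * (\<theta> * a)) + \<alpha> * (z * a)" unfolding z(2) by (simp add: algebra_simps)
  moreover have "z * a \<in> OL" using OL_closed(2)[OF z(1)] sub a by blast
  ultimately show "r * a \<in> hnf_ideal e M k"
    using hnf_ideal_add[OF hnf_ideal_add[OF hnf_ideal_mult_int[OF a] hnf_ideal_mult_int[OF hnf_ideal_mult_theta[OF a assms]]]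
        hnf_ideal_generators(3)] by simp
qed

text \<open>Coordinates with respect to 1 and \<theta> are determined only modulo N. As N is a
  multiple of e M, both N and N \<theta> belong to the lattice of the first two generators, which
  absorbs the ambiguity.\<close>

lemma mem_hnf_ideal_iff:
  assumes "e * M dvd N"
  shows "of_int x + of_int y * \<theta> \<in> hnf_ideal e M k \<longleftrightarrow> (\<exists>i j. x = i * (e * M) + j * e * k \<and> y = j * e)"
proof
  assume "of_int x + of_int y * \<theta> \<in> hnf_ideal e M k"
  then obtain i j z where z: "z \<in> OL" "of_int x + of_int y * \<theta> = of_int (i * (e * M)) + of_int (j * e) * (of_int k + \<theta>) + \<alpha> * z"
    by (elim hnf_idealE)
  then have "of_int (x - i * (e * M) - j * e * k) + of_int (y - j * e) * \<theta> = \<alpha> * z" by (simp add: algebra_simps)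
  from residue_form_unique[OF this z(1)] obtain p q where
    pq: "x - i * (e * M) - j * e * k = N * p" "y - j * e = N * q" by (elim dvdE)
  obtain r where r: "N = e * M * r" using assms by (elim dvdE)
  have "x = (i + r * p - r * q * k) * (e * M) + (j + M * r * q) * e * k" "y = (j + M * r * q) * e"
    using pq unfolding r by (simp_all add: algebra_simps)
  then show "\<exists>i j. x = i * (e * M) + j * e * k \<and> y = j * e" by blast
next
  assume "\<exists>i j. x = i * (e * M) + j * e * k \<and> y = j * e"
  then obtain i j where "x = i * (e * M) + j * e * k" "y = j * e" by blast
  then show "of_int x + of_int y * \<theta> \<in> hnf_ideal e M k"
    by (intro hnf_idealI[of 0 _ i _ _ j]) (simp_all add: OL_closed(7) algebra_simps)
qed

lemma alpha_alpha'_N: "of_int N = \<alpha> * (- \<alpha>')" using alpha_norm by simp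

text \<open>e generates the group Y of \<theta>-coordinates occurring in A, and a = e M the group X
  of integers in A. Stability under \<theta> gives that e divides a and the integer part of an
  element with coordinate e, so that this element is e (k1 + \<theta>), and k1 matters modulo
  M.\<close>

lemma ideal_is_hnf:
  assumes "ideal A (integers_ring L)" "\<alpha> \<in> A"
  shows "\<exists>e M k. e > 0 \<and> M > 0 \<and> 0 \<le> k \<and> k < M \<and> e * M dvd N \<and> M dvd k\<^sup>2 + k - c \<and> A = hnf_ideal e M k"
proof -
  have A: "A \<subseteq> OL" "0 \<in> A" and add: "\<And>x y. x \<in> A \<Longrightarrow> y \<in> A \<Longrightarrow> x + y \<in> A"
    and mult: "\<And>x r. x \<in> A \<Longrightarrow> r \<in> OL \<Longrightarrow> r * x \<in> A"
    using assms(1) unfolding ideal_integers_ring_iff[OF subfield_L] by blast+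
  have int_mult: "of_int m * x \<in> A" if "x \<in> A" for m x using mult[OF that OL_closed(5)] .
  have diff: "x - y \<in> A" if "x \<in> A" "y \<in> A" for x y
    using add[OF that(1) int_mult[OF that(2), of "-1"]] by simp
  have alpha_mult: "\<alpha> * z \<in> A" if "z \<in> OL" for z using mult[OF assms(2) that] by (simp add: mult.commute)
  have N_in: "of_int N \<in> A" unfolding alpha_alpha'_N by (intro alpha_mult OL_closed OL_of_OK alpha'_OK)
  define Y where "Y = {y. \<exists>x. of_int x + of_int y * \<theta> \<in> A}"
  have "N \<in> Y" using mult[OF N_in theta_OL] unfolding Y_def by (auto intro!: exI[of _ 0] simp: mult.commute)
  have Y_diff: "x - y \<in> Y" if xy: "x \<in> Y" "y \<in> Y" for x y
  proof -
    obtain p q where "of_int p + of_int x * \<theta> \<in> A" "of_int q + of_int y * \<theta> \<in> A" using xy unfolding Y_def by blast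
    then have "(of_int p + of_int x * \<theta>) - (of_int q + of_int y * \<theta>) \<in> A" by (rule diff)
    then have "of_int (p - q) + of_int (x - y) * \<theta> \<in> A" by (simp add: algebra_simps)
    then show ?thesis unfolding Y_def by blast
  qed
  obtain e where e: "e > 0" "\<And>y. y \<in> Y \<longleftrightarrow> e dvd y" using int_subgroup_generator[of Y, OF Y_diff \<open>N \<in> Y\<close> N_pos] by blast
  define X where "X = {x. of_int x \<in> A}"
  have X_diff: "x - y \<in> X" if "x \<in> X" "y \<in> X" for x y using diff that unfolding X_def by fastforce
  have "N \<in> X" using N_in unfolding X_def by simp
  obtain a where a: "a > 0" "\<And>x. x \<in> X \<longleftrightarrow> a dvd x" using int_subgroup_generator[of X, OF X_diff \<open>N \<in> X\<close> N_pos] by blast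
  have "of_int a \<in> A" using a(2)[of a] unfolding X_def by simp
  then have "of_int 0 + of_int a * \<theta> \<in> A" using mult[OF _ theta_OL, of "of_int a"] by (simp add: mult.commute)
  then have "e dvd a" using e(2) unfolding Y_def by blast
  then obtain M where M: "a = e * M" by (elim dvdE)
  have M_pos: "M > 0" using a(1) e(1) M by (simp add: zero_less_mult_iff)
  obtain x1 where x1: "of_int x1 + of_int e * \<theta> \<in> A" using e(2)[of e] unfolding Y_def by auto
  \<comment> \<open>Multiplication by \<theta> moves x1 + e into the \<theta>-coordinate, so e
    divides x1.\<close>
  have "\<theta> * (of_int x1 + of_int e * \<theta>) - \<alpha> * of_int (e * (x0 * y0)) \<in> A"
    by (intro diff mult x1 theta_OL alpha_mult OL_closed)
  also have "\<theta> * (of_int x1 + of_int e * \<theta>) = of_int x1 * \<theta> + of_int e * (\<theta> * \<theta>)" by (simp add: algebra_simps)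
  also have "of_int x1 * \<theta> + of_int e * (\<theta> * \<theta>) - \<alpha> * of_int (e * (x0 * y0)) = of_int (e * c) + of_int (x1 + e) * \<theta>"
    unfolding theta_square by (simp add: algebra_simps)
  finally have "e dvd x1 + e" using e(2) unfolding Y_def by blast
  then have "e dvd x1" by (simp add: dvd_add_left_iff)
  then obtain k1 where k1: "x1 = e * k1" by (elim dvdE)
  define k where "k = k1 mod M"
  have k: "0 \<le> k" "k < M" using M_pos by (simp_all add: k_def)
  obtain m where m: "k1 = k + m * M" unfolding k_def by (metis mod_div_mult_eq)
  have ek: "of_int e * (of_int k + \<theta>) \<in> A"
  proof -
    have "(of_int x1 + of_int e * \<theta>) - of_int m * of_int a \<in> A" by (intro diff int_mult x1 \<open>of_int a \<in> A\<close>)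
    also have "(of_int x1 + of_int e * \<theta>) - of_int m * of_int a = of_int e * (of_int k + \<theta>)"
      unfolding k1 m M by (simp add: algebra_simps)
    finally show ?thesis .
  qed
  \<comment> \<open>k + 1 - \<theta> is the conjugate of k + \<theta>; the product is an integer up
    to a multiple of \<alpha>, and it yields the congruence for k.\<close>
  have "(of_int (k + 1) - \<theta>) * (of_int e * (of_int k + \<theta>)) + \<alpha> * of_int (e * (x0 * y0)) \<in> A"
    by (intro add mult ek alpha_mult OL_closed theta_OL)
  also have "(of_int (k + 1) - \<theta>) * (of_int e * (of_int k + \<theta>)) = of_int (e * (k\<^sup>2 + k)) + of_int e * \<theta> - of_int e * (\<theta> * \<theta>)"
    by (simp add: algebra_simps power2_eq_square)
  also have "of_int (e * (k\<^sup>2 + k)) + of_int e * \<theta> - of_int e * (\<theta> * \<theta>) + \<alpha> * of_int (e * (x0 * y0)) = of_int (e * (k\<^sup>2 + k - c))"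
    unfolding theta_square by (simp add: algebra_simps)
  finally have "a dvd e * (k\<^sup>2 + k - c)" using a(2) unfolding X_def by blast
  then have Mk: "M dvd k\<^sup>2 + k - c" using e(1) unfolding M by simp
  have "e * M dvd N" using a(2) \<open>N \<in> X\<close> M by blast
  moreover have "A = hnf_ideal e M k"
  proof (intro equalityI subsetI)
    fix r assume r: "r \<in> A"
    then have "r \<in> OL" using A(1) by blast
    then obtain x y z where z: "z \<in> OL" "r = of_int x + of_int y * \<theta> + \<alpha> * z" by (rule OL_residue_form)
    have xy: "of_int x + of_int y * \<theta> \<in> A" using diff[OF r alpha_mult[OF z(1)]] unfolding z(2) by simp
    then have "e dvd y" using e(2) unfolding Y_def by blast
    then obtain j where j: "y = e * j" by (elim dvdE)
    have "(of_int x + of_int y * \<theta>) - of_int j * (of_int e * (of_int k + \<theta>)) \<in> A" by (intro diff xy int_mult ek)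
    also have "(of_int x + of_int y * \<theta>) - of_int j * (of_int e * (of_int k + \<theta>)) = of_int (x - j * e * k)"
      unfolding j by (simp add: algebra_simps)
    finally have "a dvd x - j * e * k" using a(2) unfolding X_def by blast
    then obtain i where i: "x - j * e * k = a * i" by (elim dvdE)
    have x: "x = i * (e * M) + j * e * k" using i unfolding M by (simp add: algebra_simps)
    show "r \<in> hnf_ideal e M k" unfolding z(2) x j
      by (rule hnf_idealI[OF z(1), of _ i _ _ j]) (simp add: algebra_simps)
  next
    fix r assume "r \<in> hnf_ideal e M k"
    then obtain i j z where z: "z \<in> OL" "r = of_int (i * (e * M)) + of_int (j * e) * (of_int k + \<theta>) + \<alpha> * z"
      by (elim hnf_idealE)
    have "of_int i * of_int a + of_int j * (of_int e * (of_int k + \<theta>)) + \<alpha> * z \<in> A"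
      by (intro add int_mult ek alpha_mult z \<open>of_int a \<in> A\<close>)
    also have "of_int i * of_int a + of_int j * (of_int e * (of_int k + \<theta>)) + \<alpha> * z = r"
      unfolding z(2) M by (simp add: algebra_simps)
    finally show "r \<in> A" .
  qed
  ultimately show ?thesis using e(1) M_pos k Mk by blast
qed

text \<open>(2k + 1)^2 - 4 (k^2 + k - c) = D, so a common prime of M and 2k + 1 would divide both D
  and N.\<close>

lemma hnf_coprime:
  assumes "M dvd N" "M dvd k\<^sup>2 + k - c"
  shows "coprime M (2 * k + 1)"
proof (rule coprime_intI_prime)
  fix p assume p: "prime p" "p dvd M" "p dvd 2 * k + 1"
  have "p dvd (2 * k + 1) * (2 * k + 1) - 4 * (k\<^sup>2 + k - c)"
    by (rule dvd_diff[OF dvd_mult[OF p(3)] dvd_mult[OF dvd_trans[OF p(2) assms(2)]]])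
  also have "\<dots> = D" by (subst D_decomp) (simp add: power2_eq_square algebra_simps)
  finally have "p dvd D" .
  moreover have "p dvd N" using p assms dvd_trans by blast
  ultimately show False using coprime_DN p(1) by (meson coprime_common_divisor not_prime_unit)
qed

section \<open>Relative norms of the ideals\<close>

definition relnorm :: "complex \<Rightarrow> complex" where "relnorm x = x * \<sigma> x"

lemma relnorm_add:
  assumes "x \<in> OL" "y \<in> OL"
  shows "relnorm (x + y) = relnorm x + relnorm y + (x * \<sigma> y + \<sigma> x * y)"
  unfolding relnorm_def sigma_hom(1)[OF assms] by (simp add: algebra_simps)

lemma cross_OK:
  assumes "x \<in> OL" "y \<in> OL"
  shows "x * \<sigma> y + \<sigma> x * y \<in> OK"
proof -
  have "relnorm (x + y) - relnorm x - relnorm y \<in> OK"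
    unfolding relnorm_def by (intro OK_closed trace_norm_OK OL_closed assms)
  then show ?thesis unfolding relnorm_add[OF assms] by simp
qed

lemma sigma_k_theta: "\<sigma> (of_int k + \<theta>) = of_int k + 1 - \<theta>"
  using sigma_hom(1)[OF OL_closed(5) theta_OL] by (simp add: sigma_int sigma_theta)

text \<open>Up to a multiple of \<alpha>, the norm on the lattice spanned by M and k + \<theta> is M
  times the binary form [M, 2k + 1, t], which has discriminant D. The \<alpha>-term comes from the
  relation for the square of \<theta>.\<close>

lemma relnorm_generator:
  assumes "k\<^sup>2 + k - c = M * t"
  shows "relnorm (of_int i * of_int M + of_int j * (of_int k + \<theta>)) =
     of_int (M * (i\<^sup>2 * M + i * j * (2 * k + 1) + j\<^sup>2 * t)) - of_int (j\<^sup>2 * (x0 * y0)) * \<alpha>"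
proof -
  have ct: "c = k * k + k - M * t" using assms by (simp add: power2_eq_square algebra_simps)
  have kt: "of_int k + \<theta> \<in> OL" by (intro OL_closed theta_OL)
  have jk: "of_int j * (of_int k + \<theta>) \<in> OL" "of_int (i * M) \<in> OL" by (intro OL_closed kt)+
  have \<sigma>: "\<sigma> (of_int (i * M) + of_int j * (of_int k + \<theta>)) = of_int (i * M) + of_int j * (of_int k + 1 - \<theta>)"
    unfolding sigma_hom(1)[OF jk(2,1)] sigma_int sigma_scale[OF OK_closed(5) kt] sigma_k_theta ..
  have "relnorm (of_int i * of_int M + of_int j * (of_int k + \<theta>)) =
      (of_int (i * M) + of_int j * (of_int k + \<theta>)) * (of_int (i * M) + of_int j * (of_int k + 1 - \<theta>))"
    unfolding relnorm_def \<sigma>[symmetric] by simp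
  also have "\<dots> = of_int (i * M) * of_int (i * M) + of_int (i * M * j * (2 * k + 1)) + of_int (j * j) * (of_int (k * k + k) + \<theta> - \<theta> * \<theta>)"
    by (simp add: algebra_simps)
  also have "\<dots> = of_int (M * (i\<^sup>2 * M + i * j * (2 * k + 1) + j\<^sup>2 * t)) - of_int (j\<^sup>2 * (x0 * y0)) * \<alpha>"
    unfolding theta_square ct by (simp add: algebra_simps power2_eq_square)
  finally show ?thesis .
qed

lemma relnorm_scale: "x \<in> OK \<Longrightarrow> y \<in> OL \<Longrightarrow> relnorm (x * y) = x * x * relnorm y"
  unfolding relnorm_def by (simp add: sigma_scale algebra_simps)

text \<open>If \<open>e\<^sup>2 M = N k'\<close>, all relative norms lie in \<open>\<alpha> (k', \<alpha>)\<close>; for \<open>k' > 1\<close> this is smaller than \<open>(\<alpha>)\<close>.\<close>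

lemma relnorm_hnf_ideal:
  assumes "a \<in> hnf_ideal e M k" "M dvd k\<^sup>2 + k - c" "e\<^sup>2 * M = N * k'" "k' dvd e"
  shows "\<exists>u v. u \<in> OK \<and> v \<in> OK \<and> relnorm a = \<alpha> * (of_int k' * u + \<alpha> * v)"
proof -
  obtain i j r where r: "r \<in> OL" "a = of_int (i * (e * M)) + of_int (j * e) * (of_int k + \<theta>) + \<alpha> * r"
    using assms(1) by (elim hnf_idealE)
  obtain t where t: "k\<^sup>2 + k - c = M * t" using assms(2) by (elim dvdE)
  obtain e' where e': "e = k' * e'" using assms(4) by (elim dvdE)
  define w where "w = of_int i * of_int M + of_int j * (of_int k + \<theta>)"
  have w: "w \<in> OL" unfolding w_def by (intro OL_closed theta_OL)
  have ew: "of_int e * w \<in> OL" "\<alpha> * r \<in> OL" by (intro OL_closed w r OL_of_OK alpha_OK)+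
  have a: "a = of_int e * w + \<alpha> * r" unfolding r(2) w_def by (simp add: algebra_simps)
  define Q where "Q = i\<^sup>2 * M + i * j * (2 * k + 1) + j\<^sup>2 * t"
  have "relnorm a = of_int e * of_int e * relnorm w + \<alpha> * \<alpha> * relnorm r +
      ((of_int e * w) * \<sigma> (\<alpha> * r) + \<sigma> (of_int e * w) * (\<alpha> * r))"
    unfolding a relnorm_add[OF ew] relnorm_scale[OF OK_closed(5) w] relnorm_scale[OF alpha_OK r(1)] ..
  also have "(of_int e * w) * \<sigma> (\<alpha> * r) + \<sigma> (of_int e * w) * (\<alpha> * r) = \<alpha> * of_int e * (w * \<sigma> r + \<sigma> w * r)"
    unfolding sigma_scale[OF alpha_OK r(1)] sigma_scale[OF OK_closed(5) w] by (simp add: algebra_simps)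
  also have "relnorm w = of_int (M * Q) - of_int (j\<^sup>2 * (x0 * y0)) * \<alpha>"
    unfolding w_def Q_def by (rule relnorm_generator[OF t])
  also have "of_int e * of_int e * (of_int (M * Q) - of_int (j\<^sup>2 * (x0 * y0)) * \<alpha>) =
      of_int ((e\<^sup>2 * M) * Q) - \<alpha> * of_int (e * e * (j\<^sup>2 * (x0 * y0)))"
    by (simp add: algebra_simps power2_eq_square)
  also have "(of_int ((e\<^sup>2 * M) * Q) :: complex) = of_int N * of_int (k' * Q)" unfolding assms(3) by simp
  also have "of_int N * of_int (k' * Q) - \<alpha> * of_int (e * e * (j\<^sup>2 * (x0 * y0))) + \<alpha> * \<alpha> * relnorm r + \<alpha> * of_int e * (w * \<sigma> r + \<sigma> w * r)
      = \<alpha> * (of_int k' * (- \<alpha>' * of_int Q - of_int (e' * e * (j\<^sup>2 * (x0 * y0))) + of_int e' * (w * \<sigma> r + \<sigma> w * r)) + \<alpha> * relnorm r)"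
    unfolding alpha_alpha'_N by (subst (1 2) e') (simp add: algebra_simps)
  finally have eq: "relnorm a = \<alpha> * (of_int k' * (- \<alpha>' * of_int Q - of_int (e' * e * (j\<^sup>2 * (x0 * y0))) + of_int e' * (w * \<sigma> r + \<sigma> w * r)) + \<alpha> * relnorm r)" .
  have "relnorm r \<in> OK" unfolding relnorm_def by (rule trace_norm_OK(2)[OF r(1)])
  moreover have "- \<alpha>' * of_int Q - of_int (e' * e * (j\<^sup>2 * (x0 * y0))) + of_int e' * (w * \<sigma> r + \<sigma> w * r) \<in> OK"
    by (intro OK_closed alpha'_OK cross_OK w r)
  ultimately show ?thesis using eq by blast
qed

end

context biquadratic_value
begin

lemma genideal_facts:
  assumes "S \<subseteq> OK"
  shows "ideal (Idl\<^bsub>integers_ring K\<^esub> S) (integers_ring K)" "S \<subseteq> Idl\<^bsub>integers_ring K\<^esub> S"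
    "ideal J (integers_ring K) \<Longrightarrow> S \<subseteq> J \<Longrightarrow> Idl\<^bsub>integers_ring K\<^esub> S \<subseteq> J"
proof -
  interpret R: cring "integers_ring K" by (rule ring_integers_ring[OF subfield_K])
  have S: "S \<subseteq> carrier (integers_ring K)" using assms by (simp add: complex_integers_def)
  show "ideal (Idl\<^bsub>integers_ring K\<^esub> S) (integers_ring K)" by (rule R.genideal_ideal[OF S])
  show "S \<subseteq> Idl\<^bsub>integers_ring K\<^esub> S" by (rule R.genideal_self[OF S])
  show "ideal J (integers_ring K) \<Longrightarrow> S \<subseteq> J \<Longrightarrow> Idl\<^bsub>integers_ring K\<^esub> S \<subseteq> J" by (rule R.genideal_minimal)
qed

definition "norm_ideal A = rel_ideal_norm K L A"
definition "alpha_ideal = {x * \<alpha> | x. x \<in> OK}"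

lemma norm_ideal_eq:
  assumes "A \<subseteq> OL"
  shows "norm_ideal A = Idl\<^bsub>integers_ring K\<^esub> (relnorm ` A)" "relnorm ` A \<subseteq> OK"
proof -
  have "rel_norm K L ` A = relnorm ` A"
    using assms rel_norm_KL unfolding relnorm_def by (intro image_cong) auto
  then show "norm_ideal A = Idl\<^bsub>integers_ring K\<^esub> (relnorm ` A)" unfolding norm_ideal_def rel_ideal_norm_def by simp
  show "relnorm ` A \<subseteq> OK" using assms trace_norm_OK(2) unfolding relnorm_def by blast
qed

lemma alpha_multiples_ideal:
  assumes "ideal J (integers_ring K)"
  shows "ideal {\<alpha> * x | x. x \<in> J} (integers_ring K)"
proof -
  have J: "J \<subseteq> OK" "0 \<in> J" "\<And>x y. x \<in> J \<Longrightarrow> y \<in> J \<Longrightarrow> x + y \<in> J" "\<And>x r. x \<in> J \<Longrightarrow> r \<in> OK \<Longrightarrow> r * x \<in> J"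
    using assms unfolding ideal_integers_ring_iff[OF subfield_K] by blast+
  show ?thesis
    unfolding ideal_integers_ring_iff[OF subfield_K]
  proof (intro conjI ballI)
    show "{\<alpha> * x | x. x \<in> J} \<subseteq> OK" using OK_closed(2)[OF alpha_OK] J(1) by blast
    show "0 \<in> {\<alpha> * x | x. x \<in> J}" using J(2) by force
    fix x assume "x \<in> {\<alpha> * x | x. x \<in> J}"
    then obtain a where a: "x = \<alpha> * a" "a \<in> J" by blast
    show "x + y \<in> {\<alpha> * x | x. x \<in> J}" if y: "y \<in> {\<alpha> * x | x. x \<in> J}" for y
    proof -
      obtain b where b: "y = \<alpha> * b" "b \<in> J" using y by blast
      have "x + y = \<alpha> * (a + b)" by (simp add: a b algebra_simps)
      then show ?thesis using J(3)[OF a(2) b(2)] by blast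
    qed
    show "r * x \<in> {\<alpha> * x | x. x \<in> J}" if "r \<in> OK" for r
    proof -
      have "r * x = \<alpha> * (r * a)" by (simp add: a algebra_simps)
      then show ?thesis using J(4)[OF a(2) that] by blast
    qed
  qed
qed

lemma two_generator_ideal: "ideal {of_int m * u + \<alpha> * v | u v. u \<in> OK \<and> v \<in> OK} (integers_ring K)"
  unfolding ideal_integers_ring_iff[OF subfield_K]
proof (intro conjI ballI)
  let ?J = "{of_int m * u + \<alpha> * v | u v. u \<in> OK \<and> v \<in> OK}"
  have I: "x \<in> ?J" if "x = of_int m * u + \<alpha> * v" "u \<in> OK" "v \<in> OK" for x u v using that by blast
  show "?J \<subseteq> OK"
  proof
    fix x assume "x \<in> ?J"
    then obtain u v where x: "x = of_int m * u + \<alpha> * v" "u \<in> OK" "v \<in> OK" by blast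
    show "x \<in> OK" unfolding x(1) by (intro OK_closed alpha_OK x)
  qed
  show "0 \<in> ?J" by (rule I[of _ 0 0]) (simp_all add: OK_closed(7))
  fix x assume "x \<in> ?J"
  then obtain u v where x: "x = of_int m * u + \<alpha> * v" "u \<in> OK" "v \<in> OK" by blast
  show "x + y \<in> ?J" if y: "y \<in> ?J" for y
  proof -
    obtain u' v' where y: "y = of_int m * u' + \<alpha> * v'" "u' \<in> OK" "v' \<in> OK" using y by blast
    show ?thesis by (rule I[of _ "u + u'" "v + v'"]) (simp_all add: x y OK_closed(1) algebra_simps)
  qed
  show "r * x \<in> ?J" if "r \<in> OK" for r
    by (rule I[of _ "r * u" "r * v"]) (simp_all add: x OK_closed(2)[OF that] algebra_simps)
qed

text \<open>A relative norm is a multiple of the element itself, so the norm ideal is contained in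
  A.\<close>

lemma alpha_mem_of_norm:
  assumes "ideal A (integers_ring L)" "norm_ideal A = alpha_ideal"
  shows "\<alpha> \<in> A"
proof -
  have A: "A \<subseteq> OL" "0 \<in> A" and add: "\<And>x y. x \<in> A \<Longrightarrow> y \<in> A \<Longrightarrow> x + y \<in> A"
    and mult: "\<And>x r. x \<in> A \<Longrightarrow> r \<in> OL \<Longrightarrow> r * x \<in> A"
    using assms(1) unfolding ideal_integers_ring_iff[OF subfield_L] by blast+
  have "ideal (A \<inter> OK) (integers_ring K)"
    unfolding ideal_integers_ring_iff[OF subfield_K]
    using A(2) add mult OK_closed(1,2,7) OL_of_OK by (intro conjI ballI IntI) auto
  moreover have "relnorm ` A \<subseteq> A \<inter> OK"
  proof
    fix y assume "y \<in> relnorm ` A"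
    then obtain x where x: "x \<in> A" "y = relnorm x" by blast
    then have "x \<in> OL" using A(1) by blast
    then have "\<sigma> x * x \<in> A" "relnorm x \<in> OK" using mult[OF x(1)] sigma_OL trace_norm_OK(2) by (auto simp: relnorm_def)
    then show "y \<in> A \<inter> OK" using x(2) by (simp add: relnorm_def mult.commute)
  qed
  ultimately have "norm_ideal A \<subseteq> A \<inter> OK"
    unfolding norm_ideal_eq(1)[OF A(1)] by (rule genideal_facts(3)[OF norm_ideal_eq(2)[OF A(1)]])
  moreover have "1 * \<alpha> \<in> alpha_ideal" unfolding alpha_ideal_def using OK_closed(6) by blast
  ultimately show ?thesis using assms(2) by auto
qed

lemma alpha_ideal_int: "of_int m \<in> alpha_ideal \<Longrightarrow> N dvd m"
  unfolding alpha_ideal_def using alpha_dvd_int[of _ m] by (auto simp: mult.commute)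

lemma hnf_ideal_subset_OL: "M dvd k\<^sup>2 + k - c \<Longrightarrow> hnf_ideal e M k \<subseteq> OL"
  using hnf_ideal_ideal unfolding ideal_integers_ring_iff[OF subfield_L] by blast

text \<open>The norms of the two generators and of their sum show that N divides e^2 M; let k' be
  the quotient. By \<open>relnorm_hnf_ideal\<close> the norm ideal lies in \<alpha> times the ideal
  (k', \<alpha>), which must therefore contain 1. Reading this modulo \<alpha> in the integers
  forces k' = 1, since k' divides N.\<close>

lemma hnf_norm_imp:
  assumes eM: "e > 0" "M > 0" "e * M dvd N" "M dvd k\<^sup>2 + k - c" and norm: "norm_ideal (hnf_ideal e M k) = alpha_ideal"
  shows "e\<^sup>2 * M = N"
proof -
  let ?A = "hnf_ideal e M k"
  have sub: "?A \<subseteq> OL" by (rule hnf_ideal_subset_OL[OF eM(4)])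
  have ideal: "ideal alpha_ideal (integers_ring K)" unfolding norm[symmetric] norm_ideal_eq(1)[OF sub]
    by (rule genideal_facts(1)[OF norm_ideal_eq(2)[OF sub]])
  have rel: "relnorm a \<in> alpha_ideal" if "a \<in> ?A" for a
    using that genideal_facts(2)[OF norm_ideal_eq(2)[OF sub]] unfolding norm[symmetric] norm_ideal_eq(1)[OF sub] by blast
  have I: "\<And>x y. x \<in> alpha_ideal \<Longrightarrow> y \<in> alpha_ideal \<Longrightarrow> x + y \<in> alpha_ideal" "\<And>x r. x \<in> alpha_ideal \<Longrightarrow> r \<in> OK \<Longrightarrow> r * x \<in> alpha_ideal"
    using ideal unfolding ideal_integers_ring_iff[OF subfield_K] by blast+
  have diff: "x - y \<in> alpha_ideal" if "x \<in> alpha_ideal" "y \<in> alpha_ideal" for x y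
    using I(1)[OF that(1) I(2)[OF that(2) OK_closed(5)[of "-1"]]] by simp
  define z1 z2 where "z1 = (of_int (e * M) :: complex)" and "z2 = of_int e * (of_int k + \<theta>)"
  have z: "z1 \<in> ?A" "z2 \<in> ?A" "z1 + z2 \<in> ?A"
    unfolding z1_def z2_def using hnf_ideal_generators(1,2) hnf_ideal_add by blast+
  have zL: "z1 \<in> OL" "z2 \<in> OL" using z sub by blast+
  \<comment> \<open>Polarization of the norm: what remains is the trace of z1 times the conjugate of
    z2, an integer.\<close>
  have "relnorm (z1 + z2) - relnorm z1 - relnorm z2 \<in> alpha_ideal" by (intro diff rel z)
  also have "relnorm (z1 + z2) - relnorm z1 - relnorm z2 = z1 * \<sigma> z2 + \<sigma> z1 * z2"
    unfolding relnorm_add[OF zL] by simp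
  also have "\<dots> = of_int (e\<^sup>2 * M * (2 * k + 1))"
    unfolding z1_def z2_def sigma_int sigma_scale[OF OK_closed(5) OL_closed(1)[OF OL_closed(5) theta_OL]] sigma_k_theta
    by (simp add: power2_eq_square algebra_simps)
  finally have 1: "N dvd e\<^sup>2 * M * (2 * k + 1)" by (rule alpha_ideal_int)
  have "relnorm z1 = of_int (e\<^sup>2 * M * M)" unfolding relnorm_def z1_def sigma_int by (simp add: power2_eq_square)
  then have 2: "N dvd e\<^sup>2 * M * M" using rel[OF z(1)] alpha_ideal_int by simp
  have "M dvd N" using eM(3) by (rule dvd_mult_right)
  then have "coprime M (2 * k + 1)" using hnf_coprime eM(4) by blast
  then obtain p q where pq: "p * M + q * (2 * k + 1) = 1" using bezout_int[of M "2 * k + 1"] by (auto simp: coprime_iff_gcd_eq_1)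
  have "N dvd (e\<^sup>2 * M * M) * p + (e\<^sup>2 * M * (2 * k + 1)) * q" by (rule dvd_add[OF dvd_mult2[OF 2] dvd_mult2[OF 1]])
  also have "\<dots> = e\<^sup>2 * M * (p * M + q * (2 * k + 1))" by (simp add: algebra_simps)
  finally have "N dvd e\<^sup>2 * M" unfolding pq by simp
  then obtain k' where k': "e\<^sup>2 * M = N * k'" by (elim dvdE)
  have k'_pos: "k' > 0"
  proof -
    have "N * k' > 0" unfolding k'[symmetric] using eM by simp
    then show ?thesis using N_pos by (simp add: zero_less_mult_iff)
  qed
  obtain j where j: "N = e * M * j" using eM(3) by (elim dvdE)
  have "e * M * e = e * M * (j * k')" using k' unfolding j by (simp add: power2_eq_square algebra_simps)
  then have ej: "e = j * k'" using eM by simp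
  let ?J = "{of_int k' * u + \<alpha> * v | u v. u \<in> OK \<and> v \<in> OK}"
  have "relnorm ` ?A \<subseteq> {\<alpha> * x | x. x \<in> ?J}"
    using relnorm_hnf_ideal[OF _ eM(4) k'] ej by fastforce
  then have "alpha_ideal \<subseteq> {\<alpha> * x | x. x \<in> ?J}"
    unfolding norm[symmetric] norm_ideal_eq(1)[OF sub]
    by (rule genideal_facts(3)[OF norm_ideal_eq(2)[OF sub] alpha_multiples_ideal[OF two_generator_ideal]])
  moreover have "1 * \<alpha> \<in> alpha_ideal" unfolding alpha_ideal_def using OK_closed(6) by blast
  ultimately have "1 * \<alpha> \<in> {\<alpha> * x | x. x \<in> ?J}" by blast
  then obtain u v where uv: "\<alpha> = \<alpha> * (of_int k' * u + \<alpha> * v)" "u \<in> OK" "v \<in> OK" by auto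
  then have 1: "of_int k' * u + \<alpha> * v = 1" using alpha_nonzero by simp
  obtain u0 u1 where u: "u = of_int u0 + of_int u1 * \<omega>" using integers_K_coords[OF uv(2)] by blast
  \<comment> \<open>Modulo \<alpha> the generator \<omega> is the integer (D1 D2 + n)/2, so u is
    congruent to h.\<close>
  define h where "h = u0 + u1 * ((D1 * D2 + n) div 2)"
  have "\<alpha> * (v + of_int (k' * u1)) = of_int (1 - k' * h)"
    using 1 unfolding u omega_alpha h_def by (simp add: algebra_simps)
  moreover have "v + of_int (k' * u1) \<in> OK" by (intro OK_closed uv)
  ultimately have "N dvd 1 - k' * h" using alpha_dvd_int by blast
  moreover have "k' dvd N" unfolding j ej by simp
  ultimately have "k' dvd 1 - k' * h" by (rule dvd_trans[rotated])
  then have "k' dvd 1" by (metis diff_add_cancel dvd_add dvd_triv_left)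
  then have "k' = 1" using k'_pos by simp
  then show ?thesis using k' by simp
qed

text \<open>One inclusion is the bound on norms for k' = 1. For the other, the norm ideal J must be
  shown to contain \<alpha>: it contains the multiples of \<alpha> by e, by n and by D1 D2, and
  these three integers have no common prime because D1 D2 is fundamental.\<close>

lemma hnf_norm:
  assumes eM: "e > 0" "M > 0" "e\<^sup>2 * M = N" "M dvd k\<^sup>2 + k - c"
  shows "norm_ideal (hnf_ideal e M k) = alpha_ideal"
proof
  let ?A = "hnf_ideal e M k"
  have sub: "?A \<subseteq> OL" by (rule hnf_ideal_subset_OL[OF eM(4)])
  note nI = norm_ideal_eq[OF sub]
  let ?J = "{of_int 1 * u + \<alpha> * v | u v. u \<in> OK \<and> v \<in> OK}"
  have "relnorm ` ?A \<subseteq> {\<alpha> * x | x. x \<in> ?J}"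
    using relnorm_hnf_ideal[OF _ eM(4), of _ e 1] eM(3) by fastforce
  then have "norm_ideal ?A \<subseteq> {\<alpha> * x | x. x \<in> ?J}" unfolding nI(1)
    by (rule genideal_facts(3)[OF nI(2) alpha_multiples_ideal[OF two_generator_ideal]])
  also have "\<dots> \<subseteq> alpha_ideal"
  proof
    fix y assume "y \<in> {\<alpha> * x | x. x \<in> ?J}"
    then obtain u v where y: "y = \<alpha> * (of_int 1 * u + \<alpha> * v)" "u \<in> OK" "v \<in> OK" by blast
    have "u + \<alpha> * v \<in> OK" by (intro OK_closed alpha_OK y)
    moreover have "y = (u + \<alpha> * v) * \<alpha>" by (simp add: y algebra_simps)
    ultimately show "y \<in> alpha_ideal" unfolding alpha_ideal_def by blast
  qed
  finally show "norm_ideal ?A \<subseteq> alpha_ideal" .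
  define J where "J = norm_ideal ?A"
  have ideal: "ideal J (integers_ring K)" unfolding J_def nI(1) by (rule genideal_facts(1)[OF nI(2)])
  have rel: "relnorm a \<in> J" if "a \<in> ?A" for a
    using that genideal_facts(2)[OF nI(2)] unfolding J_def nI(1) by blast
  have add: "\<And>x y. x \<in> J \<Longrightarrow> y \<in> J \<Longrightarrow> x + y \<in> J" and mult: "\<And>x r. x \<in> J \<Longrightarrow> r \<in> OK \<Longrightarrow> r * x \<in> J"
    using ideal unfolding ideal_integers_ring_iff[OF subfield_K] by blast+
  have imult: "of_int m * x \<in> J" if "x \<in> J" for m x by (rule mult[OF that OK_closed(5)])
  have diff: "x - y \<in> J" if "x \<in> J" "y \<in> J" for x y
    using add[OF that(1) imult[OF that(2), of "-1"]] by simp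
  have gcd_mem: "x \<in> J" if mem: "of_int a * x \<in> J" "of_int b * x \<in> J" "coprime a b" for a b :: int and x
  proof -
    obtain p q where pq: "p * a + q * b = 1" using bezout_int[of a b] mem(3) by (auto simp: coprime_iff_gcd_eq_1)
    have "of_int p * (of_int a * x) + of_int q * (of_int b * x) \<in> J" by (intro add imult mem)
    also have "of_int p * (of_int a * x) + of_int q * (of_int b * x) = of_int (p * a + q * b) * x" by (simp add: algebra_simps)
    finally show ?thesis unfolding pq by simp
  qed
  have "M dvd N" using eM(3) by (metis dvd_triv_right)
  then have cop: "coprime M (2 * k + 1)" using hnf_coprime eM(4) by blast
  define z1 z2 where "z1 = (of_int (e * M) :: complex)" and "z2 = of_int e * (of_int k + \<theta>)"
  have z: "z1 \<in> ?A" "z2 \<in> ?A" "z1 + z2 \<in> ?A"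
    unfolding z1_def z2_def using hnf_ideal_generators(1,2) hnf_ideal_add by blast+
  have zL: "z1 \<in> OL" "z2 \<in> OL" using z sub by blast+
  have \<sigma>z: "\<sigma> z1 = z1" "\<sigma> z2 = of_int e * (of_int k + 1 - \<theta>)"
    unfolding z1_def z2_def sigma_int sigma_scale[OF OK_closed(5) OL_closed(1)[OF OL_closed(5) theta_OL]] sigma_k_theta by simp_all
  \<comment> \<open>Polarizing the norm at x and \<alpha> r, both in the ideal, produces \<alpha>
    times a relative trace.\<close>
  have cross: "\<alpha> * (x * \<sigma> r + \<sigma> x * r) \<in> J" if "x \<in> ?A" "r \<in> OL" for x r
  proof -
    have xL: "x \<in> OL" using that sub by blast
    have ar: "\<alpha> * r \<in> ?A" "\<alpha> * r \<in> OL" using hnf_ideal_generators(3)[OF that(2)] sub by blast+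
    have "relnorm (x + \<alpha> * r) - relnorm x - relnorm (\<alpha> * r) \<in> J"
      by (intro diff rel hnf_ideal_add that ar)
    also have "relnorm (x + \<alpha> * r) - relnorm x - relnorm (\<alpha> * r) = \<alpha> * (x * \<sigma> r + \<sigma> x * r)"
      unfolding relnorm_add[OF xL ar(2)] sigma_scale[OF alpha_OK that(2)] by (simp add: algebra_simps)
    finally show ?thesis .
  qed
  \<comment> \<open>r = \<theta> and r = 1 give the traces e M and e (2k + 1), and M is coprime to
    2k + 1.\<close>
  have "\<alpha> * (z1 * \<sigma> \<theta> + \<sigma> z1 * \<theta>) \<in> J" by (rule cross[OF z(1) theta_OL])
  then have 1: "of_int M * (of_int e * \<alpha>) \<in> J" unfolding \<sigma>z sigma_theta by (simp add: z1_def algebra_simps)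
  have "\<alpha> * (z2 * \<sigma> 1 + \<sigma> z2 * 1) \<in> J" by (rule cross[OF z(2) OL_closed(6)])
  moreover have "\<alpha> * (z2 * \<sigma> 1 + \<sigma> z2 * 1) = of_int (2 * k + 1) * (of_int e * \<alpha>)"
    unfolding \<sigma>z unfolding z2_def using sigma_int[of 1] by (simp add: algebra_simps)
  ultimately have "of_int (2 * k + 1) * (of_int e * \<alpha>) \<in> J" by (simp only:)
  from gcd_mem[OF 1 this cop] have e\<alpha>: "of_int e * \<alpha> \<in> J" .
  \<comment> \<open>The same coprimality extracts N from the norm M N of z1 and the polarized value
    (2k + 1) N.\<close>
  have "relnorm z1 \<in> J" by (rule rel[OF z(1)])
  moreover have "relnorm z1 = of_int M * of_int N"
    unfolding relnorm_def \<sigma>z unfolding z1_def eM(3)[symmetric] by (simp add: power2_eq_square)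
  ultimately have 2: "of_int M * of_int N \<in> J" by (simp only:)
  have "relnorm (z1 + z2) - relnorm z1 - relnorm z2 \<in> J" by (intro diff rel z)
  also have "relnorm (z1 + z2) - relnorm z1 - relnorm z2 = z1 * \<sigma> z2 + \<sigma> z1 * z2"
    unfolding relnorm_add[OF zL] by simp
  also have "\<dots> = of_int (2 * k + 1) * of_int N"
    unfolding \<sigma>z unfolding z1_def z2_def eM(3)[symmetric] by (simp add: power2_eq_square algebra_simps)
  finally have "of_int (2 * k + 1) * of_int N \<in> J" .
  from gcd_mem[OF 2 this cop] have N_mem: "of_int N \<in> J" .
  have "relnorm (\<alpha> * 1) \<in> J" by (intro rel hnf_ideal_generators OL_closed)
  then have aa: "\<alpha> * \<alpha> \<in> J" using sigma_alpha by (simp add: relnorm_def)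
  \<comment> \<open>\<alpha> is a root of T^2 + n T - N.\<close>
  have n_mem: "of_int n * \<alpha> \<in> J"
  proof -
    have "of_int N - \<alpha> * \<alpha> \<in> J" by (intro diff N_mem aa)
    moreover have "of_int N - \<alpha> * \<alpha> = of_int n * \<alpha>" unfolding alpha_alpha'_N alpha'_eq by (simp add: algebra_simps)
    ultimately show ?thesis by simp
  qed
  \<comment> \<open>2 \<alpha> + n is s1 s2, so multiplying (2 \<alpha> + n) \<alpha> by s1 s2 gives
    D1 D2 \<alpha>.\<close>
  have D_mem: "of_int (D1 * D2) * \<alpha> \<in> J"
  proof -
    have "(s1 * s2) * (of_int 2 * (\<alpha> * \<alpha>) + of_int n * \<alpha>) \<in> J" by (intro mult add imult aa n_mem s12_OK)
    also have "(s1 * s2) * (of_int 2 * (\<alpha> * \<alpha>) + of_int n * \<alpha>) = (s1 * s2) * (2 * \<alpha> + of_int n) * \<alpha>" by (simp add: algebra_simps)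
    also have "\<dots> = of_int (D1 * D2) * \<alpha>" unfolding s12[symmetric] sq12 ..
    finally show ?thesis .
  qed
  \<comment> \<open>A common prime p would give D1 D2 = p^2 q with q a square modulo 4, contrary to
    fundamentality.\<close>
  have "coprime (gcd e n) (D1 * D2)"
  proof (rule coprime_intI_prime)
    fix p assume p: "prime p" "p dvd gcd e n" "p dvd D1 * D2"
    then obtain e' n' where e': "e = p * e'" "n = p * n'" by (auto elim!: dvdE)
    define q where "q = n'\<^sup>2 + 4 * (e'\<^sup>2 * M)"
    have eq: "D1 * D2 = p\<^sup>2 * q"
      using DN unfolding eM(3)[symmetric] e' q_def by (simp add: power2_eq_square algebra_simps)
    have "q mod 4 = n'\<^sup>2 mod 4" unfolding q_def by simp
    then show False
      using fundamentalD(2)[OF fund12 prime_gt_1_int[OF p(1)] eq] square_mod_4[of n'] by (auto split: if_splits)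
  qed
  moreover have "of_int (gcd e n) * \<alpha> \<in> J"
  proof -
    obtain p q where pq: "p * e + q * n = gcd e n" using bezout_int[of e n] by blast
    have "of_int p * (of_int e * \<alpha>) + of_int q * (of_int n * \<alpha>) \<in> J" by (intro add imult e\<alpha> n_mem)
    also have "of_int p * (of_int e * \<alpha>) + of_int q * (of_int n * \<alpha>) = of_int (p * e + q * n) * \<alpha>" by (simp add: algebra_simps)
    finally show ?thesis unfolding pq .
  qed
  ultimately have "\<alpha> \<in> J" using gcd_mem[OF _ D_mem] by blast
  then show "alpha_ideal \<subseteq> norm_ideal ?A" unfolding alpha_ideal_def J_def[symmetric] using mult by blast
qed

lemma root_cond: "4 * M dvd (2 * k + 1)\<^sup>2 - D \<longleftrightarrow> M dvd k\<^sup>2 + k - c"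
proof -
  have "(2 * k + 1)\<^sup>2 - D = 4 * (k\<^sup>2 + k - c)" by (subst D_decomp) (simp add: power2_eq_square algebra_simps)
  then show ?thesis by (simp only: dvd_mult_cancel_left) simp
qed

theorem bij_betw_ideals_of_norm:
  "bij_betw (\<lambda>(e, M, k). hnf_ideal e M k) (square_divisor_roots D N)
     (ideals_of_norm K L (PIdl\<^bsub>integers_ring K\<^esub> \<alpha>))"
proof -
  have a: "PIdl\<^bsub>integers_ring K\<^esub> \<alpha> = alpha_ideal" unfolding cgenideal_integers_ring alpha_ideal_def ..
  have mem: "e > 0" "M > 0" "e\<^sup>2 * M = N" "0 \<le> k" "k < M" "M dvd k\<^sup>2 + k - c" "e * M dvd N"
    if "(e, M, k) \<in> square_divisor_roots D N" for e M k
    using that root_cond unfolding square_divisor_roots_def by (auto simp: power2_eq_square)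
  show ?thesis
    unfolding bij_betw_def
  proof (intro conjI)
    show "inj_on (\<lambda>(e, M, k). hnf_ideal e M k) (square_divisor_roots D N)"
    proof (rule inj_onI, clarsimp)
      fix e M k e' M' k'
      assume *: "(e, M, k) \<in> square_divisor_roots D N" "(e', M', k') \<in> square_divisor_roots D N"
        and eq: "hnf_ideal e M k = hnf_ideal e' M' k'"
      note m = mem[OF *(1)] and m' = mem[OF *(2)]
      \<comment> \<open>Equal ideals contain each other's generator with least \<theta>-coordinate,
        so e and e' divide each other.\<close>
      have g: "of_int (e * k) + of_int e * \<theta> \<in> hnf_ideal e M k" "of_int (e' * k') + of_int e' * \<theta> \<in> hnf_ideal e' M' k'"
        using hnf_ideal_generators(2)[of e k M] hnf_ideal_generators(2)[of e' k' M'] by (simp_all add: algebra_simps)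
      obtain i j where ij: "e * k = i * (e' * M') + j * e' * k'" "e = j * e'"
        using g(1) unfolding eq mem_hnf_ideal_iff[OF m'(7)] by blast
      obtain i' j' where ij': "e' = j' * e"
        using g(2) unfolding eq[symmetric] mem_hnf_ideal_iff[OF m(7)] by blast
      have ee: "e = e'" using ij(2) ij' m(1) m'(1) by (metis dvd_triv_right zdvd_antisym_nonneg order_less_imp_le)
      have "e\<^sup>2 * M = e\<^sup>2 * M'" using m(3) m'(3) ee by simp
      then have MM: "M = M'" using m(1) by simp
      have "j = 1" using ij(2) m(1) unfolding ee[symmetric] by simp
      then have "e * k = e * (i * M + k')" using ij(1) unfolding ee[symmetric] MM[symmetric] by (simp add: algebra_simps)
      then have "k - k' = M * i" using m(1) by simp
      then have "M dvd k - k'" by simp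
      moreover have "\<bar>k - k'\<bar> < M" using m(4,5) m'(4,5) MM by auto
      ultimately have "k = k'" using dvd_imp_le_int[of "k - k'" M] by (cases "k = k'") auto
      then show "e = e' \<and> M = M' \<and> k = k'" using ee MM by blast
    qed
    show "(\<lambda>(e, M, k). hnf_ideal e M k) ` square_divisor_roots D N = ideals_of_norm K L (PIdl\<^bsub>integers_ring K\<^esub> \<alpha>)"
    proof (intro equalityI subsetI)
      fix A assume "A \<in> (\<lambda>(e, M, k). hnf_ideal e M k) ` square_divisor_roots D N"
      then obtain e M k where *: "(e, M, k) \<in> square_divisor_roots D N" "A = hnf_ideal e M k" by auto
      show "A \<in> ideals_of_norm K L (PIdl\<^bsub>integers_ring K\<^esub> \<alpha>)"
        unfolding ideals_of_norm_def a *(2) norm_ideal_def[symmetric]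
        using hnf_ideal_ideal[OF mem(6)[OF *(1)]] hnf_norm[OF mem(1,2,3,6)[OF *(1)]] by simp
    next
      fix A assume "A \<in> ideals_of_norm K L (PIdl\<^bsub>integers_ring K\<^esub> \<alpha>)"
      then have A: "ideal A (integers_ring L)" "norm_ideal A = alpha_ideal"
        unfolding ideals_of_norm_def a norm_ideal_def by auto
      obtain e M k where h: "e > 0" "M > 0" "0 \<le> k" "k < M" "e * M dvd N" "M dvd k\<^sup>2 + k - c" "A = hnf_ideal e M k"
        using ideal_is_hnf[OF A(1) alpha_mem_of_norm[OF A]] by blast
      have "e\<^sup>2 * M = N" by (rule hnf_norm_imp[OF h(1,2,5,6)]) (use A(2) h(7) in simp)
      then have "(e, M, k) \<in> square_divisor_roots D N" using h root_cond by (intro square_divisor_rootsI) auto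
      then show "A \<in> (\<lambda>(e, M, k). hnf_ideal e M k) ` square_divisor_roots D N" using h(7) by force
    qed
  qed
qed

end

section \<open>The main theorem\<close>

lemma bij_betw_quotient:
  assumes r: "equiv UNIV r" and mem: "\<And>x. x \<in> X \<Longrightarrow> f x \<in> Y" and surj: "\<And>y. y \<in> Y \<Longrightarrow> \<exists>x\<in>X. f x = y"
    and eq: "\<And>x x'. x \<in> X \<Longrightarrow> x' \<in> X \<Longrightarrow> f x = f x' \<longleftrightarrow> (x, x') \<in> r"
  shows "bij_betw (\<lambda>y. r `` {SOME x. x \<in> X \<and> f x = y}) Y (X // r)"
proof -
  define g where "g = (\<lambda>y. SOME x. x \<in> X \<and> f x = y)"
  have g: "g y \<in> X" "f (g y) = y" if "y \<in> Y" for y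
    using someI_ex[of "\<lambda>x. x \<in> X \<and> f x = y"] surj[OF that] unfolding g_def by blast+
  have class_eq: "r `` {x} = r `` {x'} \<longleftrightarrow> f x = f x'" if "x \<in> X" "x' \<in> X" for x x'
    using eq_equiv_class_iff[OF r] eq[OF that] by simp
  have "bij_betw (\<lambda>y. r `` {g y}) Y (X // r)"
    unfolding bij_betw_def
  proof (intro conjI equalityI subsetI)
    show "inj_on (\<lambda>y. r `` {g y}) Y"
    proof (rule inj_onI)
      fix y y' assume "y \<in> Y" "y' \<in> Y" "r `` {g y} = r `` {g y'}"
      then show "y = y'" using class_eq[of "g y" "g y'"] g by metis
    qed
  next
    fix C assume "C \<in> (\<lambda>y. r `` {g y}) ` Y"
    then show "C \<in> X // r" using g by (auto intro: quotientI)
  next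
    fix C assume "C \<in> X // r"
    then obtain x where x: "x \<in> X" "C = r `` {x}" by (rule quotientE)
    have "r `` {g (f x)} = r `` {x}" using class_eq[of "g (f x)" x] g[OF mem[OF x(1)]] x(1) by blast
    then show "C \<in> (\<lambda>y. r `` {g y}) ` Y" using mem[OF x(1)] x(2) by blast
  qed
  then show ?thesis unfolding g_def .
qed

section \<open>Change of basis and the number of classes\<close>

definition change_basis :: "int \<Rightarrow> int \<Rightarrow> int \<Rightarrow> int \<Rightarrow> qform \<times> qform \<Rightarrow> qform \<times> qform" where
  "change_basis x y z w = (\<lambda>(q1, q2). (qadd (qscale x q1) (qscale y q2), qadd (qscale z q1) (qscale w q2)))"

lemma change_basis_inverse:
  assumes "x * w - y * z = 1"
  shows "change_basis w (- y) (- z) x (change_basis x y z w q) = q"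
proof -
  obtain A1 B1 C1 A2 B2 C2 where q: "q = ((A1, B1, C1), (A2, B2, C2))" by (metis surj_pair)
  have "w * (x * X1 + y * X2) + - y * (z * X1 + w * X2) = X1" "- z * (x * X1 + y * X2) + x * (z * X1 + w * X2) = X2" for X1 X2
  proof -
    have "w * (x * X1 + y * X2) + - y * (z * X1 + w * X2) = (x * w - y * z) * X1"
      "- z * (x * X1 + y * X2) + x * (z * X1 + w * X2) = (x * w - y * z) * X2" by (simp_all add: algebra_simps)
    then show "w * (x * X1 + y * X2) + - y * (z * X1 + w * X2) = X1" "- z * (x * X1 + y * X2) + x * (z * X1 + w * X2) = X2"
      unfolding assms by simp_all
  qed
  then show ?thesis by (simp add: change_basis_def q)
qed

lemma change_basis_sim2:
  assumes "(q, q') \<in> sim2"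
  shows "(change_basis x y z w q, change_basis x y z w q') \<in> sim2"
proof -
  obtain q1 q2 q1' q2' where q: "q = (q1, q2)" "q' = (q1', q2')" by (cases q; cases q')
  obtain a b c d where *: "a * d - b * c = 1" "form_act a b c d q1 = q1'" "form_act a b c d q2 = q2'"
    using assms unfolding sim2_def q by blast
  have "form_act a b c d (qadd (qscale i q1) (qscale j q2)) = qadd (qscale i q1') (qscale j q2')" for i j
    by (simp add: form_act_linear *)
  then have "form_act a b c d (qadd (qscale x q1) (qscale y q2)) = qadd (qscale x q1') (qscale y q2')"
    "form_act a b c d (qadd (qscale z q1) (qscale w q2)) = qadd (qscale z q1') (qscale w q2')" by blast+
  with *(1) show ?thesis unfolding sim2_def change_basis_def q case_prod_conv mem_Collect_eq by blast
qed

lemma change_basis_form_pairs: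
  assumes "q \<in> form_pairs D1 D2 n"
  shows "change_basis x y z w q \<in> form_pairs (D1 * x\<^sup>2 + 2 * n * x * y + D2 * y\<^sup>2) (D1 * z\<^sup>2 + 2 * n * z * w + D2 * w\<^sup>2)
     (D1 * x * z + n * (x * w + y * z) + D2 * y * w)"
proof -
  obtain q1 q2 where q: "q = (q1, q2)" by (cases q)
  have B: "B_Delta q1 q1 = D1" "B_Delta q2 q2 = D2" "B_Delta q1 q2 = n" "B_Delta q2 q1 = n"
    using assms unfolding q form_pairs_altdef by (auto simp: B_Delta_commute)
  show ?thesis unfolding q change_basis_def case_prod_conv form_pairs_altdef B_Delta_bilinear B
    by (simp add: power2_eq_square algebra_simps)
qed

text \<open>The primitive vector (x, y) is completed to a basis change of determinant 1. It forms
  linear combinations of the two forms, hence commutes with substitutions of the variables, and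
  classes for D1, D2, n correspond to classes for D, E, m. Each triple (e, M, k) occurs with both
  signs of the Jacobian.\<close>

theorem num_classes_eq:
  fixes D1 D2 n N x y D :: int
  assumes eqN: "D1 * D2 - n\<^sup>2 = 4 * N" "N > 0" and D: "D = D1 * x\<^sup>2 + 2 * n * x * y + D2 * y\<^sup>2"
    and D4: "D mod 4 = 1" and cop: "coprime D N" "coprime x y"
  shows "finite (form_pair_classes D1 D2 n)" "num_classes D1 D2 n = 2 * card (square_divisor_roots D N)"
proof -
  obtain w z' where "w * x + z' * y = 1" using bezout_int[of x y] cop(2) by (auto simp: coprime_iff_gcd_eq_1)
  then obtain z where det: "x * w - y * z = 1" using that[of "- z'"] by (simp add: algebra_simps)
  define E where "E = D1 * z\<^sup>2 + 2 * n * z * w + D2 * w\<^sup>2"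
  define m where "m = D1 * x * z + n * (x * w + y * z) + D2 * y * w"
  have "D * E - m\<^sup>2 = (D1 * D2 - n\<^sup>2) * (x * w - y * z)\<^sup>2"
    unfolding D E_def m_def by (simp add: power2_eq_square algebra_simps)
  then have DE: "D * E - m\<^sup>2 = 4 * N" using eqN(1) det by simp
  interpret coprime_form_data D E m N by standard (use DE eqN(2) D4 cop in auto)
  define T where "T = change_basis x y z w"
  define T' where "T' = change_basis w (- y) (- z) x"
  have TT: "T' (T q) = q" "T (T' q) = q" for q
    unfolding T_def T'_def using change_basis_inverse[OF det] change_basis_inverse[of w x "- y" "- z"] det
    by (simp_all add: mult.commute)
  have T_mem: "T q \<in> form_pairs D E m" if "q \<in> form_pairs D1 D2 n" for q
    unfolding T_def D E_def m_def by (rule change_basis_form_pairs[OF that])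
  have T'_mem: "T' q \<in> form_pairs D1 D2 n" if "q \<in> form_pairs D E m" for q
  proof -
    have "D * w\<^sup>2 + 2 * m * w * (- y) + E * (- y)\<^sup>2 = D1 * (x * w - y * z)\<^sup>2"
      "D * (- z)\<^sup>2 + 2 * m * (- z) * x + E * x\<^sup>2 = D2 * (x * w - y * z)\<^sup>2"
      "D * w * (- z) + m * (w * x + (- y) * (- z)) + E * (- y) * x = n * (x * w - y * z)\<^sup>2"
      unfolding D E_def m_def by (simp_all add: power2_eq_square algebra_simps)
    then show ?thesis using change_basis_form_pairs[OF that, of w "- y" "- z" x] unfolding T'_def det by simp
  qed
  have T_sim: "(T q, T q') \<in> sim2 \<longleftrightarrow> (q, q') \<in> sim2" for q q'
    using change_basis_sim2[of q q' x y z w] change_basis_sim2[of "T q" "T q'" w "- y" "- z" x] TT(1)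
    unfolding T_def[symmetric] T'_def[symmetric] by auto
  define sig where "sig = (\<lambda>(q1, q2) ((e, M, k), s). signature_of q1 q2 e M k s)"
  have sig_unique: "v = v'" if "q \<in> form_pairs D E m" "sig q v" "sig q v'" for q v v'
  proof -
    obtain q1 q2 e M k s e' M' k' s' where eqs: "q = (q1, q2)" "v = ((e, M, k), s)" "v' = ((e', M', k'), s')"
      by (metis surj_pair)
    have "(e, M, k, s) = (e', M', k', s')"
      by (rule signature_of_unique[of q1 q2]) (use that in \<open>simp_all only: eqs sig_def case_prod_conv\<close>)
    then show ?thesis by (simp add: eqs)
  qed
  have sig_ex: "\<exists>v. sig q v" if mem: "q \<in> form_pairs D E m" for q
  proof -
    obtain q1 q2 where q: "q = (q1, q2)" by (cases q)
    obtain e M k s where "signature_of q1 q2 e M k s" using signature_of_exists[OF mem[unfolded q]] by blast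
    then have "sig q ((e, M, k), s)" by (simp add: sig_def q)
    then show ?thesis by blast
  qed
  define f where "f = (\<lambda>q. SOME v. sig (T q) v)"
  have f: "sig (T q) (f q)" if "q \<in> form_pairs D1 D2 n" for q
    unfolding f_def by (rule someI_ex[OF sig_ex[OF T_mem[OF that]]])
  define Y where "Y = square_divisor_roots D N \<times> {1, - 1 :: int}"
  have bij: "bij_betw (\<lambda>y. sim2 `` {SOME x. x \<in> form_pairs D1 D2 n \<and> f x = y}) Y (form_pairs D1 D2 n // sim2)"
  proof (rule bij_betw_quotient[OF equiv_sim2])
    fix q assume q: "q \<in> form_pairs D1 D2 n"
    obtain q1 q2 where Tq: "T q = (q1, q2)" by (cases "T q")
    obtain e M k s where fq: "f q = ((e, M, k), s)" by (metis surj_pair)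
    have sig: "signature_of q1 q2 e M k s" using f[OF q] unfolding Tq fq sig_def by simp
    have "lead_minor q1 q2 \<noteq> 0"
      using lead_minor_form_act(2)[of D E m q1 q2 1 1 0 0 1] DE eqN(2) T_mem[OF q] unfolding Tq by simp
    moreover have "(e, M, k) \<in> square_divisor_roots D N" "sgn (lead_minor q1 q2) = s"
      using sig unfolding signature_of_def by blast+
    ultimately show "f q \<in> Y" unfolding fq Y_def by (cases "lead_minor q1 q2 > 0") auto
  next
    fix v assume "v \<in> Y"
    then obtain e M k s where v: "v = ((e, M, k), s)" "(e, M, k) \<in> square_divisor_roots D N" "s = 1 \<or> s = - 1"
      unfolding Y_def by auto
    obtain q1 q2 where q: "(q1, q2) \<in> form_pairs D E m" "signature_of q1 q2 e M k s"
      using signature_of_surj[OF v(2,3)] by blast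
    have "sig (T (T' (q1, q2))) (f (T' (q1, q2)))" by (rule f[OF T'_mem[OF q(1)]])
    moreover have "sig (q1, q2) v" using q(2) by (simp add: sig_def v)
    ultimately have "f (T' (q1, q2)) = v" using sig_unique[OF q(1)] unfolding TT(2) by blast
    then show "\<exists>q\<in>form_pairs D1 D2 n. f q = v" using T'_mem[OF q(1)] by blast
  next
    fix q q' assume q: "q \<in> form_pairs D1 D2 n" "q' \<in> form_pairs D1 D2 n"
    obtain q1 q2 q1' q2' where Tq: "T q = (q1, q2)" "T q' = (q1', q2')" by (cases "T q"; cases "T q'")
    have mem: "(q1, q2) \<in> form_pairs D E m" "(q1', q2') \<in> form_pairs D E m" using T_mem q unfolding Tq[symmetric] by blast+
    show "f q = f q' \<longleftrightarrow> (q, q') \<in> sim2"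
    proof
      assume "f q = f q'"
      then have sig: "sig (T q) (f q)" "sig (T q') (f q)" using f[OF q(1)] f[OF q(2)] by simp_all
      obtain e M k s where fq: "f q = ((e, M, k), s)" by (metis surj_pair)
      have "((q1, q2), (q1', q2')) \<in> sim2"
        by (rule signature_of_imp_sim2[OF mem]) (use sig in \<open>simp_all only: Tq fq sig_def case_prod_conv\<close>)
      then have "(T q, T q') \<in> sim2" unfolding Tq .
      then show "(q, q') \<in> sim2" using T_sim by blast
    next
      assume "(q, q') \<in> sim2"
      then have "((q1, q2), (q1', q2')) \<in> sim2" using T_sim[of q q'] unfolding Tq by blast
      then obtain a b c d where act: "a * d - b * c = 1" "form_act a b c d q1 = q1'" "form_act a b c d q2 = q2'"
        unfolding sim2_def by blast
      obtain e M k s where fq: "f q = ((e, M, k), s)" by (metis surj_pair)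
      have "signature_of q1 q2 e M k s" using f[OF q(1)] by (simp only: Tq fq sig_def case_prod_conv)
      from signature_of_form_act[OF mem(1) this act(1)] have "sig (q1', q2') (f q)"
        by (simp only: act(2,3) fq sig_def case_prod_conv)
      then show "f q = f q'" using sig_unique[OF mem(2)] f[OF q(2)] unfolding Tq by blast
    qed
  qed
  have "finite Y" unfolding Y_def using finite_square_divisor_roots[OF eqN(2)] by simp
  then show "finite (form_pair_classes D1 D2 n)"
    using bij_betw_finite[OF bij] unfolding form_pair_classes_def by simp
  show "num_classes D1 D2 n = 2 * card (square_divisor_roots D N)"
    using bij_betw_same_card[OF bij] unfolding num_classes_def form_pair_classes_def Y_def
    by (simp add: card_cartesian_product)
qed

text \<open>x collects the primes of 2N that divide D1, y all the others. At a prime of the first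
  kind the value is D2 y^2, at one of the second kind D1 x^2, and neither vanishes modulo that
  prime.\<close>

lemma coprime_value_exists:
  fixes D1 D2 n N :: int
  assumes "coprime D1 D2" "N > 0"
  shows "\<exists>x y. coprime x y \<and> coprime (D1 * x\<^sup>2 + 2 * n * x * y + D2 * y\<^sup>2) (2 * N)"
proof -
  define P where "P = prime_factors (nat (2 * N))"
  define x where "x = (\<Prod>p\<in>{p \<in> P. int p dvd D1}. int p)"
  define y where "y = (\<Prod>p\<in>{p \<in> P. \<not> int p dvd D1}. int p)"
  have prime: "prime p" if "p \<in> P" for p using that by (auto simp: P_def)
  have cop: "coprime x y"
    unfolding x_def y_def
  proof (intro prod_coprime_left prod_coprime_right)
    fix p q assume "p \<in> {p \<in> P. int p dvd D1}" "q \<in> {p \<in> P. \<not> int p dvd D1}"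
    then have "prime p" "prime q" "p \<noteq> q" using prime by auto
    then show "coprime (int p) (int q)" by (simp add: primes_coprime)
  qed
  have "coprime (D1 * x\<^sup>2 + 2 * n * x * y + D2 * y\<^sup>2) (2 * N)"
  proof (rule coprime_intI_prime)
    fix p assume p: "prime p" "p dvd D1 * x\<^sup>2 + 2 * n * x * y + D2 * y\<^sup>2" "p dvd 2 * N"
    have no: False if "p dvd a" "p dvd b" "coprime a b" for a b
      using that p(1) by (meson coprime_common_divisor not_prime_unit)
    have p0: "p > 0" using p(1) by (rule prime_gt_0_int)
    have "nat p dvd nat (2 * N)" using p(3) p0 by (simp add: nat_dvd_iff)
    moreover have "prime (nat p)" using p(1) by (rule prime_int_nat_transfer[THEN iffD1, THEN conjunct2])
    moreover have "nat (2 * N) \<noteq> 0" using assms(2) by simp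
    ultimately have mem: "nat p \<in> P" unfolding P_def in_prime_factors_iff by blast
    show False
    proof (cases "p dvd D1")
      case True
      have "int (nat p) dvd x" unfolding x_def using True mem p0 by (intro dvd_prodI) (auto simp: P_def)
      then have px: "p dvd x" using p0 by simp
      have "p dvd (D1 * x\<^sup>2 + 2 * n * x * y + D2 * y\<^sup>2) - x * (D1 * x + 2 * n * y)" using p(2) px by (intro dvd_diff dvd_mult2)
      also have "\<dots> = D2 * y\<^sup>2" by (simp add: power2_eq_square algebra_simps)
      finally have "p dvd D2 \<or> p dvd y" using p(1) prime_dvd_mult_iff prime_dvd_power by blast
      then show False using no[OF True _ assms(1)] no[OF px _ cop] by blast
    next
      case False
      have "int (nat p) dvd y" unfolding y_def using False mem p0 by (intro dvd_prodI) (auto simp: P_def)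
      then have py: "p dvd y" using p0 by simp
      have "p dvd (D1 * x\<^sup>2 + 2 * n * x * y + D2 * y\<^sup>2) - y * (2 * n * x + D2 * y)" using p(2) py by (intro dvd_diff dvd_mult2)
      also have "\<dots> = D1 * x\<^sup>2" by (simp add: power2_eq_square algebra_simps)
      finally have "p dvd D1 \<or> p dvd x" using p(1) prime_dvd_mult_iff prime_dvd_power by blast
      then show False using False no[OF _ py cop] by blast
    qed
  qed
  then show ?thesis using cop by blast
qed

text \<open>Dividing w^2 = E D by y^2 = E modulo p exhibits w / y as a root of D.\<close>

lemma QuadRes_transfer:
  assumes "prime (p::int)" "\<not> p dvd E" "p dvd E * D - w\<^sup>2" "QuadRes p E"
  shows "QuadRes p D"
proof -
  obtain y where y: "p dvd y\<^sup>2 - E" using assms(4) by (auto simp: QuadRes_def cong_iff_dvd_diff)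
  have "\<not> p dvd y"
  proof
    assume "p dvd y"
    then have "p dvd y\<^sup>2" by (simp add: power2_eq_square)
    then have "p dvd y\<^sup>2 - (y\<^sup>2 - E)" using y by (rule dvd_diff)
    then show False using assms(2) by simp
  qed
  then have "coprime p y" using assms(1) by (rule prime_imp_coprime[rotated])
  then obtain u v where uv: "u * p + v * y = 1" using bezout_int[of p y] by (auto simp: coprime_iff_gcd_eq_1)
  then have vy: "v * y = 1 - u * p" by simp
  have "(w * v)\<^sup>2 - D = - (v\<^sup>2 * (E * D - w\<^sup>2)) - v\<^sup>2 * D * (y\<^sup>2 - E) + D * ((v * y)\<^sup>2 - 1)"
    by (simp add: power2_eq_square algebra_simps)
  moreover have "(v * y)\<^sup>2 - 1 = p * (u\<^sup>2 * p - 2 * u)" unfolding vy by (simp add: power2_eq_square algebra_simps)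
  moreover have "p dvd - (v\<^sup>2 * (E * D - w\<^sup>2)) - v\<^sup>2 * D * (y\<^sup>2 - E) + D * (p * (u\<^sup>2 * p - 2 * u))"
  proof (rule dvd_add[OF dvd_diff])
    show "p dvd - (v\<^sup>2 * (E * D - w\<^sup>2))" using dvd_mult[OF assms(3)] unfolding dvd_minus_iff .
    show "p dvd v\<^sup>2 * D * (y\<^sup>2 - E)" by (rule dvd_mult[OF y])
    show "p dvd D * (p * (u\<^sup>2 * p - 2 * u))" by simp
  qed
  ultimately have "p dvd (w * v)\<^sup>2 - D" by simp
  then show ?thesis unfolding QuadRes_def cong_iff_dvd_diff by blast
qed

text \<open>E D is a square modulo 4p and prime to p, so the two symbols agree. For p = 2 the factor
  4 supplies the modulus 8, where E and D, both 1 modulo 4, can only be 1 or 5.\<close>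

lemma kronecker_prime_transfer:
  assumes "prime p" "\<not> int p dvd E" "\<not> int p dvd D" "E mod 4 = 0 \<or> E mod 4 = 1" "D mod 4 = 1" "4 * int p dvd E * D - w\<^sup>2"
  shows "kronecker_prime E p = kronecker_prime D p"
proof (cases "p = 2")
  case True
  then have "odd E" "odd D" using assms by auto
  then have E4: "E mod 4 = 1" using assms(4) by auto
  have d8: "8 dvd E * D - w\<^sup>2" using assms(6) True by simp
  then have "even (E * D - w\<^sup>2)" by (rule dvd_trans[rotated]) simp
  then have "odd w" using \<open>odd E\<close> \<open>odd D\<close> by simp
  then obtain k where k: "w = 2 * k + 1" by (elim oddE)
  have "even (k * (k + 1))" by simp
  then obtain t where t: "k * (k + 1) = 2 * t" by (elim evenE)
  have w2: "w\<^sup>2 = 8 * t + 1"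
  proof -
    have "w\<^sup>2 = 4 * (k * (k + 1)) + 1" by (simp add: k power2_eq_square algebra_simps)
    then show ?thesis unfolding t by simp
  qed
  have "E * D mod 8 = 1" using d8 unfolding w2 by presburger
  then have m: "(E mod 8) * (D mod 8) mod 8 = 1" by (simp add: mod_mult_eq)
  have "E mod 8 = 1 \<or> E mod 8 = 5" "D mod 8 = 1 \<or> D mod 8 = 5" using E4 assms(5) by presburger+
  then have "E mod 8 = D mod 8" using m by auto
  then show ?thesis using True \<open>odd E\<close> \<open>odd D\<close> by (simp add: kronecker_prime_def)
next
  case False
  have p: "prime (int p)" using assms(1) by simp
  have d: "int p dvd E * D - w\<^sup>2" using assms(6) by (rule dvd_mult_right)
  then have d': "int p dvd D * E - w\<^sup>2" by (simp add: mult.commute)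
  have "QuadRes (int p) E \<longleftrightarrow> QuadRes (int p) D"
    using QuadRes_transfer[OF p assms(2) d] QuadRes_transfer[OF p assms(3) d'] by blast
  then show ?thesis using False assms(2,3) by (simp add: kronecker_prime_def Legendre_def cong_0_iff)
qed

lemma kronecker_prime_zero: "prime p \<Longrightarrow> int p dvd E \<Longrightarrow> kronecker_prime E p = 0"
  by (auto simp: kronecker_prime_def Legendre_def cong_0_iff)

text \<open>Completing the square shows that D1 D and D2 D are squares modulo 4p, so whichever of
  D1, D2 is prime to p has the same symbol as D. The other one, if divisible by p, has symbol 0, and
  coprimality prevents this from happening to both.\<close>

lemma eps_prime_eq:
  fixes D1 D2 n N x y D :: int
  assumes p: "prime p" "int p dvd N" and DN: "D1 * D2 - n\<^sup>2 = 4 * N"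
    and D: "D = D1 * x\<^sup>2 + 2 * n * x * y + D2 * y\<^sup>2" "D mod 4 = 1" "coprime D N"
    and D12: "coprime D1 D2" "D1 mod 4 = 0 \<or> D1 mod 4 = 1" "D2 mod 4 = 0 \<or> D2 mod 4 = 1"
  shows "eps_prime D1 D2 p = kronecker_prime D p" "kronecker_prime D p = 1 \<or> kronecker_prime D p = - 1"
proof -
  have no: False if "int p dvd a" "int p dvd b" "coprime a b" for a b
    using that p(1) by (meson coprime_common_divisor not_prime_unit prime_nat_int_transfer)
  have pD: "\<not> int p dvd D" using no[OF _ p(2) D(3)] by blast
  show v: "kronecker_prime D p = 1 \<or> kronecker_prime D p = - 1" by (rule kronecker_prime_root(1)[OF p(1) pD D(2)])
  have DD: "D1 * D2 = n\<^sup>2 + 4 * N" using DN by simp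
  have "D1 * D - (D1 * x + n * y)\<^sup>2 = (D1 * D2 - n\<^sup>2) * y\<^sup>2" unfolding D(1) by (simp add: power2_eq_square algebra_simps)
  also have "\<dots> = 4 * (N * y\<^sup>2)" unfolding DN by simp
  finally have 1: "4 * int p dvd D1 * D - (D1 * x + n * y)\<^sup>2" using p(2) by (simp add: mult_dvd_mono)
  have "D2 * D - (D2 * y + n * x)\<^sup>2 = (D1 * D2 - n\<^sup>2) * x\<^sup>2" unfolding D(1) by (simp add: power2_eq_square algebra_simps)
  also have "\<dots> = 4 * (N * x\<^sup>2)" unfolding DN by simp
  finally have 2: "4 * int p dvd D2 * D - (D2 * y + n * x)\<^sup>2" using p(2) by (simp add: mult_dvd_mono)
  have k1: "if int p dvd D1 then kronecker_prime D1 p = 0 else kronecker_prime D1 p = kronecker_prime D p"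
    using kronecker_prime_zero[OF p(1)] kronecker_prime_transfer[OF p(1) _ pD D12(2) D(2) 1] by simp
  have k2: "if int p dvd D2 then kronecker_prime D2 p = 0 else kronecker_prime D2 p = kronecker_prime D p"
    using kronecker_prime_zero[OF p(1)] kronecker_prime_transfer[OF p(1) _ pD D12(3) D(2) 2] by simp
  show "eps_prime D1 D2 p = kronecker_prime D p"
    unfolding eps_prime_def using k1 k2 v no[OF _ _ D12(1)]
    by (intro the_equality) (auto split: if_splits)
qed

text \<open>A prime of value -1 contributes 1 at an even exponent and annihilates the product at an
  odd one.\<close>

lemma prod_local_count:
  assumes "finite A" "\<And>p. p \<in> A \<Longrightarrow> v p = 1 \<or> v p = (- 1 :: int)"
  shows "(\<Prod>p\<in>A. local_count (v p) (m p)) =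
     (if {p \<in> A. v p = - 1 \<and> odd (m p)} = {} then (\<Prod>p\<in>{p \<in> A. v p = 1}. m p + 1) else 0)"
proof (cases "{p \<in> A. v p = - 1 \<and> odd (m p)} = {}")
  case True
  have "(\<Prod>p\<in>A. local_count (v p) (m p)) = (\<Prod>p\<in>{p \<in> A. v p = 1}. local_count (v p) (m p))"
    using assms True by (intro prod.mono_neutral_right) (auto simp: local_count_def)
  also have "\<dots> = (\<Prod>p\<in>{p \<in> A. v p = 1}. m p + 1)" by (intro prod.cong) (auto simp: local_count_def)
  finally show ?thesis using True by simp
next
  case False
  then obtain p where "p \<in> A" "v p = - 1" "odd (m p)" by auto
  then have "local_count (v p) (m p) = 0" by (simp add: local_count_def)
  then show ?thesis using \<open>p \<in> A\<close> assms(1) False by (simp add: prod_zero_iff) blast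
qed

text \<open>For positive radicands the principal roots are the real square roots, which are
  multiplicative.\<close>

lemma csqrt_of_int_mult:
  assumes "D1 > 0" "D2 > 0"
  shows "csqrt (of_int (D1 * D2)) = csqrt (of_int D1) * csqrt (of_int D2)"
proof -
  have "csqrt (of_int E) = of_real (sqrt (of_int E))" if "E > 0" for E :: int
    using that csqrt_of_real_nonneg[of "of_int E"] by simp
  then show ?thesis using assms by (simp add: real_sqrt_mult mult_pos_pos del: of_int_mult) (simp add: real_sqrt_mult)
qed

text \<open>The two finiteness clauses belong to the conclusion because \<open>card\<close> is 0 on
  infinite sets; with them \<open>num_classes\<close> and \<open>num_ideals_of_norm\<close> are
  genuine counts. The number r of the factorization is \<open>card P\<close>.\<close>

theorem theorem3:
  fixes D1 D2 n :: int and N :: nat and P Q W :: "nat set" and K L \<aa> :: "complex set"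
  assumes "pos_fundamental_disc D1" and "pos_fundamental_disc D2" and "coprime D1 D2"
    and "\<bar>real_of_int n\<bar> < sqrt (real_of_int (D1 * D2))"
    and "[n = D1 * D2] (mod 2)"
    and N: "N = nat ((D1 * D2 - n\<^sup>2) div 4)"
    and P: "P = {p \<in> prime_factors N. eps D1 D2 p = - 1 \<and> odd (multiplicity p N)}"
    and Q: "Q = {q \<in> prime_factors N. eps D1 D2 q = - 1 \<and> even (multiplicity q N)}"
    and W: "W = {w \<in> prime_factors N. eps D1 D2 w = 1}"
    and K: "K = adjoin {csqrt (of_int (D1 * D2))}"
    and L: "L = adjoin {csqrt (of_int D1), csqrt (of_int D2)}"
    and \<aa>: "\<aa> = PIdl\<^bsub>integers_ring K\<^esub> ((csqrt (of_int (D1 * D2)) - of_int n) / 2)"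
  shows "D1 * D2 - n\<^sup>2 = 4 * int ((\<Prod>p\<in>P. p ^ multiplicity p N) * (\<Prod>q\<in>Q. q ^ multiplicity q N)
                                   * (\<Prod>w\<in>W. w ^ multiplicity w N)) \<and>
    finite (form_pair_classes D1 D2 n) \<and>
    finite (ideals_of_norm K L \<aa>) \<and>
    (num_classes D1 D2 n = 0 \<longleftrightarrow> card P > 0) \<and>
    (card P = 0 \<longrightarrow> num_classes D1 D2 n = 2 * (\<Prod>w\<in>W. multiplicity w N + 1)) \<and>
    int (num_classes D1 D2 n) = 2 * (\<Sum>d | d dvd N. eps D1 D2 d) \<and>
    num_classes D1 D2 n = 2 * num_ideals_of_norm K L \<aa>"
proof -
  note fund1 = pos_fundamental_disc_imp_fundamental[OF assms(1)]
  note fund2 = pos_fundamental_disc_imp_fundamental[OF assms(2)]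
  note m1 = fundamentalD(1)[OF fund1(1)] and m2 = fundamentalD(1)[OF fund2(1)]
  have n_lt: "n\<^sup>2 < D1 * D2"
  proof -
    have "\<bar>real_of_int n\<bar>\<^sup>2 < (sqrt (real_of_int (D1 * D2)))\<^sup>2" using assms(4) by (intro power_strict_mono) auto
    also have "\<dots> = real_of_int (D1 * D2)" using fund1(2) fund2(2) by (intro real_sqrt_pow2) simp
    finally have "real_of_int (n\<^sup>2) < real_of_int (D1 * D2)" by simp
    then show ?thesis by (simp only: of_int_less_iff)
  qed
  have par: "n mod 2 = D1 * D2 mod 2" using assms(5) by (simp add: cong_def)
  have d4: "4 dvd D1 * D2 - n\<^sup>2"
  proof -
    define X where "X = D1 * D2"
    have "X mod 4 = (D1 mod 4) * (D2 mod 4) mod 4" by (simp add: X_def mod_mult_eq)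
    then have X4: "X mod 4 = 0 \<or> X mod 4 = 1" using m1 m2 by auto
    have "X mod 4 = n\<^sup>2 mod 4"
    proof (cases "even n")
      case True
      then have "even X" using par by (simp only: X_def even_iff_mod_2_eq_zero)
      then have "X mod 4 = 0" using X4 by presburger
      then show ?thesis using True square_mod_4[of n] by simp
    next
      case False
      then have "odd X" using par by (simp only: X_def even_iff_mod_2_eq_zero) simp
      then have "X mod 4 = 1" using X4 by presburger
      then show ?thesis using False square_mod_4[of n] by simp
    qed
    then show ?thesis unfolding X_def by (simp add: mod_eq_dvd_iff)
  qed
  have DN: "D1 * D2 - n\<^sup>2 = 4 * int N" using d4 n_lt unfolding N by (auto elim!: dvdE)
  have N_pos: "N > 0" using DN n_lt by simp
  obtain x y where xy: "coprime x y" "coprime (D1 * x\<^sup>2 + 2 * n * x * y + D2 * y\<^sup>2) (2 * int N)"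
    using coprime_value_exists[OF assms(3), of "int N" n] N_pos by auto
  define D where "D = D1 * x\<^sup>2 + 2 * n * x * y + D2 * y\<^sup>2"
  have cop: "coprime D (int N)" "odd D" using xy(2) unfolding D_def[symmetric] by simp_all
  \<comment> \<open>With l and k the residues of D1 and D2 modulo 4, both 0 or 1, the form is the
    square of l x + k y modulo 4; so an odd value is 1.\<close>
  have D4: "D mod 4 = 1"
  proof -
    obtain a l where a: "D1 = 4 * a + l" "l = 0 \<or> l = 1" using m1 by (metis mult_div_mod_eq)
    obtain b k where b: "D2 = 4 * b + k" "k = 0 \<or> k = 1" using m2 by (metis mult_div_mod_eq)
    have "even (n - l * k)"
    proof -
      have "even (n - D1 * D2)" using assms(5) by (simp add: cong_iff_dvd_diff)
      moreover have "n - l * k = n - D1 * D2 + 2 * (8 * a * b + 2 * a * k + 2 * b * l)" unfolding a b by (simp add: algebra_simps)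
      ultimately show ?thesis by (simp only: dvd_add dvd_triv_left)
    qed
    then obtain h where h: "n = l * k + 2 * h" by (metis add.commute diff_eq_eq dvdE)
    have D_sq: "D = (l * x + k * y)\<^sup>2 + 4 * (a * x\<^sup>2 + h * x * y + b * y\<^sup>2)"
      using a(2) b(2) unfolding D_def a(1) b(1) h by (auto simp: power2_eq_square algebra_simps)
    have "D mod 4 = (l * x + k * y)\<^sup>2 mod 4" unfolding D_sq by (rule mod_mult_self2)
    moreover have "odd (l * x + k * y)"
    proof
      assume "even (l * x + k * y)"
      then have "even D" unfolding D_sq by simp
      then show False using cop(2) by blast
    qed
    ultimately show ?thesis using square_mod_4[of "l * x + k * y"] by simp
  qed
  define s1 s2 where "s1 = csqrt (of_int D1)" and "s2 = csqrt (of_int D2)"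
  have s12: "csqrt (of_int (D1 * D2)) = s1 * s2" unfolding s1_def s2_def
    by (rule csqrt_of_int_mult) (use fund1 fund2 in auto)
  have sq: "s1 * s1 = of_int D1" "s2 * s2 = of_int D2" unfolding s1_def s2_def by (rule complex_csqrt_square)+
  have N0: "int N > 0" using N_pos by simp
  interpret V: biquadratic_value D1 D2 s1 s2 n "int N" x y D
    by standard (rule sq fund1 fund2 assms(3) DN N0 D_def D4 cop(1))+
  have KK: "K = V.K" unfolding K s12 V.K_def by (rule adjoin_single) (simp only: V.sq12 Rats_of_int)
  have LL: "L = V.L" unfolding L s1_def[symmetric] s2_def[symmetric] by (rule V.L_eq_adjoin[symmetric])
  have bij: "bij_betw (\<lambda>(e, M, k). V.hnf_ideal e M k) (square_divisor_roots D (int N)) (ideals_of_norm K L \<aa>)"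
    unfolding \<aa> KK LL s12 V.\<alpha>_def[symmetric] by (rule V.bij_betw_ideals_of_norm)
  have fin_roots: "finite (square_divisor_roots D (int N))" using N_pos by (intro finite_square_divisor_roots) simp
  note classes = num_classes_eq[OF DN N0 D_def D4 cop(1) xy(1)]
  have eps: "eps_prime D1 D2 p = kronecker_prime D p" "eps_prime D1 D2 p = 1 \<or> eps_prime D1 D2 p = - 1" "eps D1 D2 p = eps_prime D1 D2 p"
    if "p \<in> prime_factors N" for p
  proof -
    have p: "prime p" "int p dvd int N" using that by auto
    note e = eps_prime_eq[OF p DN D_def D4 cop(1) assms(3) m1 m2]
    show "eps_prime D1 D2 p = kronecker_prime D p" by (rule e(1))
    show "eps_prime D1 D2 p = 1 \<or> eps_prime D1 D2 p = - 1" using e by simp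
    show "eps D1 D2 p = eps_prime D1 D2 p" using eps_prime_power[OF p(1), of D1 D2 1] by simp
  qed
  define c where "c = (\<Prod>p\<in>prime_factors N. local_count (eps D1 D2 p) (multiplicity p N))"
  have card_c: "card (square_divisor_roots D (int N)) = c"
    unfolding c_def card_square_divisor_roots[OF N_pos cop(1) D4] by (intro prod.cong) (simp_all add: eps)
  have "(\<Sum>d | d dvd N. eps D1 D2 d) = (\<Prod>p\<in>prime_factors N. int (local_count (eps_prime D1 D2 p) (multiplicity p N)))"
    by (rule sum_divisors_eps[OF N_pos eps(2)])
  also have "\<dots> = int c" unfolding c_def of_nat_prod by (intro prod.cong) (simp_all add: eps(3))
  finally have sum_c: "(\<Sum>d | d dvd N. eps D1 D2 d) = int c" .
  have c_eq: "c = (if P = {} then (\<Prod>w\<in>W. multiplicity w N + 1) else 0)"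
    unfolding c_def P W using eps by (intro prod_local_count) auto
  have PQW: "(\<Prod>p\<in>P. p ^ multiplicity p N) * (\<Prod>q\<in>Q. q ^ multiplicity q N) * (\<Prod>w\<in>W. w ^ multiplicity w N) = N"
  proof -
    have fin: "finite P" "finite Q" "finite W" unfolding P Q W by simp_all
    have "prime_factors N = P \<union> Q \<union> W" unfolding P Q W using eps(2,3) by force
    moreover have "P \<inter> Q = {}" "(P \<union> Q) \<inter> W = {}" unfolding P Q W by auto
    ultimately have "(\<Prod>p\<in>prime_factors N. p ^ multiplicity p N) =
        (\<Prod>p\<in>P. p ^ multiplicity p N) * (\<Prod>q\<in>Q. q ^ multiplicity q N) * (\<Prod>w\<in>W. w ^ multiplicity w N)"
      using fin by (simp add: prod.union_disjoint)
    then show ?thesis using prod_prime_factors[of N] N_pos by simp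
  qed
  have "finite P" unfolding P by simp
  then have cardP: "card P = 0 \<longleftrightarrow> P = {}" by simp
  have num: "num_classes D1 D2 n = 2 * c" using classes(2) card_c by simp
  have ideals: "finite (ideals_of_norm K L \<aa>)" "num_ideals_of_norm K L \<aa> = c"
    using bij_betw_finite[OF bij] fin_roots bij_betw_same_card[OF bij] card_c by (simp_all add: num_ideals_of_norm_def)
  have "(\<Prod>w\<in>W. multiplicity w N + 1) \<noteq> 0" by (simp add: W)
  then have zero: "num_classes D1 D2 n = 0 \<longleftrightarrow> card P > 0" unfolding num c_eq using cardP by auto
  show ?thesis
    unfolding PQW using DN classes(1) ideals zero num cardP c_eq sum_c by simp
qed

end
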